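(* Let $n>2$ and let $p\in\Omega$. Let $\rho>0$ be a continuously differentiable function of $Q\ge 0$ satisfying: there is a constant $C_0>0$ such that $H'(Q)\leq C_0\,\rho(Q)$ wherever $\rho'(Q)>0$, and $H'(Q)\geq C_0^{-1}\rho(Q)$ wherever $\rho'(Q)<0$. Let the 1-forms $\Gamma=d\eta$ and $\omega$ smoothly satisfy, on $\Omega\setminus\{p\}$, $$d\omega=\Gamma\wedge\omega,\qquad \delta\left[\rho(Q)\omega\right]=\ast\left(\Gamma\wedge\ast\rho(Q)\omega\right),\qquad Q=|\omega|^2 .$$ Suppose that $H=H(Q)\in L^{2n/(n-2)}(\Omega)$, that the function $f\equiv|\nabla\Gamma|+|\Gamma|^2$ is sufficiently small in $L^{n/2}(\Omega)$, and that in addition $f$ satisfies the growth condition $$\int_{B_r(\mathbf{x}_0)\cap\Omega}|f|^{n/2}d\Omega\leq C_1r^\kappa$$ for some $\kappa>0$ and $C_1>0$ (for all $\mathbf{x}_0$ and $r>0$), where $B_r(\mathbf{x}_0)$ is the $n$-ball of radius $r$ centered at $\mathbf{x}_0$. Then $Q\rho(Q)$ is locally bounded above on $\Omega$ by the $L^2$-norm of $H$: for any concentric balls $D_R(\mathbf{x}_0)\subset D_{R+a_0}(\mathbf{x}_0)\subset\subset\Omega$ with $R,a_0>0$ (possibly containing $p$) there is a constant $C$, depending only on $n$, $C_0$, $\Gamma$ and the two balls, such that $$\sup_{D_R(\mathbf{x}_0)\setminus\{p\}}Q\rho(Q)\leq C\,\|H(Q)\|_{L^2(D_{R+a_0}(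\mathbf{x}_0))}.$$
   Context: $\Omega$ is an open, bounded domain of $\mathbb{R}^n$ satisfying an interior sphere condition. Forms are scalar-valued; $\ast$ is the Euclidean Hodge star, $\langle\alpha,\beta\rangle=\ast(\alpha\wedge\ast\beta)$, $|\alpha|^2=\langle\alpha,\alpha\rangle$; $d$ is the exterior derivative with formal adjoint $\delta$, where $\delta\alpha=(-1)^{nk+n+1}\ast d\ast\alpha$ for $\alpha\in\Lambda^k$ (so $\delta\alpha=-\partial_i\alpha_i$ on 1-forms). $Q=|\omega|^2$ is viewed as a function of $\mathbf{x}$. The function $H$ is defined by $H'(Q)=\frac12\rho(Q)+Q\rho'(Q)$ (prime is $d/dQ$), normalized by $H(0)=0$. "Sufficiently small in $L^{n/2}(\Omega)$" means that $\|f\|_{L^{n/2}(\Omega)}$ is less than some positive constant depending only on $n$ and $C_0$. *)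

theory Defs
  imports "HOL-Analysis.Analysis"
begin

text \<open>
  An exterior form on Euclidean space is given by its coefficients with respect to the basis
  \<open>dx I\<close>, where \<open>I\<close> ranges over the sets of coordinate indices and \<open>dx I\<close> is the wedge product of
  the coordinate differentials with indices in \<open>I\<close>, taken in increasing order.  The linear order of
  the index type also fixes the orientation of the space.
\<close>

type_synonym 'n covec = "(real, 'n set) vec"
type_synonym 'n form = "(real, 'n) vec \<Rightarrow> (real, 'n set) vec"

definition form_on :: "nat \<Rightarrow> (real^'n) set \<Rightarrow> 'n::finite form \<Rightarrow> bool" where
  "form_on k S \<alpha> \<longleftrightarrow> (\<forall>x\<in>S. \<forall>I. card I \<noteq> k \<longrightarrow> \<alpha> x $ I = 0)"

text \<open>For disjoint \<open>I\<close> and \<open>J\<close> one has \<open>dx I \<and> dx J = shuffle_sign I J dx (I \<union> J)\<close>: the exponent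
  counts the inversions of the concatenated index sequence.\<close>

definition shuffle_sign :: "'n::{finite,linorder} set \<Rightarrow> 'n set \<Rightarrow> real" where
  "shuffle_sign I J = (-1) ^ card {(i, j). i \<in> I \<and> j \<in> J \<and> j < i}"

definition wedge :: "'n::{finite,linorder} covec \<Rightarrow> 'n covec \<Rightarrow> 'n covec"
    (infixr "\<and>\<^sub>e" 70) where
  "\<alpha> \<and>\<^sub>e \<beta> = (\<chi> K. \<Sum>I\<in>Pow K. shuffle_sign I (K - I) * \<alpha> $ I * \<beta> $ (K - I))"

text \<open>The Hodge star sends \<open>dx I\<close> to \<open>shuffle_sign I (- I) dx (- I)\<close>.\<close>

definition hodge_star :: "'n::{finite,linorder} covec \<Rightarrow> 'n covec" where
  "hodge_star \<alpha> = (\<chi> K. shuffle_sign (- K) K * \<alpha> $ (- K))"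

text \<open>\<open>\<langle>\<alpha>, \<beta>\<rangle> = *(\<alpha> \<and> *\<beta>)\<close>, read off as the coefficient of the resulting 0-form.\<close>

definition form_inner :: "'n::{finite,linorder} covec \<Rightarrow> 'n covec \<Rightarrow> real" where
  "form_inner \<alpha> \<beta> = hodge_star (\<alpha> \<and>\<^sub>e hodge_star \<beta>) $ {}"

definition form_norm :: "'n::{finite,linorder} covec \<Rightarrow> real" where
  "form_norm \<alpha> = sqrt (form_inner \<alpha> \<alpha>)"

definition partial_deriv :: "'n::finite \<Rightarrow> 'n form \<Rightarrow> 'n form" where
  "partial_deriv i \<alpha> x = frechet_derivative \<alpha> (at x) (axis i 1)"

definition ext_deriv :: "'n::{finite,linorder} form \<Rightarrow> 'n form" where
  "ext_deriv \<alpha> x = (\<Sum>i\<in>UNIV. axis {i} 1 \<and>\<^sub>e partial_deriv i \<alpha> x)"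

text \<open>The formal adjoint of the exterior derivative; \<open>k\<close> is the degree of \<open>\<alpha>\<close>.\<close>

definition codiff :: "nat \<Rightarrow> 'n::{finite,linorder} form \<Rightarrow> 'n form" where
  "codiff k \<alpha> x =
     (-1) ^ (CARD('n) * k + CARD('n) + 1) *\<^sub>R hodge_star (ext_deriv (\<lambda>y. hodge_star (\<alpha> y)) x)"

definition grad_norm :: "'n::{finite,linorder} form \<Rightarrow> (real, 'n) vec \<Rightarrow> real" where
  "grad_norm \<alpha> x = sqrt (\<Sum>i\<in>UNIV. (form_norm (partial_deriv i \<alpha> x))\<^sup>2)"

primrec Ck_on ::
    "nat \<Rightarrow> 'a::real_normed_vector set \<Rightarrow> ('a \<Rightarrow> 'b::real_normed_vector) \<Rightarrow> bool" where
  "Ck_on 0 S f \<longleftrightarrow> continuous_on S f"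
| "Ck_on (Suc k) S f \<longleftrightarrow> (\<forall>x\<in>S. f differentiable (at x)) \<and>
     (\<forall>v. Ck_on k S (\<lambda>x. frechet_derivative f (at x) v))"

definition smooth_on ::
    "'a::real_normed_vector set \<Rightarrow> ('a \<Rightarrow> 'b::real_normed_vector) \<Rightarrow> bool" where
  "smooth_on S f \<longleftrightarrow> (\<forall>k. Ck_on k S f)"

definition interior_sphere_condition :: "'a::euclidean_space set \<Rightarrow> bool" where
  "interior_sphere_condition S \<longleftrightarrow>
     (\<forall>y\<in>frontier S. \<exists>c r. r > 0 \<and> ball c r \<subseteq> S \<and> y \<in> sphere c r)"

definition Lp_on :: "real \<Rightarrow> 'a::euclidean_space set \<Rightarrow> ('a \<Rightarrow> real) \<Rightarrow> bool" where
  "Lp_on q S f \<longleftrightarrow> set_borel_measurable lebesgue S f \<and>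
     set_integrable lebesgue S (\<lambda>x. \<bar>f x\<bar> powr q)"

text \<open>Only meaningful if \<open>Lp_on q S f\<close> holds: otherwise the integral is the default value 0.\<close>

definition Lp_norm :: "real \<Rightarrow> 'a::euclidean_space set \<Rightarrow> ('a \<Rightarrow> real) \<Rightarrow> real" where
  "Lp_norm q S f = (LINT x:S|lebesgue. \<bar>f x\<bar> powr q) powr (1 / q)"

end

theory Submission
  imports Defs
begin

text \<open>
  In coordinates the system says that \<open>V = \<rho>(Q) \<omega>\<close> has divergence \<open>- \<langle>\<Gamma>, V\<rangle>\<close> and that the curl of
  \<open>\<omega>\<close> is \<open>\<Gamma> \<and> \<omega>\<close>.  Testing the differentiated equation with \<open>\<phi> \<omega>\<close> gives, as in Bochner's
  formula, that \<open>u = H(Q)\<close> is a weak subsolution away from \<open>p\<close>: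
  \<open>\<integral> a \<bullet> \<nabla>\<phi> \<le> C \<integral> (|\<Gamma>|\<^sup>2 u \<phi> + |\<Gamma>| u |\<nabla>\<phi>|)\<close>, where \<open>a\<close> is the image of \<open>\<nabla>u\<close> under a matrix whose
  ellipticity depends only on \<open>C\<^sub>0\<close>.  As \<open>|\<Gamma>|\<^sup>2 \<le> f\<close>, the growth condition and Young's
  inequality give a Morrey condition for \<open>|\<Gamma>|\<^sup>2\<close>, and then \<open>\<integral> |\<Gamma>|\<^sup>2 \<phi>\<^sup>2\<close> is absorbed by the Dirichlet
  integral at a small scale.  The same trace inequality with weight \<open>|\<phi>|\<close> to the power \<open>2/n\<close>
  replaces the Sobolev inequality in Moser's iteration.  Cutoff functions vanishing near \<open>p\<close> are
  removed by means of \<open>u \<in> L\<close> with exponent \<open>2n/(n-2)\<close>, applied to powers of \<open>u\<close> truncated to linear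
  growth.  Finally \<open>Q \<rho>(Q)\<close> is bounded by a multiple of \<open>H(Q)\<close>.
\<close>

section \<open>Test functions and integration by parts\<close>

text \<open>Two obstacles shape the proof. The function \<rho> is only continuously differentiable,
  so the field V has no second derivatives and its equation cannot be differentiated literally. What
  replaces this is an identity that lets two first partial derivatives trade places under the
  integral; applied to the components of V and of the test form, it turns one side into a product of
  two divergences, which the equations determine. The second obstacle is the point p. A cutoff with
  gradient of order j on a ball of radius of order 1/j costs the integral of the square of j times
  the truncated power of u. Linear growth of the truncation bounds this by the square of j u, and
  that is what the integrability exponent of u sends to 0. Within each Moser step the cutoff at p is
  removed first, at a fixed truncation level, and the truncation second; hence higher integrability
  of u is always a conclusion, never an assumption. The hypotheses on \<rho> enter only through
  two-sided bounds of H' by multiples of \<rho>: where the sign of \<rho>' leaves a hypothesis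
  silent, the formula for H' supplies the bound.\<close>

definition C1_grad_on :: "'a::euclidean_space set \<Rightarrow> ('a \<Rightarrow> real) \<Rightarrow> ('a \<Rightarrow> 'a) \<Rightarrow> bool" where
  "C1_grad_on U f g \<longleftrightarrow> (\<forall>x\<in>U. GDERIV f x :> g x) \<and> continuous_on U g"

text \<open>The gradient is carried as a second function, and the regularity holds on the whole
  space, so that all integrals run over \<open>lborel\<close> without boundary terms.
  \<open>K\<close> is kept explicit because it is the set on which continuity yields
  integrability.\<close>

definition test_fun ::
    "'a::euclidean_space set \<Rightarrow> 'a set \<Rightarrow> ('a \<Rightarrow> real) \<Rightarrow> ('a \<Rightarrow> 'a) \<Rightarrow> bool" where
  "test_fun U K f g \<longleftrightarrow> compact K \<and> K \<subseteq> U \<and> C1_grad_on UNIV f g \<and> (\<forall>x. x \<notin> K \<longrightarrow> f x = 0)"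

lemma GDERIV_unique: "GDERIV f x :> a \<Longrightarrow> GDERIV f x :> b \<Longrightarrow> a = b"
proof -
  assume "GDERIV f x :> a" "GDERIV f x :> b"
  then have "(\<lambda>h. h \<bullet> a) = (\<lambda>h. h \<bullet> b)"
    unfolding gderiv_def by (rule has_derivative_unique)
  then have "\<forall>h. h \<bullet> a = h \<bullet> b" by (simp add: fun_eq_iff)
  then show "a = b" by (simp only: vector_eq_ldot)
qed

lemma C1_grad_on_continuous: "C1_grad_on U f g \<Longrightarrow> continuous_on U f"
  unfolding C1_grad_on_def gderiv_def
  by (meson continuous_at_imp_continuous_on has_derivative_continuous)

lemma C1_grad_on_subset: "C1_grad_on U f g \<Longrightarrow> V \<subseteq> U \<Longrightarrow> C1_grad_on V f g"
  unfolding C1_grad_on_def using continuous_on_subset by blast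

lemma C1_grad_on_mult:
  "C1_grad_on U f g \<Longrightarrow> C1_grad_on U f' g' \<Longrightarrow>
    C1_grad_on U (\<lambda>x. f x * f' x) (\<lambda>x. f x *\<^sub>R g' x + f' x *\<^sub>R g x)"
  using C1_grad_on_continuous[of U f g] C1_grad_on_continuous[of U f' g']
  unfolding C1_grad_on_def by (auto intro!: GDERIV_mult continuous_intros)

text \<open>The outer function is differentiated only within \<open>S\<close>. The case needed is
  \<open>S = {0..}\<close>: \<rho>, \<open>H\<close> and the truncated powers have a one-sided
  derivative at 0, a value that the inner function may attain.\<close>

lemma GDERIV_compose_within:
  assumes "GDERIV f x :> D" "(h has_real_derivative h') (at (f x) within S)"
    "open U" "x \<in> U" "f ` U \<subseteq> S"
  shows "GDERIV (\<lambda>x. h (f x)) x :> h' *\<^sub>R D"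
proof -
  have "(f has_derivative (\<lambda>h. h \<bullet> D)) (at x within U)"
    using assms(1) unfolding gderiv_def by (rule has_derivative_at_withinI)
  moreover have "(h has_derivative (\<lambda>y. h' * y)) (at (f x) within f ` U)"
    using has_derivative_subset[OF assms(2)[unfolded has_field_derivative_def] assms(5)] .
  ultimately have "((\<lambda>x. h (f x)) has_derivative (\<lambda>y. h' * (y \<bullet> D))) (at x within U)"
    by (rule has_derivative_in_compose)
  then show ?thesis
    unfolding gderiv_def at_within_open[OF assms(4,3)] by simp
qed

lemma test_fun_grad_zero: "test_fun U K f g \<Longrightarrow> x \<notin> K \<Longrightarrow> g x = 0"
proof -
  assume a: "test_fun U K f g" "x \<notin> K"
  then have "open (- K)" "x \<in> - K" "\<And>y. y \<in> - K \<Longrightarrow> f y = 0" "GDERIV f x :> g x"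
    by (auto simp: test_fun_def C1_grad_on_def compact_imp_closed)
  then have "GDERIV f x :> 0"
    using has_derivative_transform_within_open[OF GDERIV_const[of "0::real" x, unfolded gderiv_def], of "- K" f]
    unfolding gderiv_def by simp
  with \<open>GDERIV f x :> g x\<close> show ?thesis using GDERIV_unique by blast
qed

lemma continuous_on_mult_compact_support:
  fixes f :: "'a::t2_space \<Rightarrow> real" and g :: "'a \<Rightarrow> 'b::real_normed_vector"
  assumes "open U" "compact K" "K \<subseteq> U" "continuous_on U f" "continuous_on U g"
    "\<And>x. x \<notin> K \<Longrightarrow> g x = 0"
  shows "continuous_on UNIV (\<lambda>x. f x *\<^sub>R g x)"
proof -
  have "continuous_on U (\<lambda>x. f x *\<^sub>R g x)" using assms by (intro continuous_intros)
  moreover have "continuous_on (- K) (\<lambda>x. f x *\<^sub>R g x)"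
    using assms(6) by (subst continuous_on_cong[where g="\<lambda>_. 0"]) auto
  moreover have "U \<union> - K = UNIV" using assms(3) by auto
  ultimately show ?thesis
    using continuous_on_open_Un[of U "- K"] assms(1,2)
    by (metis compact_imp_closed open_Compl)
qed

lemma integrable_compact_support:
  fixes f :: "'a::euclidean_space \<Rightarrow> 'b::{banach,second_countable_topology}"
  assumes "compact K" "continuous_on K f" "\<And>x. x \<notin> K \<Longrightarrow> f x = 0"
  shows "integrable lborel f"
proof -
  have "(\<lambda>x. indicator K x *\<^sub>R f x) = f" using assms(3) by (auto simp: indicator_def)
  with borel_integrable_compact[OF assms(1,2)] show ?thesis by simp
qed

text \<open>Nothing is known of \<open>v\<close> off \<open>U\<close>, but there the product
  vanishes on the open set \<open>- K\<close>, and \<open>U\<close> and \<open>- K\<close> cover the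
  space. In this way functions of the solution, regular only away from the point \<open>p\<close>,
  become global test functions.\<close>

lemma test_fun_mult:
  assumes "open U" "C1_grad_on U v gv" "test_fun U K w gw"
  shows "test_fun U K (\<lambda>x. v x * w x) (\<lambda>x. v x *\<^sub>R gw x + w x *\<^sub>R gv x)"
proof -
  have K: "compact K" "K \<subseteq> U" "C1_grad_on UNIV w gw" "\<And>x. x \<notin> K \<Longrightarrow> w x = 0"
    "\<And>x. x \<notin> K \<Longrightarrow> gw x = 0"
    using assms(3) test_fun_grad_zero[OF assms(3)] by (auto simp: test_fun_def)
  have c: "continuous_on U v" "continuous_on UNIV w" "continuous_on U gv" "continuous_on UNIV gw"
    using C1_grad_on_continuous assms(2) K(3) unfolding C1_grad_on_def by blast+
  have "GDERIV (\<lambda>x. v x * w x) x :> v x *\<^sub>R gw x + w x *\<^sub>R gv x" for x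
  proof (cases "x \<in> U")
    case True
    then show ?thesis using assms(2) K(3) by (auto simp: C1_grad_on_def intro!: GDERIV_mult)
  next
    case False
    then have x: "x \<in> - K" "open (- K)" using K by (auto intro: open_Compl compact_imp_closed)
    have "GDERIV (\<lambda>x. v x * w x) x :> 0"
      using has_derivative_transform_within_open[OF GDERIV_const[of "0::real" x, unfolded gderiv_def], of "- K" "\<lambda>x. v x * w x"]
        x K(4) unfolding gderiv_def by simp
    then show ?thesis using x K by simp
  qed
  moreover have "continuous_on UNIV (\<lambda>x. v x *\<^sub>R gw x + w x *\<^sub>R gv x)"
  proof (rule continuous_on_add)
    show "continuous_on UNIV (\<lambda>x. v x *\<^sub>R gw x)"
      using continuous_on_mult_compact_support[of U K v gw] assms(1) K c
        continuous_on_subset[OF c(4)] by auto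
    have "continuous_on U (\<lambda>x. w x *\<^sub>R gv x)"
      using c continuous_on_subset[OF c(2)] by (intro continuous_intros) auto
    moreover have "continuous_on (- K) (\<lambda>x. w x *\<^sub>R gv x)"
      using K(4) by (subst continuous_on_cong[where g="\<lambda>_. 0"]) auto
    moreover have "U \<union> - K = UNIV" using K by auto
    ultimately show "continuous_on UNIV (\<lambda>x. w x *\<^sub>R gv x)"
      using continuous_on_open_Un[of U "- K"] assms(1) K(1)
      by (metis compact_imp_closed open_Compl)
  qed
  ultimately show ?thesis using K by (auto simp: test_fun_def C1_grad_on_def)
qed

lemma LIMSEQ_divide_Suc: "(\<lambda>j. c / real (Suc j)) \<longlonglongrightarrow> 0"
  by (rule real_tendsto_divide_at_top[OF tendsto_const])
    (rule filterlim_compose[OF filterlim_real_sequentially filterlim_Suc])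

text \<open>Dominated convergence: on \<open>K\<close> the mean value inequality bounds the
  quotients by a bound \<open>L\<close> for the gradient. The weight \<open>w\<close> is only
  bounded and measurable because it will also be an indicator, or a derivative cut off by an
  indicator.\<close>

lemma difference_quotient_LIMSEQ:
  fixes v :: "'a::euclidean_space \<Rightarrow> real"
  assumes "open U" "C1_grad_on U v gv" "compact K" "w \<in> borel_measurable borel"
    "\<And>x. \<bar>w x\<bar> \<le> B" "\<And>x. x \<notin> K \<Longrightarrow> w x = 0" "d > 0"
    "\<And>x. x \<in> K \<Longrightarrow> cball x d \<subseteq> U" "norm e \<le> 1"
  shows "(\<lambda>j. LINT x|lborel. (v (x + (d / Suc j) *\<^sub>R e) - v x) / (d / Suc j) * w x)
    \<longlonglongrightarrow> (LINT x|lborel. (gv x \<bullet> e) * w x)"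
proof -
  define Kd where "Kd = {x + y | x y. x \<in> K \<and> y \<in> cball 0 d}"
  have Kd: "compact Kd" unfolding Kd_def by (intro compact_sums assms compact_cball)
  have KdI: "x \<in> K \<Longrightarrow> norm y \<le> d \<Longrightarrow> x + y \<in> Kd" for x y unfolding Kd_def by force
  have KdU: "Kd \<subseteq> U"
  proof
    fix z assume "z \<in> Kd"
    then obtain x y where "x \<in> K" "norm y \<le> d" "z = x + y" unfolding Kd_def by auto
    then have "z \<in> cball x d" by (simp add: dist_norm)
    then show "z \<in> U" using assms(8) \<open>x \<in> K\<close> by blast
  qed
  have KU: "K \<subseteq> U" using assms(7,8) by fastforce
  have gc: "continuous_on U gv" using assms(2) by (simp add: C1_grad_on_def)
  have vc: "continuous_on U v" using C1_grad_on_continuous assms(2) by blast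
  have "bounded (gv ` Kd)"
    using Kd gc KdU compact_continuous_image compact_imp_bounded continuous_on_subset by metis
  then obtain L where L: "\<And>x. x \<in> Kd \<Longrightarrow> norm (gv x) \<le> L" "L \<ge> 0"
    by (metis bounded_pos image_eqI less_imp_le)
  define t where "t j = d / real (Suc j)" for j
  have t: "t j > 0" "t j \<le> d" "norm (t j *\<^sub>R e) \<le> d" for j
  proof -
    show "t j > 0" unfolding t_def using assms(7) by auto
    show "t j \<le> d" unfolding t_def using assms(7) by (simp add: divide_le_eq)
    then have "t j * norm e \<le> d * 1" using assms(7,9) \<open>t j > 0\<close> by (intro mult_mono) auto
    then show "norm (t j *\<^sub>R e) \<le> d" using \<open>t j > 0\<close> by simp
  qed
  have mv: "\<bar>v (x + t j *\<^sub>R e) - v x\<bar> \<le> L * t j" if "x \<in> K" for x j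
  proof -
    have sub: "x + y \<in> Kd" if "norm y \<le> d" for y using KdI \<open>x \<in> K\<close> that by auto
    have cv: "convex (cball x d)" by simp
    have in1: "cball x d \<subseteq> Kd"
    proof
      fix z assume "z \<in> cball x d"
      then show "z \<in> Kd" using sub[of "z - x"] by (simp add: dist_norm norm_minus_commute)
    qed
    have "norm (v (x + t j *\<^sub>R e) - v x) \<le> L * norm (x + t j *\<^sub>R e - x)"
    proof (rule differentiable_bound[OF cv])
      show "(v has_derivative (\<lambda>h. h \<bullet> gv z)) (at z within cball x d)" if "z \<in> cball x d" for z
        using assms(2) in1 KdU that has_derivative_at_withinI unfolding C1_grad_on_def gderiv_def
        by blast
      show "onorm (\<lambda>h. h \<bullet> gv z) \<le> L" if "z \<in> cball x d" for z
      proof (rule onorm_le)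
        show "norm (h \<bullet> gv z) \<le> L * norm h" for h
          using Cauchy_Schwarz_ineq2[of h "gv z"] L(1)[of z] in1 that
          by (smt (verit, ccfv_threshold) mult.commute mult_left_mono norm_ge_zero real_norm_def subsetD)
      qed
      show "x + t j *\<^sub>R e \<in> cball x d" using t(3)[of j] by (simp add: dist_norm)
    qed (use assms(7) in auto)
    also have "\<dots> \<le> L * t j"
      using t(1)[of j] assms(9) L(2) by (simp add: mult_left_mono mult_left_le)
    finally show ?thesis by simp
  qed
  define s where "s j x = (v (x + t j *\<^sub>R e) - v x) / t j * w x" for j x
  have meas: "s j \<in> borel_measurable borel" for j
  proof -
    have "x + t j *\<^sub>R e \<in> U" if "x \<in> K" for x
      using KdI[OF that t(3)] KdU by blast
    then have "continuous_on K (\<lambda>x. (v (x + t j *\<^sub>R e) - v x) / t j)"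
      using t(1)[of j] KU
      by (intro continuous_intros continuous_on_compose2[OF vc] continuous_on_subset[OF vc]) auto
    then have "(\<lambda>x. indicator K x *\<^sub>R ((v (x + t j *\<^sub>R e) - v x) / t j)) \<in> borel_measurable borel"
      using assms(3) by (intro borel_measurable_continuous_on_indicator) (auto intro: borel_closed compact_imp_closed)
    then have "(\<lambda>x. (indicator K x *\<^sub>R ((v (x + t j *\<^sub>R e) - v x) / t j)) * w x) \<in> borel_measurable borel"
      using assms(4) by (intro borel_measurable_times)
    also have "(\<lambda>x. (indicator K x *\<^sub>R ((v (x + t j *\<^sub>R e) - v x) / t j)) * w x) = s j"
      using assms(6) by (force simp: s_def indicator_def)
    finally show ?thesis .
  qed
  have lim: "(\<lambda>j. s j x) \<longlonglongrightarrow> (gv x \<bullet> e) * w x" for x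
  proof (cases "x \<in> K")
    case True
    have "(v has_derivative (\<lambda>h. h \<bullet> gv x)) (at x)"
      using assms(2) KU True unfolding C1_grad_on_def gderiv_def by auto
    then have "((\<lambda>h. v (x + h *\<^sub>R e)) has_derivative (\<lambda>h. (h *\<^sub>R e) \<bullet> gv x)) (at 0)"
      by (intro has_derivative_compose[where g=v and f="\<lambda>h. x + h *\<^sub>R e" and g'="\<lambda>h. h \<bullet> gv x"])
        (auto intro!: derivative_eq_intros)
    then have "((\<lambda>h. v (x + h *\<^sub>R e)) has_real_derivative (e \<bullet> gv x)) (at 0)"
      by (simp add: has_field_derivative_def mult_commute_abs)
    then have l: "((\<lambda>h. (v (x + h *\<^sub>R e) - v x) / h) \<longlongrightarrow> (e \<bullet> gv x)) (at 0)"
      by (simp add: DERIV_def)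
    have "t \<longlonglongrightarrow> 0" unfolding t_def by (rule LIMSEQ_divide_Suc)
    then have "filterlim t (at 0) sequentially"
      using t(1) by (auto simp: filterlim_at eventually_sequentially less_imp_neq[symmetric]) 
    from filterlim_compose[OF l this]
    have "(\<lambda>j. (v (x + t j *\<^sub>R e) - v x) / t j) \<longlonglongrightarrow> gv x \<bullet> e" by (simp add: inner_commute)
    then show ?thesis unfolding s_def by (intro tendsto_intros)
  qed (use assms(6) in \<open>auto simp: s_def\<close>)
  have "(\<lambda>j. integral\<^sup>L lborel (s j)) \<longlonglongrightarrow> (LINT x|lborel. (gv x \<bullet> e) * w x)"
  proof (rule integral_dominated_convergence[where w="\<lambda>x. indicator K x *\<^sub>R (L * B)"])
    show "integrable lborel (\<lambda>x. indicator K x *\<^sub>R (L * B))"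
      by (intro borel_integrable_compact assms continuous_intros)
    show "s j \<in> borel_measurable lborel" for j using meas by simp
    show "(\<lambda>x. (gv x \<bullet> e) * w x) \<in> borel_measurable lborel"
      using borel_measurable_LIMSEQ_metric[OF meas lim] by simp
    show "AE x in lborel. (\<lambda>j. s j x) \<longlonglongrightarrow> (gv x \<bullet> e) * w x" using lim by simp
    show "AE x in lborel. norm (s j x) \<le> indicator K x *\<^sub>R (L * B)" for j
    proof (rule AE_I2)
      fix x
      show "norm (s j x) \<le> indicator K x *\<^sub>R (L * B)"
      proof (cases "x \<in> K")
        case True
        then have "\<bar>(v (x + t j *\<^sub>R e) - v x) / t j\<bar> \<le> L"
          using mv[of x j] t(1)[of j] by (simp add: divide_le_eq)
        then show ?thesis using True assms(5)[of x] L(2)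
          unfolding s_def by (simp only: real_norm_def abs_mult indicator_simps scaleR_one)
            (intro mult_mono, auto)
      qed (use assms(6) in \<open>auto simp: s_def\<close>)
    qed
  qed
  then show ?thesis unfolding s_def t_def .
qed

lemma integral_translate:
  fixes f :: "'a::euclidean_space \<Rightarrow> real"
  assumes "f \<in> borel_measurable borel"
  shows "(LINT x|lborel. f (x + c)) = (LINT x|lborel. f x)"
proof -
  have "(LINT x|lborel. f x) = integral\<^sup>L (distr lborel borel ((+) c)) f"
    by (simp add: lborel_distr_plus)
  also have "\<dots> = (LINT x|lborel. f (c + x))" using assms by (intro integral_distr) auto
  finally show ?thesis by (simp add: add.commute)
qed

lemma compact_neighbourhood:
  fixes K :: "'a::euclidean_space set"
  assumes "compact K" "open U" "K \<subseteq> U"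
  obtains d Kd where "d > 0" "compact Kd" "Kd \<subseteq> U" "\<And>x. x \<in> K \<Longrightarrow> cball x d \<subseteq> Kd"
proof -
  from compact_subset_open_imp_ball_epsilon_subset[OF assms]
  obtain e where e: "e > 0" "(\<Union>x\<in>K. ball x e) \<subseteq> U" by auto
  define Kd where "Kd = {x + y | x y. x \<in> K \<and> y \<in> cball 0 (e/2)}"
  show ?thesis
  proof
    show "e/2 > 0" using e by simp
    show "compact Kd" unfolding Kd_def by (intro compact_sums assms compact_cball)
    show "Kd \<subseteq> U"
    proof
      fix z assume "z \<in> Kd"
      then obtain x y where "x \<in> K" "norm y \<le> e/2" "z = x + y" unfolding Kd_def by auto
      then have "z \<in> ball x e" using e(1) by (simp add: dist_norm)
      then show "z \<in> U" using e \<open>x \<in> K\<close> by blast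
    qed
    show "cball x (e/2) \<subseteq> Kd" if "x \<in> K" for x
    proof
      fix z assume "z \<in> cball x (e/2)"
      then have "z = x + (z - x)" "z - x \<in> cball 0 (e/2)"
        by (auto simp: dist_norm norm_minus_commute)
      then show "z \<in> Kd" unfolding Kd_def using that by blast
    qed
  qed
qed

text \<open>By translation invariance every difference quotient of \<open>w\<close> has integral 0.
  The indicator of \<open>Kd\<close> supplies the compactly supported weight for the passage to the
  limit; it changes nothing, since translates by at most \<open>d\<close> stay supported in
  \<open>Kd\<close>.\<close>

lemma test_fun_integral_grad:
  assumes "test_fun U K w gw" "norm e \<le> 1"
  shows "(LINT x|lborel. gw x \<bullet> e) = 0"
proof -
  have K: "compact K" "C1_grad_on UNIV w gw" "\<And>x. x \<notin> K \<Longrightarrow> w x = 0"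
    "\<And>x. x \<notin> K \<Longrightarrow> gw x = 0"
    using assms test_fun_grad_zero[OF assms(1)] by (auto simp: test_fun_def)
  obtain d Kd where Kd: "d > 0" "compact Kd" "\<And>x. x \<in> K \<Longrightarrow> cball x d \<subseteq> Kd"
    using compact_neighbourhood[of K UNIV] K by auto
  have wm: "w \<in> borel_measurable borel"
    using K C1_grad_on_continuous borel_measurable_continuous_onI by blast
  have wi: "integrable lborel w"
    using K C1_grad_on_continuous[OF K(2)] by (intro integrable_compact_support[of K]) (auto intro: continuous_on_subset)
  have "(\<lambda>j. LINT x|lborel. (w (x + (d / Suc j) *\<^sub>R e) - w x) / (d / Suc j) * indicator Kd x)
    \<longlonglongrightarrow> (LINT x|lborel. (gw x \<bullet> e) * indicator Kd x)"
  proof (rule difference_quotient_LIMSEQ[where U=UNIV and K=Kd and B=1])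
    show "indicator Kd \<in> borel_measurable borel" using compact_imp_closed[OF Kd(2)] by simp
  qed (use Kd K(2) assms(2) in \<open>auto simp: indicator_def\<close>)
  moreover have "(\<lambda>x. (gw x \<bullet> e) * indicator Kd x) = (\<lambda>x. gw x \<bullet> e)"
  proof
    fix x show "(gw x \<bullet> e) * indicator Kd x = gw x \<bullet> e"
      using K(4)[of x] Kd(1) Kd(3)[of x] by (cases "x \<in> Kd") force+
  qed
  moreover have "(LINT x|lborel. (w (x + (d / Suc j) *\<^sub>R e) - w x) / (d / Suc j) * indicator Kd x) = 0" for j
  proof -
    define t where "t = d / Suc j"
    have t: "t > 0" "t \<le> d" using Kd(1) by (auto simp: t_def divide_le_eq)
    have "w (x + t *\<^sub>R e) - w x = 0" if "x \<notin> Kd" for x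
    proof -
      have "norm (t *\<^sub>R e) \<le> d"
        using t assms(2) by simp (smt (verit, best) mult_left_le norm_ge_zero)
      then have "x + t *\<^sub>R e \<notin> K"
        using Kd(3)[of "x + t *\<^sub>R e"] that by (auto simp: dist_norm subset_eq)
      moreover have "x \<notin> K" using Kd(1) Kd(3)[of x] that by force
      ultimately show ?thesis using K(3) by simp
    qed
    then have eq: "(\<lambda>x. (w (x + t *\<^sub>R e) - w x) / t * indicator Kd x) = (\<lambda>x. (w (x + t *\<^sub>R e) - w x) / t)"
      by (force simp: indicator_def)
    have wi': "integrable lborel (\<lambda>x. w (x + t *\<^sub>R e))"
    proof -
      have "integrable (distr lborel borel ((+) (t *\<^sub>R e))) w" using wi by (simp add: lborel_distr_plus)
      then show ?thesis using wm by (simp add: integrable_distr_eq add.commute)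
    qed
    have "(LINT x|lborel. (w (x + t *\<^sub>R e) - w x) / t) = 0"
      using wi wi' integral_translate[OF wm] by simp
    then show ?thesis using eq unfolding t_def by simp
  qed
  ultimately show ?thesis by (simp only: LIMSEQ_const_iff)
qed

text \<open>The product of \<open>v\<close> and \<open>w\<close> is again a test function, so its
  gradient integrates to 0.\<close>

lemma integration_by_parts_test_fun:
  assumes "open U" "C1_grad_on U v gv" "test_fun U K w gw" "norm e \<le> 1"
  shows "(LINT x|lborel. v x * (gw x \<bullet> e)) = - (LINT x|lborel. (gv x \<bullet> e) * w x)"
proof -
  have K: "compact K" "K \<subseteq> U" "C1_grad_on UNIV w gw" "\<And>x. x \<notin> K \<Longrightarrow> w x = 0"
    "\<And>x. x \<notin> K \<Longrightarrow> gw x = 0"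
    using assms(3) test_fun_grad_zero[OF assms(3)] by (auto simp: test_fun_def)
  have c: "continuous_on K v" "continuous_on K w" "continuous_on K gv" "continuous_on K gw"
    using K C1_grad_on_continuous assms(2) continuous_on_subset unfolding C1_grad_on_def
    by (metis subset_UNIV)+
  have i: "integrable lborel (\<lambda>x. v x * (gw x \<bullet> e))" "integrable lborel (\<lambda>x. (gv x \<bullet> e) * w x)"
    using K c by (auto intro!: integrable_compact_support[of K] continuous_intros)
  have "0 = (LINT x|lborel. (v x *\<^sub>R gw x + w x *\<^sub>R gv x) \<bullet> e)"
    using test_fun_integral_grad[OF test_fun_mult[OF assms(1-3)] assms(4)] by simp
  also have "\<dots> = (LINT x|lborel. v x * (gw x \<bullet> e) + (gv x \<bullet> e) * w x)"
    by (simp add: inner_add_left mult.commute)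
  also have "\<dots> = (LINT x|lborel. v x * (gw x \<bullet> e)) + (LINT x|lborel. (gv x \<bullet> e) * w x)"
    using i by (rule Bochner_Integration.integral_add)
  finally show ?thesis by simp
qed

text \<open>For \<open>C\<^sup>2\<close> functions this is two integrations by parts; since \<open>v\<close> and \<open>w\<close> are only \<open>C\<^sup>1\<close>,
  the derivative in direction \<open>a\<close> is replaced by difference quotients, which may be moved
  from \<open>v\<close> to \<open>w\<close> by translation invariance.\<close>

lemma integral_swap_partial_derivs:
  assumes "open U" "C1_grad_on U v gv" "test_fun U K w gw" "norm a \<le> 1" "norm b \<le> 1"
  shows "(LINT x|lborel. (gv x \<bullet> a) * (gw x \<bullet> b)) = (LINT x|lborel. (gv x \<bullet> b) * (gw x \<bullet> a))"
proof -
  have K: "compact K" "K \<subseteq> U" "C1_grad_on UNIV w gw" "\<And>x. x \<notin> K \<Longrightarrow> w x = 0"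
    "\<And>x. x \<notin> K \<Longrightarrow> gw x = 0"
    using assms(3) test_fun_grad_zero[OF assms(3)] by (auto simp: test_fun_def)
  obtain d Kd where Kd: "d > 0" "compact Kd" "Kd \<subseteq> U" "\<And>x. x \<in> K \<Longrightarrow> cball x d \<subseteq> Kd"
    using compact_neighbourhood[OF K(1) assms(1) K(2)] by blast
  have c: "continuous_on UNIV w" "continuous_on U v" "continuous_on UNIV gw" "continuous_on U gv"
    using C1_grad_on_continuous assms(2) K(3) unfolding C1_grad_on_def by blast+
  have KKd: "x \<in> Kd" if "x \<in> K" for x
    using Kd(4)[OF that] Kd(1) by (meson centre_in_cball less_imp_le subsetD)
  have "bounded (gw ` K)" "bounded (gv ` Kd)"
    using K(1,2) Kd(2,3) c by (metis compact_continuous_image compact_imp_bounded continuous_on_subset subset_UNIV)+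
  then obtain B B' where B: "\<And>x. x \<in> K \<Longrightarrow> norm (gw x) \<le> B" "B > 0"
    and B': "\<And>x. x \<in> Kd \<Longrightarrow> norm (gv x) \<le> B'" "B' > 0"
    unfolding bounded_pos by (meson image_eqI)
  have inner_le: "\<bar>x \<bullet> e\<bar> \<le> norm x" if "norm e \<le> 1" for x e :: 'a
    using Cauchy_Schwarz_ineq2[of x e] that by (smt (verit) mult_left_le norm_ge_zero)
  have "(\<lambda>j. LINT x|lborel. (v (x + (d / Suc j) *\<^sub>R a) - v x) / (d / Suc j) * (gw x \<bullet> b))
    \<longlonglongrightarrow> (LINT x|lborel. (gv x \<bullet> a) * (gw x \<bullet> b))"
  proof (rule difference_quotient_LIMSEQ[OF assms(1,2) K(1), where B=B])
    show "(\<lambda>x. gw x \<bullet> b) \<in> borel_measurable borel"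
      using c(3) by (intro borel_measurable_continuous_onI continuous_intros)
    show "\<bar>gw x \<bullet> b\<bar> \<le> B" for x
      using inner_le[OF assms(5), of "gw x"] B K(5)[of x] by (cases "x \<in> K") force+
    show "cball x d \<subseteq> U" if "x \<in> K" for x using Kd that by blast
  qed (use K Kd assms in auto)
  \<comment> \<open>A derivative of \<open>v\<close> cut off to \<open>Kd\<close>, which contains
    \<open>K\<close> and all its translates by \<open>t *\<^sub>R a\<close> that occur below. It is
    discontinuous in general, hence the weak assumptions on the weight in
    \<open>difference_quotient_LIMSEQ\<close>.\<close>
  moreover define h where "h x = indicator Kd x *\<^sub>R (gv x \<bullet> b)" for x
  have hm: "h \<in> borel_measurable borel"
    unfolding h_def using Kd c(4) compact_imp_closed[OF Kd(2)]
    by (intro borel_measurable_continuous_on_indicator continuous_intros) (auto intro: continuous_on_subset)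
  obtain d2 Kd2 where Kd2: "d2 > 0" "compact Kd2" "\<And>x. x \<in> Kd \<Longrightarrow> cball x d2 \<subseteq> Kd2"
    using compact_neighbourhood[OF Kd(2) open_UNIV] by auto
  have "(\<lambda>j. LINT x|lborel. (w (x + (d / Suc j) *\<^sub>R (-a)) - w x) / (d / Suc j) * h x)
    \<longlonglongrightarrow> (LINT x|lborel. (gw x \<bullet> (-a)) * h x)"
  proof (rule difference_quotient_LIMSEQ[OF open_UNIV K(3) Kd(2) hm, where B=B'])
    show "\<bar>h x\<bar> \<le> B'" for x
      using inner_le[OF assms(5), of "gv x"] B' by (cases "x \<in> Kd") (force simp: h_def)+
  qed (use Kd assms in \<open>auto simp: h_def\<close>)
  \<comment> \<open>At a fixed step size, integration by parts in direction \<open>b\<close>, for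
    \<open>v\<close> and for its translate, moves that derivative from \<open>w\<close> to
    \<open>v\<close>. A translation of the variable then moves the shift from \<open>gv\<close> to
    \<open>w\<close>, where its direction becomes \<open>-a\<close>.\<close>
  moreover have shift: "(LINT x|lborel. (v (x + t *\<^sub>R a) - v x) / t * (gw x \<bullet> b)) =
      - (LINT x|lborel. (w (x + t *\<^sub>R (-a)) - w x) / t * h x)" if t: "t > 0" "t \<le> d" for t
  proof -
    have nt: "norm (t *\<^sub>R a) \<le> d"
      using t assms(4) by simp (smt (verit, best) mult_left_le norm_ge_zero)
    define U' where "U' = {x. x + t *\<^sub>R a \<in> U}"
    have U': "open U'"
      unfolding U'_def using open_vimage[OF assms(1), of "\<lambda>x. x + t *\<^sub>R a"]
      by (simp add: vimage_def continuous_intros)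
    have KU': "x + t *\<^sub>R a \<in> Kd" if "x \<in> K" for x
      using Kd(4)[OF that] nt by (auto simp: dist_norm subset_eq)
    have KU'': "K \<subseteq> U'" using KU' Kd(3) unfolding U'_def by auto
    have v': "C1_grad_on U' (\<lambda>x. v (x + t *\<^sub>R a)) (\<lambda>x. gv (x + t *\<^sub>R a))"
      unfolding C1_grad_on_def gderiv_def
    proof (intro conjI ballI)
      fix x assume "x \<in> U'"
      then have "(v has_derivative (\<lambda>h. h \<bullet> gv (x + t *\<^sub>R a))) (at (x + t *\<^sub>R a))"
        using assms(2) unfolding U'_def C1_grad_on_def gderiv_def by auto
      then show "((\<lambda>x. v (x + t *\<^sub>R a)) has_derivative (\<lambda>h. h \<bullet> gv (x + t *\<^sub>R a))) (at x)"
        by (intro has_derivative_compose[where g=v and f="\<lambda>x. x + t *\<^sub>R a" and f'="\<lambda>h. h"])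
          (auto intro!: derivative_eq_intros)
    next
      show "continuous_on U' (\<lambda>x. gv (x + t *\<^sub>R a))"
        unfolding U'_def by (intro continuous_on_compose2[OF c(4)] continuous_intros) auto
    qed
    have w': "test_fun U' K w gw" using assms(3) KU'' by (simp add: test_fun_def)
    have cK: "continuous_on K (\<lambda>x. v (x + t *\<^sub>R a))" "continuous_on K (\<lambda>x. gv (x + t *\<^sub>R a))"
      using v' C1_grad_on_continuous[OF v'] KU'' continuous_on_subset unfolding C1_grad_on_def by blast+
    have cK2: "continuous_on K v" "continuous_on K gv" "continuous_on K w" "continuous_on K gw"
      using c K continuous_on_subset by blast+
    note ii = integrable_compact_support[OF K(1)]
    have i1: "integrable lborel (\<lambda>x. v (x + t *\<^sub>R a) * (gw x \<bullet> b))" "integrable lborel (\<lambda>x. v x * (gw x \<bullet> b))"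
      "integrable lborel (\<lambda>x. (gv (x + t *\<^sub>R a) \<bullet> b) * w x)" "integrable lborel (\<lambda>x. (gv x \<bullet> b) * w x)"
      using cK cK2 K by (auto intro!: ii continuous_intros)
    have hw: "(\<lambda>x. (gv x \<bullet> b) * w x) = (\<lambda>x. w x * h x)"
    proof
      fix x show "(gv x \<bullet> b) * w x = w x * h x"
        using K(4)[of x] KKd[of x] by (cases "x \<in> K") (auto simp: h_def)
    qed
    have hw2: "(\<lambda>x. (gv (x + t *\<^sub>R a) \<bullet> b) * w x) = (\<lambda>x. w x * h (x + t *\<^sub>R a))"
    proof
      fix x show "(gv (x + t *\<^sub>R a) \<bullet> b) * w x = w x * h (x + t *\<^sub>R a)"
        using K(4)[of x] KU'[of x] by (cases "x \<in> K") (auto simp: h_def)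
    qed
    define F where "F = (\<lambda>x. w (x - t *\<^sub>R a) * h x)"
    have wm: "w \<in> borel_measurable borel" using c(1) by (rule borel_measurable_continuous_onI)
    have Fm: "F \<in> borel_measurable borel" unfolding F_def using hm wm by measurable
    have Ft: "(LINT x|lborel. w x * h (x + t *\<^sub>R a)) = (LINT x|lborel. F x)"
      using integral_translate[OF Fm, of "t *\<^sub>R a"] by (simp add: F_def)
    have Fi: "integrable lborel F"
    proof -
      have "integrable (distr lborel borel ((+) (t *\<^sub>R a))) F"
        using i1(3) Fm unfolding hw2 by (simp add: integrable_distr_eq F_def add.commute)
      then show ?thesis by (simp add: lborel_distr_plus)
    qed
    have "(LINT x|lborel. (v (x + t *\<^sub>R a) - v x) / t * (gw x \<bullet> b)) =
       (LINT x|lborel. (v (x + t *\<^sub>R a) * (gw x \<bullet> b) - v x * (gw x \<bullet> b)) / t)"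
      by (simp add: field_simps)
    also have "\<dots> = ((LINT x|lborel. v (x + t *\<^sub>R a) * (gw x \<bullet> b)) - (LINT x|lborel. v x * (gw x \<bullet> b))) / t"
      using i1 by simp
    also have "\<dots> = - ((LINT x|lborel. (gv (x + t *\<^sub>R a) \<bullet> b) * w x) - (LINT x|lborel. (gv x \<bullet> b) * w x)) / t"
      using integration_by_parts_test_fun[OF U' v' w' assms(5)]
        integration_by_parts_test_fun[OF assms(1,2,3,5)] by simp
    also have "\<dots> = - ((LINT x|lborel. F x) - (LINT x|lborel. w x * h x)) / t"
      unfolding hw hw2 Ft ..
    also have "\<dots> = - (LINT x|lborel. (F x - w x * h x) / t)"
      using Fi i1(4) unfolding hw by (simp add: diff_divide_distrib)
    also have "\<dots> = - (LINT x|lborel. (w (x + t *\<^sub>R (-a)) - w x) / t * h x)"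
      by (simp add: F_def field_simps)
    finally show ?thesis .
  qed
  then have "(LINT x|lborel. (v (x + (d / Suc j) *\<^sub>R a) - v x) / (d / Suc j) * (gw x \<bullet> b)) =
      - (LINT x|lborel. (w (x + (d / Suc j) *\<^sub>R (-a)) - w x) / (d / Suc j) * h x)" for j
  proof -
    have "d / Suc j > 0" "d / Suc j \<le> d" using Kd(1) by (auto simp: divide_le_eq)
    then show ?thesis by (rule shift)
  qed
  ultimately have "(\<lambda>j. - (LINT x|lborel. (w (x + (d / Suc j) *\<^sub>R (-a)) - w x) / (d / Suc j) * h x))
      \<longlonglongrightarrow> (LINT x|lborel. (gv x \<bullet> a) * (gw x \<bullet> b))"
    and "(\<lambda>j. - (LINT x|lborel. (w (x + (d / Suc j) *\<^sub>R (-a)) - w x) / (d / Suc j) * h x))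
      \<longlonglongrightarrow> - (LINT x|lborel. (gw x \<bullet> (-a)) * h x)"
    by (simp only:, intro tendsto_minus)
  then have "(LINT x|lborel. (gv x \<bullet> a) * (gw x \<bullet> b)) = - (LINT x|lborel. (gw x \<bullet> (-a)) * h x)"
    by (rule LIMSEQ_unique)
  also have "\<dots> = (LINT x|lborel. (gw x \<bullet> a) * h x)" by simp
  also have "(\<lambda>x. (gw x \<bullet> a) * h x) = (\<lambda>x. (gv x \<bullet> b) * (gw x \<bullet> a))"
  proof
    fix x show "(gw x \<bullet> a) * h x = (gv x \<bullet> b) * (gw x \<bullet> a)"
      using K(5)[of x] KKd[of x] by (cases "x \<in> K") (auto simp: h_def)
  qed
  finally show ?thesis .
qed

section \<open>A trace inequality and a gain of integrability\<close>

lemma nn_integral_translate: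
  fixes f :: "'a::euclidean_space \<Rightarrow> ennreal"
  assumes "f \<in> borel_measurable borel"
  shows "(\<integral>\<^sup>+x. f (x + c) \<partial>lborel) = (\<integral>\<^sup>+x. f x \<partial>lborel)"
proof -
  have "(\<integral>\<^sup>+x. f x \<partial>lborel) = (\<integral>\<^sup>+x. f x \<partial>(distr lborel borel ((+) c)))"
    by (simp add: lborel_distr_plus)
  also have "\<dots> = (\<integral>\<^sup>+x. f (c + x) \<partial>lborel)" using assms by (intro nn_integral_distr) auto
  finally show ?thesis by (simp add: add.commute)
qed

lemma nn_integral_scale:
  fixes f :: "'a::euclidean_space \<Rightarrow> ennreal"
  assumes [measurable]: "f \<in> borel_measurable borel" and "c > 0"
  shows "ennreal (c ^ DIM('a)) * (\<integral>\<^sup>+x. f (c *\<^sub>R x) \<partial>lborel) = (\<integral>\<^sup>+x. f x \<partial>lborel)"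
proof -
  have "(\<integral>\<^sup>+x. f x \<partial>lborel) =
      (\<integral>\<^sup>+x. f x \<partial>(density (distr lborel borel (\<lambda>x. 0 + c *\<^sub>R x)) (\<lambda>_. \<bar>c\<bar>^DIM('a))))"
    using lborel_affine[of c "0::'a"] assms(2) by simp
  also have "\<dots> = (\<integral>\<^sup>+x. ennreal (c ^ DIM('a)) * f (c *\<^sub>R x) \<partial>lborel)"
    using assms(2) by (simp add: nn_integral_density nn_integral_distr)
  also have "\<dots> = ennreal (c ^ DIM('a)) * (\<integral>\<^sup>+x. f (c *\<^sub>R x) \<partial>lborel)"
    by (intro nn_integral_cmult) measurable
  finally show ?thesis by simp
qed

text \<open>Substitute z = c h, then y = x + z, and exchange the integrals. Averaging over
  displacements thus weighs \<open>g\<close> at \<open>y\<close> by the mass of \<open>f\<close> in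
  a ball about \<open>y\<close>, which is exactly what a growth bound controls. The power of
  \<open>c\<close> is the Jacobian.\<close>

lemma nn_integral_ball_shift:
  fixes f g :: "'a::euclidean_space \<Rightarrow> ennreal"
  assumes [measurable]: "f \<in> borel_measurable borel" "g \<in> borel_measurable borel" and c: "c > 0"
  shows "ennreal (c ^ DIM('a)) *
      (\<integral>\<^sup>+h. indicator (ball 0 r) h * (\<integral>\<^sup>+x. f x * g (x + c *\<^sub>R h) \<partial>lborel) \<partial>lborel) =
    (\<integral>\<^sup>+y. g y * (\<integral>\<^sup>+x. f x * indicator (ball y (c * r)) x \<partial>lborel) \<partial>lborel)"
proof -
  define k :: "'a \<Rightarrow> ennreal" where "k = indicator (ball 0 (c * r))"
  have [measurable]: "k \<in> borel_measurable borel" unfolding k_def by (intro borel_measurable_indicator) simp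
  have k1: "indicator (ball 0 r) h = k (c *\<^sub>R h)" for h
    using c by (auto simp: k_def indicator_def)
  have k2: "k (y - x) = indicator (ball y (c * r)) x" for x y
    by (simp add: k_def indicator_def dist_norm norm_minus_commute)
  have "ennreal (c ^ DIM('a)) *
      (\<integral>\<^sup>+h. indicator (ball 0 r) h * (\<integral>\<^sup>+x. f x * g (x + c *\<^sub>R h) \<partial>lborel) \<partial>lborel) =
    (\<integral>\<^sup>+z. k z * (\<integral>\<^sup>+x. f x * g (x + z) \<partial>lborel) \<partial>lborel)"
    unfolding k1 by (intro nn_integral_scale[OF _ c]) measurable
  also have "\<dots> = (\<integral>\<^sup>+z. (\<integral>\<^sup>+x. k z * (f x * g (x + z)) \<partial>lborel) \<partial>lborel)"
    by (simp add: nn_integral_cmult)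
  also have "\<dots> = (\<integral>\<^sup>+x. (\<integral>\<^sup>+z. k z * (f x * g (x + z)) \<partial>lborel) \<partial>lborel)"
    by (intro lborel_pair.Fubini'[symmetric]) measurable
  also have "\<dots> = (\<integral>\<^sup>+x. (\<integral>\<^sup>+y. k (y - x) * (f x * g y) \<partial>lborel) \<partial>lborel)"
  proof (rule nn_integral_cong)
    fix x
    have "(\<integral>\<^sup>+y. k (y - x) * (f x * g y) \<partial>lborel) = (\<integral>\<^sup>+z. k (z + x - x) * (f x * g (z + x)) \<partial>lborel)"
      by (intro nn_integral_translate[symmetric]) measurable
    then show "(\<integral>\<^sup>+z. k z * (f x * g (x + z)) \<partial>lborel) = (\<integral>\<^sup>+y. k (y - x) * (f x * g y) \<partial>lborel)"
      by (simp add: add.commute)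
  qed
  also have "\<dots> = (\<integral>\<^sup>+y. (\<integral>\<^sup>+x. k (y - x) * (f x * g y) \<partial>lborel) \<partial>lborel)"
    by (intro lborel_pair.Fubini') measurable
  also have "\<dots> = (\<integral>\<^sup>+y. g y * (\<integral>\<^sup>+x. f x * k (y - x) \<partial>lborel) \<partial>lborel)"
    by (intro nn_integral_cong) (simp add: nn_integral_cmult[symmetric] mult_ac)
  also have "\<dots> = (\<integral>\<^sup>+y. g y * (\<integral>\<^sup>+x. f x * indicator (ball y (c * r)) x \<partial>lborel) \<partial>lborel)"
    by (simp only: k2)
  finally show ?thesis .
qed

text \<open>Jensen's inequality on the unit interval, read off from the nonnegative integral of the
  squared deviation of \<open>D\<close> from its mean \<open>c\<close>.\<close>

lemma power2_integral_le:
  fixes D :: "real \<Rightarrow> real"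
  assumes "continuous_on {0..1} D"
  shows "(LINT s|lborel. indicator {0..1} s * D s)\<^sup>2 \<le> (LINT s|lborel. indicator {0..1} s * (D s)\<^sup>2)"
proof -
  define c where "c = (LINT s|lborel. indicator {0..1} s * D s)"
  have "integrable lborel (\<lambda>s. indicator {0..1} s *\<^sub>R D s)"
    "integrable lborel (\<lambda>s. indicator {0..1} s *\<^sub>R (D s)\<^sup>2)"
    by (intro borel_integrable_compact continuous_intros assms compact_Icc)+
  then have i: "integrable lborel (\<lambda>s. indicator {0..1} s * D s)"
    "integrable lborel (\<lambda>s. indicator {0..1} s * (D s)\<^sup>2)" by simp_all
  have i2: "integrable lborel (\<lambda>s. indicator {0..1::real} s :: real)" by simp
  have "0 \<le> (LINT s|lborel. indicator {0..1} s * (D s - c)\<^sup>2)"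
    by (intro integral_nonneg_AE) (simp add: indicator_def)
  also have "\<dots> = (LINT s|lborel. indicator {0..1} s * (D s)\<^sup>2 - 2 * c * (indicator {0..1} s * D s)
      + c\<^sup>2 * indicator {0..1} s)"
    by (simp add: power2_diff algebra_simps)
  also have "\<dots> = (LINT s|lborel. indicator {0..1} s * (D s)\<^sup>2) - 2 * c * c + c\<^sup>2"
    using i i2 by (simp add: c_def)
  finally show ?thesis unfolding c_def[symmetric] by (simp add: power2_eq_square)
qed

text \<open>The segment from \<open>x\<close> to \<open>x + h\<close> is parametrized by \<open>s ^ m\<close>, so that the weight
  \<open>s ^ (2 * m - 2)\<close> later compensates the negative power of \<open>s ^ m\<close> coming from the
  change of variables \<open>h \<mapsto> s ^ m h\<close>.\<close>

lemma power2_le_segment_integral: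
  fixes \<phi> :: "'a::euclidean_space \<Rightarrow> real"
  assumes "C1_grad_on UNIV \<phi> g" "norm h \<le> r" "m \<ge> 1"
  shows "ennreal ((\<phi> x)\<^sup>2) \<le> 2 * ennreal ((\<phi> (x + h))\<^sup>2) + ennreal (2 * (real m)\<^sup>2 * r\<^sup>2) *
    (\<integral>\<^sup>+s. ennreal (indicator {0..1} s * s ^ (2 * m - 2)) * ennreal ((norm (g (x + (s ^ m) *\<^sub>R h)))\<^sup>2) \<partial>lborel)"
proof -
  define D where "D s = real m * s ^ (m - 1) * (h \<bullet> g (x + (s ^ m) *\<^sub>R h))" for s :: real
  have r: "r \<ge> 0" using assms(2) norm_ge_zero order_trans by blast
  have gc: "continuous_on UNIV g" using assms(1) by (simp add: C1_grad_on_def)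
  have Dc: "continuous_on S D" for S
    unfolding D_def by (intro continuous_intros continuous_on_compose2[OF gc]) auto
  have der: "((\<lambda>s. \<phi> (x + (s ^ m) *\<^sub>R h)) has_real_derivative D s) (at s)" for s
  proof -
    have "((\<lambda>s. s ^ m) has_derivative (\<lambda>y. real m * s ^ (m - 1) * y)) (at s)"
      using DERIV_pow[of m s UNIV] by (simp add: has_field_derivative_def)
    then have "((\<lambda>s. x + (s ^ m) *\<^sub>R h) has_derivative (\<lambda>y. (real m * s ^ (m - 1) * y) *\<^sub>R h)) (at s)"
      by (auto intro!: derivative_eq_intros)
    from has_derivative_compose[OF this, of \<phi> "\<lambda>y. y \<bullet> g (x + (s ^ m) *\<^sub>R h)"]
    have "((\<lambda>s. \<phi> (x + (s ^ m) *\<^sub>R h)) has_derivative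
        (\<lambda>y. ((real m * s ^ (m - 1) * y) *\<^sub>R h) \<bullet> g (x + (s ^ m) *\<^sub>R h))) (at s)"
      using assms(1) by (simp add: C1_grad_on_def gderiv_def)
    then show ?thesis unfolding has_field_derivative_def D_def by (simp add: mult_ac mult_commute_abs)
  qed
  have "(LINT s|lborel. D s * indicator {0..1} s) = \<phi> (x + (1 ^ m) *\<^sub>R h) - \<phi> (x + (0 ^ m) *\<^sub>R h)"
    using der Dc[of UNIV] by (intro integral_FTC_Icc_real) (auto simp: continuous_on_eq_continuous_at)
  then have d: "\<phi> (x + h) - \<phi> x = (LINT s|lborel. indicator {0..1} s * D s)"
    using assms(3) by (simp add: mult.commute power_0_left)
  define W where "W s = indicator {0..1} s * s ^ (2 * m - 2) * (norm (g (x + (s ^ m) *\<^sub>R h)))\<^sup>2" for s :: real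
  have W0: "W s \<ge> 0" for s unfolding W_def by (auto simp: indicator_def)
  have "integrable lborel (\<lambda>s. indicator {0..1} s *\<^sub>R (s ^ (2 * m - 2) * (norm (g (x + (s ^ m) *\<^sub>R h)))\<^sup>2))"
    by (intro borel_integrable_compact continuous_intros compact_Icc continuous_on_compose2[OF gc]) auto
  then have Wi: "integrable lborel W" by (simp add: W_def[abs_def] mult_ac)
  have Di: "integrable lborel (\<lambda>s. indicator {0..1} s * (D s)\<^sup>2)"
  proof -
    have "integrable lborel (\<lambda>s. indicator {0..1} s *\<^sub>R (D s)\<^sup>2)"
      by (intro borel_integrable_compact continuous_intros compact_Icc Dc)
    then show ?thesis by simp
  qed
  have DW: "indicator {0..1} s * (D s)\<^sup>2 \<le> (real m)\<^sup>2 * r\<^sup>2 * W s" for s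
  proof (cases "s \<in> {0..1}")
    case True
    have "\<bar>h \<bullet> g (x + (s ^ m) *\<^sub>R h)\<bar> \<le> norm h * norm (g (x + (s ^ m) *\<^sub>R h))"
      by (rule Cauchy_Schwarz_ineq2)
    also have "\<dots> \<le> r * norm (g (x + (s ^ m) *\<^sub>R h))" using assms(2) by (simp add: mult_right_mono)
    finally have "(h \<bullet> g (x + (s ^ m) *\<^sub>R h))\<^sup>2 \<le> (r * norm (g (x + (s ^ m) *\<^sub>R h)))\<^sup>2"
      by (simp add: abs_le_square_iff[symmetric] abs_mult r)
    then have "(real m * s ^ (m - 1))\<^sup>2 * (h \<bullet> g (x + (s ^ m) *\<^sub>R h))\<^sup>2 \<le>
        (real m * s ^ (m - 1))\<^sup>2 * (r * norm (g (x + (s ^ m) *\<^sub>R h)))\<^sup>2"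
      by (intro mult_left_mono) auto
    moreover have "(s ^ (m - 1))\<^sup>2 = s ^ (2 * m - 2)"
    proof -
      have "2 * m - 2 = (m - 1) * 2" by simp
      then show ?thesis by (simp only: power_mult)
    qed
    ultimately show ?thesis using True by (simp add: D_def W_def power_mult_distrib mult_ac)
  qed (simp add: W_def)
  have "(\<phi> x)\<^sup>2 \<le> 2 * (\<phi> (x + h))\<^sup>2 + 2 * (\<phi> (x + h) - \<phi> x)\<^sup>2"
    using zero_le_power2[of "2 * \<phi> (x + h) - \<phi> x"] by (simp add: power2_eq_square algebra_simps)
  also have "(\<phi> (x + h) - \<phi> x)\<^sup>2 \<le> (LINT s|lborel. indicator {0..1} s * (D s)\<^sup>2)"
    unfolding d by (intro power2_integral_le Dc)
  also have "\<dots> \<le> (LINT s|lborel. (real m)\<^sup>2 * r\<^sup>2 * W s)"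
    using Di Wi DW by (intro integral_mono) auto
  also have "\<dots> = (real m)\<^sup>2 * r\<^sup>2 * (LINT s|lborel. W s)" by simp
  finally have "(\<phi> x)\<^sup>2 \<le> 2 * (\<phi> (x + h))\<^sup>2 + (2 * (real m)\<^sup>2 * r\<^sup>2) * (LINT s|lborel. W s)" by simp
  then have "ennreal ((\<phi> x)\<^sup>2) \<le> ennreal (2 * (\<phi> (x + h))\<^sup>2 + (2 * (real m)\<^sup>2 * r\<^sup>2) * (LINT s|lborel. W s))"
    by (rule ennreal_leI)
  also have "\<dots> = 2 * ennreal ((\<phi> (x + h))\<^sup>2) + ennreal (2 * (real m)\<^sup>2 * r\<^sup>2) * ennreal (LINT s|lborel. W s)"
    using W0 by (simp add: ennreal_plus ennreal_mult integral_nonneg_AE del: ennreal_plus[symmetric])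
  also have "ennreal (LINT s|lborel. W s) = (\<integral>\<^sup>+s. ennreal (W s) \<partial>lborel)"
    using Wi W0 by (intro nn_integral_eq_integral[symmetric]) auto
  also have "\<dots> = (\<integral>\<^sup>+s. ennreal (indicator {0..1} s * s ^ (2 * m - 2)) * ennreal ((norm (g (x + (s ^ m) *\<^sub>R h)))\<^sup>2) \<partial>lborel)"
    by (intro nn_integral_cong) (simp add: W_def ennreal_mult''[symmetric])
  finally show ?thesis .
qed

text \<open>Integrate the segment estimate for \<open>\<phi>\<close> against \<open>f\<close> and
  over all displacements in a ball of radius \<open>r\<close>, then apply
  \<open>nn_integral_ball_shift\<close> to both terms. The endpoint term meets the mass of
  \<open>f\<close> in balls of radius \<open>r\<close>, the gradient term that in balls of radius
  \<open>s ^ m * r\<close>. Dividing by the volume of the ball of displacements gives the powers of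
  \<open>r\<close>: the gradient has a coefficient of order \<open>r powr \<kappa>\<close>, which a
  small scale makes small.\<close>

lemma trace_inequality:
  fixes \<phi> :: "'a::euclidean_space \<Rightarrow> real" and f :: "'a \<Rightarrow> ennreal" and \<kappa> :: real
  assumes \<phi>: "C1_grad_on UNIV \<phi> g" and [measurable]: "f \<in> borel_measurable borel"
    and r: "r > 0" and K: "K \<ge> 0" and m: "real m * \<kappa> \<ge> 2" "\<kappa> > 0"
    and grow: "\<And>y s. 0 < s \<Longrightarrow> s \<le> r \<Longrightarrow>
      (\<integral>\<^sup>+x. f x * indicator (ball y s) x \<partial>lborel) \<le> ennreal (K * s powr (real DIM('a) - 2 + \<kappa>))"
  shows "(\<integral>\<^sup>+x. f x * ennreal ((\<phi> x)\<^sup>2) \<partial>lborel) \<le>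
    ennreal (2 * K / unit_ball_vol DIM('a) * r powr (\<kappa> - 2)) * (\<integral>\<^sup>+x. ennreal ((\<phi> x)\<^sup>2) \<partial>lborel) +
    ennreal (2 * (real m)\<^sup>2 * K / unit_ball_vol DIM('a) * r powr \<kappa>) * (\<integral>\<^sup>+x. ennreal ((norm (g x))\<^sup>2) \<partial>lborel)"
proof -
  let ?n = "DIM('a)" and ?v = "unit_ball_vol DIM('a)"
  have v: "?v > 0" by (rule unit_ball_vol_pos) simp
  then have v0: "?v \<noteq> 0" by (rule less_imp_neq[symmetric])
  have m1: "m \<ge> 1" using m by (cases m) auto
  have gc: "continuous_on UNIV g" using \<phi> by (simp add: C1_grad_on_def)
  have \<phi>c: "continuous_on UNIV \<phi>" using \<phi> by (rule C1_grad_on_continuous)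
  have [measurable]: "\<phi> \<in> borel_measurable borel" "g \<in> borel_measurable borel"
    using gc \<phi>c by (auto intro: borel_measurable_continuous_onI)
  define N1 where "N1 = (\<integral>\<^sup>+x. ennreal ((\<phi> x)\<^sup>2) \<partial>lborel)"
  define N2 where "N2 = (\<integral>\<^sup>+x. ennreal ((norm (g x))\<^sup>2) \<partial>lborel)"
  define P where "P = (\<integral>\<^sup>+x. f x * ennreal ((\<phi> x)\<^sup>2) \<partial>lborel)"
  define B where "B = ball (0::'a) r"
  have [measurable]: "B \<in> sets borel" unfolding B_def by simp
  define KK where "KK = K * r powr (real ?n - 2 + \<kappa>)"
  have KK: "KK \<ge> 0" unfolding KK_def using K by simp
  define w where "w s = ennreal (indicator {0..1} s * s ^ (2 * m - 2))" for s :: real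
  have [measurable]: "w \<in> borel_measurable borel" unfolding w_def by measurable
  define G where "G y = ennreal ((norm (g y))\<^sup>2)" for y
  have [measurable]: "G \<in> borel_measurable borel" unfolding G_def by measurable
  define A where "A c = (\<integral>\<^sup>+h. indicator B h * (\<integral>\<^sup>+x. f x * G (x + c *\<^sub>R h) \<partial>lborel) \<partial>lborel)" for c
  define c0 where "c0 = ennreal (2 * (real m)\<^sup>2 * r\<^sup>2)"
  have bound: "(\<integral>\<^sup>+y. q y * (\<integral>\<^sup>+x. f x * indicator (ball y (c * r)) x \<partial>lborel) \<partial>lborel) \<le>
      ennreal (K * (c * r) powr (real ?n - 2 + \<kappa>)) * (\<integral>\<^sup>+y. q y \<partial>lborel)"
    if "0 < c" "c \<le> 1" "q \<in> borel_measurable borel" for c q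
  proof -
    have "c * r \<le> r" "c * r > 0" using that r by (auto simp: mult_le_cancel_right1)
    then have "(\<integral>\<^sup>+y. q y * (\<integral>\<^sup>+x. f x * indicator (ball y (c * r)) x \<partial>lborel) \<partial>lborel) \<le>
       (\<integral>\<^sup>+y. q y * ennreal (K * (c * r) powr (real ?n - 2 + \<kappa>)) \<partial>lborel)"
      by (intro nn_integral_mono mult_left_mono grow) auto
    also have "\<dots> = ennreal (K * (c * r) powr (real ?n - 2 + \<kappa>)) * (\<integral>\<^sup>+y. q y \<partial>lborel)"
      using that(3) by (simp add: nn_integral_multc mult.commute)
    finally show ?thesis .
  qed
  have first: "(\<integral>\<^sup>+h. indicator B h * (\<integral>\<^sup>+x. f x * ennreal ((\<phi> (x + h))\<^sup>2) \<partial>lborel) \<partial>lborel) \<le> ennreal KK * N1"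
    using nn_integral_ball_shift[of f "\<lambda>x. ennreal ((\<phi> x)\<^sup>2)" 1 r] bound[of 1 "\<lambda>x. ennreal ((\<phi> x)\<^sup>2)"]
    by (simp add: B_def KK_def N1_def)
  \<comment> \<open>With c = s ^ m, the Jacobian to be cancelled is s to the power m n, while the
    weight and the growth bound together give s to the power m n + (m \<kappa> - 2). Since s is at
    most 1, the condition \<open>real m * \<kappa> \<ge> 2\<close> is what makes this
    sufficient.\<close>
  have second: "w s * A (s ^ m) \<le> indicator {0..1} s * (ennreal KK * N2)" if s0: "s \<noteq> 0" for s
  proof (cases "s \<in> {0..1}")
    case True
    define c where "c = s ^ m"
    have s: "0 < s" "s \<le> 1" using True s0 by auto
    have c: "c > 0" "c \<le> 1" using s by (auto simp: c_def power_le_one)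
    have e: "s ^ (2 * m - 2) * (c * r) powr (real ?n - 2 + \<kappa>) \<le> c ^ ?n * r powr (real ?n - 2 + \<kappa>)"
    proof -
      have "s ^ (2 * m - 2) * c powr (real ?n - 2 + \<kappa>) = s powr (2 * real m - 2 + real m * (real ?n - 2 + \<kappa>))"
        using s m1 by (simp add: c_def powr_realpow[symmetric] powr_powr powr_add[symmetric] of_nat_diff)
      also have "\<dots> = s powr (real m * ?n + (real m * \<kappa> - 2))" by (simp add: algebra_simps)
      also have "\<dots> \<le> s powr (real m * ?n)" using s m by (simp add: powr_mono')
      also have "\<dots> = c ^ ?n"
        using s by (simp add: c_def powr_realpow[symmetric] powr_powr)
      finally show ?thesis using c r by (simp add: powr_mult mult.assoc[symmetric] mult_right_mono)
    qed
    have "ennreal (c ^ ?n) * A c \<le> ennreal (K * (c * r) powr (real ?n - 2 + \<kappa>)) * N2"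
      using nn_integral_ball_shift[of f G c r] bound[of c G] c
      by (simp add: A_def B_def N2_def G_def[symmetric])
    then have "ennreal (s ^ (2 * m - 2)) * (ennreal (c ^ ?n) * A c) \<le>
        ennreal (s ^ (2 * m - 2)) * (ennreal (K * (c * r) powr (real ?n - 2 + \<kappa>)) * N2)"
      by (rule mult_left_mono) simp
    also have "\<dots> = ennreal (K * (s ^ (2 * m - 2) * (c * r) powr (real ?n - 2 + \<kappa>))) * N2"
      using s K by (simp add: ennreal_mult' mult_ac)
    also have "\<dots> \<le> ennreal (K * (c ^ ?n * r powr (real ?n - 2 + \<kappa>))) * N2"
      using e K by (intro mult_right_mono ennreal_leI mult_left_mono) auto
    also have "\<dots> = ennreal (c ^ ?n) * (ennreal KK * N2)"
      using c K by (simp add: KK_def ennreal_mult' mult_ac)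
    finally have "ennreal (c ^ ?n) * (ennreal (s ^ (2 * m - 2)) * A c) \<le> ennreal (c ^ ?n) * (ennreal KK * N2)"
      by (simp add: mult_ac)
    then have "ennreal (s ^ (2 * m - 2)) * A c \<le> ennreal KK * N2"
      using c by (subst (asm) ennreal_mult_le_mult_iff) auto
    then show ?thesis using True by (simp add: w_def c_def)
  qed (simp add: w_def)
  have "AE s in lborel. s \<noteq> (0::real)" by (rule AE_lborel_singleton)
  then have "AE s in lborel. w s * A (s ^ m) \<le> indicator {0..1} s * (ennreal KK * N2)"
    by eventually_elim (rule second)
  then have "(\<integral>\<^sup>+s. w s * A (s ^ m) \<partial>lborel) \<le> (\<integral>\<^sup>+s. indicator {0..1::real} s * (ennreal KK * N2) \<partial>lborel)"
    by (rule nn_integral_mono_AE)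
  also have "\<dots> = ennreal KK * N2" by (simp add: nn_integral_multc)
  finally have third: "(\<integral>\<^sup>+s. w s * A (s ^ m) \<partial>lborel) \<le> ennreal KK * N2" .
  have "ennreal (?v * r ^ ?n) * P = (\<integral>\<^sup>+h. indicator B h * P \<partial>lborel)"
    using emeasure_ball[of r "0::'a"] r
    by (simp add: nn_integral_multc B_def[symmetric] nn_integral_indicator[unfolded sets_lborel])
  also have "\<dots> = (\<integral>\<^sup>+h. indicator B h * (\<integral>\<^sup>+x. f x * ennreal ((\<phi> x)\<^sup>2) \<partial>lborel) \<partial>lborel)"
    by (simp add: P_def)
  also have "\<dots> \<le> (\<integral>\<^sup>+h. indicator B h * (\<integral>\<^sup>+x. f x * (2 * ennreal ((\<phi> (x + h))\<^sup>2) +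
      c0 * (\<integral>\<^sup>+s. w s * G (x + (s ^ m) *\<^sub>R h) \<partial>lborel)) \<partial>lborel) \<partial>lborel)"
  proof (intro nn_integral_mono)
    fix h
    show "indicator B h * (\<integral>\<^sup>+x. f x * ennreal ((\<phi> x)\<^sup>2) \<partial>lborel) \<le>
      indicator B h * (\<integral>\<^sup>+x. f x * (2 * ennreal ((\<phi> (x + h))\<^sup>2) +
      c0 * (\<integral>\<^sup>+s. w s * G (x + (s ^ m) *\<^sub>R h) \<partial>lborel)) \<partial>lborel)"
    proof (cases "h \<in> B")
      case True
      then have "norm h \<le> r" by (simp add: B_def)
      then show ?thesis using True
        by (auto simp: c0_def w_def G_def intro!: nn_integral_mono mult_left_mono power2_le_segment_integral[OF \<phi> _ m1])
    qed simp
  qed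
  also have "\<dots> = (\<integral>\<^sup>+h. (2 * (indicator B h * (\<integral>\<^sup>+x. f x * ennreal ((\<phi> (x + h))\<^sup>2) \<partial>lborel)) +
      c0 * (indicator B h * (\<integral>\<^sup>+x. f x * (\<integral>\<^sup>+s. w s * G (x + (s ^ m) *\<^sub>R h) \<partial>lborel) \<partial>lborel))) \<partial>lborel)"
    by (intro nn_integral_cong)
      (simp add: distrib_left nn_integral_add nn_integral_cmult mult.left_commute[of _ c0] mult.left_commute[of _ 2])
  also have "\<dots> = 2 * (\<integral>\<^sup>+h. indicator B h * (\<integral>\<^sup>+x. f x * ennreal ((\<phi> (x + h))\<^sup>2) \<partial>lborel) \<partial>lborel) +
      c0 * (\<integral>\<^sup>+h. indicator B h * (\<integral>\<^sup>+x. f x * (\<integral>\<^sup>+s. w s * G (x + (s ^ m) *\<^sub>R h) \<partial>lborel) \<partial>lborel) \<partial>lborel)"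
    by (simp add: nn_integral_add nn_integral_cmult)
  also have "(\<integral>\<^sup>+h. indicator B h * (\<integral>\<^sup>+x. f x * (\<integral>\<^sup>+s. w s * G (x + (s ^ m) *\<^sub>R h) \<partial>lborel) \<partial>lborel) \<partial>lborel)
      = (\<integral>\<^sup>+s. w s * A (s ^ m) \<partial>lborel)"
  proof -
    have "(\<integral>\<^sup>+x. f x * (\<integral>\<^sup>+s. w s * G (x + (s ^ m) *\<^sub>R h) \<partial>lborel) \<partial>lborel) =
        (\<integral>\<^sup>+s. w s * (\<integral>\<^sup>+x. f x * G (x + (s ^ m) *\<^sub>R h) \<partial>lborel) \<partial>lborel)" for h
    proof -
      have "(\<integral>\<^sup>+x. f x * (\<integral>\<^sup>+s. w s * G (x + (s ^ m) *\<^sub>R h) \<partial>lborel) \<partial>lborel) =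
          (\<integral>\<^sup>+x. (\<integral>\<^sup>+s. f x * (w s * G (x + (s ^ m) *\<^sub>R h)) \<partial>lborel) \<partial>lborel)"
        by (simp add: nn_integral_cmult)
      also have "\<dots> = (\<integral>\<^sup>+s. (\<integral>\<^sup>+x. f x * (w s * G (x + (s ^ m) *\<^sub>R h)) \<partial>lborel) \<partial>lborel)"
        by (intro lborel_pair.Fubini'[symmetric]) measurable
      also have "\<dots> = (\<integral>\<^sup>+s. w s * (\<integral>\<^sup>+x. f x * G (x + (s ^ m) *\<^sub>R h) \<partial>lborel) \<partial>lborel)"
        by (intro nn_integral_cong) (simp add: nn_integral_cmult[symmetric] mult_ac)
      finally show ?thesis .
    qed
    then have "(\<integral>\<^sup>+h. indicator B h * (\<integral>\<^sup>+x. f x * (\<integral>\<^sup>+s. w s * G (x + (s ^ m) *\<^sub>R h) \<partial>lborel) \<partial>lborel) \<partial>lborel)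
      = (\<integral>\<^sup>+h. (\<integral>\<^sup>+s. indicator B h * (w s * (\<integral>\<^sup>+x. f x * G (x + (s ^ m) *\<^sub>R h) \<partial>lborel)) \<partial>lborel) \<partial>lborel)"
      by (simp add: nn_integral_cmult)
    also have "\<dots> = (\<integral>\<^sup>+s. (\<integral>\<^sup>+h. indicator B h * (w s * (\<integral>\<^sup>+x. f x * G (x + (s ^ m) *\<^sub>R h) \<partial>lborel)) \<partial>lborel) \<partial>lborel)"
      by (intro lborel_pair.Fubini'[symmetric]) measurable
    also have "\<dots> = (\<integral>\<^sup>+s. w s * A (s ^ m) \<partial>lborel)"
      unfolding A_def by (intro nn_integral_cong) (simp add: nn_integral_cmult[symmetric] mult_ac)
    finally show ?thesis .
  qed
  also note third
  also note first
  finally have main: "ennreal (?v * r ^ ?n) * P \<le> 2 * (ennreal KK * N1) + c0 * (ennreal KK * N2)"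
    by (simp add: mult_left_mono add_mono)
  have e1: "?v * r ^ ?n * (2 * K / ?v * r powr (\<kappa> - 2)) = 2 * KK"
    "?v * r ^ ?n * (2 * (real m)\<^sup>2 * K / ?v * r powr \<kappa>) = (2 * (real m)\<^sup>2 * r\<^sup>2) * KK"
  proof -
    have "r ^ ?n * r powr (\<kappa> - 2) = r powr (real ?n - 2 + \<kappa>)"
      using r by (simp add: powr_realpow[symmetric] powr_add[symmetric] algebra_simps)
    then show "?v * r ^ ?n * (2 * K / ?v * r powr (\<kappa> - 2)) = 2 * KK"
      using v0 by (simp add: KK_def mult_ac)
    have "r ^ ?n * r powr \<kappa> = r\<^sup>2 * r powr (real ?n - 2 + \<kappa>)"
    proof -
      have "r ^ ?n * r powr \<kappa> = r powr (?n + \<kappa>)"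
        using r by (simp add: powr_realpow[symmetric] powr_add)
      also have "\<dots> = r powr (2 + (real ?n - 2 + \<kappa>))" by simp
      also have "\<dots> = r powr 2 * r powr (real ?n - 2 + \<kappa>)" by (rule powr_add)
      finally show ?thesis using r by (simp add: powr_numeral)
    qed
    then show "?v * r ^ ?n * (2 * (real m)\<^sup>2 * K / ?v * r powr \<kappa>) = (2 * (real m)\<^sup>2 * r\<^sup>2) * KK"
      using v0 by (simp add: KK_def mult_ac)
  qed
  have "ennreal (?v * r ^ ?n) * P \<le> ennreal (?v * r ^ ?n) *
     (ennreal (2 * K / ?v * r powr (\<kappa> - 2)) * N1 + ennreal (2 * (real m)\<^sup>2 * K / ?v * r powr \<kappa>) * N2)"
  proof -
    have *: "ennreal (x * a) * N1 + ennreal (x * b) * N2 = ennreal x * (ennreal a * N1 + ennreal b * N2)"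
      if "x \<ge> 0" "a \<ge> 0" "b \<ge> 0" for x a b
      using that by (simp add: ennreal_mult distrib_left mult.assoc)
    have "2 * (ennreal KK * N1) + c0 * (ennreal KK * N2) =
        ennreal (2 * KK) * N1 + ennreal ((2 * (real m)\<^sup>2 * r\<^sup>2) * KK) * N2"
      using KK by (simp add: c0_def ennreal_mult mult.assoc)
    also have "\<dots> = ennreal (?v * r ^ ?n) *
     (ennreal (2 * K / ?v * r powr (\<kappa> - 2)) * N1 + ennreal (2 * (real m)\<^sup>2 * K / ?v * r powr \<kappa>) * N2)"
      unfolding e1[symmetric] using v r K by (intro *) auto
    finally show ?thesis using main by simp
  qed
  then have "P \<le> ennreal (2 * K / ?v * r powr (\<kappa> - 2)) * N1 + ennreal (2 * (real m)\<^sup>2 * K / ?v * r powr \<kappa>) * N2"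
    using v v0 r by (subst (asm) ennreal_mult_le_mult_iff) auto
  then show ?thesis unfolding P_def N1_def N2_def .
qed


lemma powr_le_one_plus: "0 \<le> t \<Longrightarrow> 0 \<le> a \<Longrightarrow> a \<le> 1 \<Longrightarrow> t powr a \<le> 1 + (t::real)"
proof (cases "t \<le> 1")
  case True
  assume "0 \<le> t" "0 \<le> a" "a \<le> 1"
  then have "t powr a \<le> 1" using True by (simp add: powr_le1)
  then show ?thesis using \<open>0 \<le> t\<close> by linarith
next
  case False
  assume "0 \<le> t" "0 \<le> a" "a \<le> 1"
  then have "t powr a \<le> t powr 1" using False by (intro powr_mono) auto
  then show ?thesis using False by simp
qed

lemma gain_of_integrability:
  fixes \<phi> :: "'a::euclidean_space \<Rightarrow> real"
  assumes \<phi>: "C1_grad_on UNIV \<phi> g" and S: "S > 0"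
    and N1: "(\<integral>\<^sup>+x. ennreal ((\<phi> x)\<^sup>2) \<partial>lborel) \<le> ennreal S"
    and N2: "(\<integral>\<^sup>+x. ennreal ((norm (g x))\<^sup>2) \<partial>lborel) \<le> ennreal S"
  shows "(\<integral>\<^sup>+x. ennreal (\<bar>\<phi> x\<bar> powr (2 * (1 + 1 / DIM('a)))) \<partial>lborel) \<le>
    ennreal (10 * (unit_ball_vol DIM('a) + 1) / unit_ball_vol DIM('a) * S powr (1 + 1 / DIM('a)))"
proof -
  let ?n = "DIM('a)" and ?v = "unit_ball_vol DIM('a)"
  have v: "?v > 0" by (rule unit_ball_vol_pos) simp
  then have v0: "?v \<noteq> 0" by (rule less_imp_neq[symmetric])
  have n: "real ?n \<ge> 1" using DIM_positive[where 'a='a] by linarith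
  define f where "f x = ennreal (\<bar>\<phi> x\<bar> powr (2 / ?n))" for x
  have [measurable]: "\<phi> \<in> borel_measurable borel"
    using C1_grad_on_continuous[OF \<phi>] by (rule borel_measurable_continuous_onI)
  have [measurable]: "f \<in> borel_measurable borel" unfolding f_def by measurable
  define K where "K = S powr (1 / ?n) * (?v + 1)"
  have K: "K \<ge> 0" using v by (simp add: K_def)
  have grow: "(\<integral>\<^sup>+x. f x * indicator (ball y s) x \<partial>lborel) \<le> ennreal (K * s powr (real ?n - 2 + 1))"
    if s: "0 < s" "s \<le> 1" for y s
  proof -
    define a where "a = S powr (1 / ?n) / s"
    have a: "a \<ge> 0" using s by (simp add: a_def)
    have pt: "f x * indicator (ball y s) x \<le>
        ennreal a * indicator (ball y s) x + ennreal (a * s ^ ?n / S) * ennreal ((\<phi> x)\<^sup>2)" for x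
    proof (cases "x \<in> ball y s")
      case True
      define t where "t = s ^ ?n * (\<phi> x)\<^sup>2 / S"
      have t: "t \<ge> 0" using s S by (simp add: t_def)
      have "\<bar>\<phi> x\<bar> powr (2 / ?n) = ((\<phi> x)\<^sup>2) powr (1 / ?n)"
      proof -
        have "(\<phi> x)\<^sup>2 = \<bar>\<phi> x\<bar> powr 2" by (simp add: powr_numeral)
        then show ?thesis by (simp only: powr_powr) simp
      qed
      also have "(\<phi> x)\<^sup>2 = S * t / s ^ ?n" using s S by (simp add: t_def)
      also have "(S * t / s ^ ?n) powr (1 / ?n) = S powr (1 / ?n) * t powr (1 / ?n) / (s ^ ?n) powr (1 / ?n)"
        using s S t by (simp add: powr_divide powr_mult)
      also have "(s ^ ?n) powr (1 / ?n) = s"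
        using s n by (simp add: powr_realpow[symmetric] powr_powr)
      finally have "\<bar>\<phi> x\<bar> powr (2 / ?n) = a * t powr (1 / ?n)" by (simp add: a_def)
      also have "\<dots> \<le> a * (1 + t)"
        using a t n by (intro mult_left_mono powr_le_one_plus) auto
      finally have "\<bar>\<phi> x\<bar> powr (2 / ?n) \<le> a + a * s ^ ?n / S * (\<phi> x)\<^sup>2"
        by (simp add: t_def algebra_simps)
      then have "f x \<le> ennreal (a + a * s ^ ?n / S * (\<phi> x)\<^sup>2)" unfolding f_def by (rule ennreal_leI)
      also have "\<dots> = ennreal a + ennreal (a * s ^ ?n / S) * ennreal ((\<phi> x)\<^sup>2)"
        using a s S by (subst ennreal_plus) (auto simp: ennreal_mult'[symmetric])
      finally show ?thesis using True by simp
    qed simp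
    have "(\<integral>\<^sup>+x. f x * indicator (ball y s) x \<partial>lborel) \<le>
        (\<integral>\<^sup>+x. ennreal a * indicator (ball y s) x + ennreal (a * s ^ ?n / S) * ennreal ((\<phi> x)\<^sup>2) \<partial>lborel)"
      by (intro nn_integral_mono pt)
    also have "\<dots> = ennreal a * emeasure lborel (ball y s) +
        ennreal (a * s ^ ?n / S) * (\<integral>\<^sup>+x. ennreal ((\<phi> x)\<^sup>2) \<partial>lborel)"
    proof (subst nn_integral_add)
      show "(\<lambda>x. ennreal a * indicator (ball y s) x) \<in> borel_measurable lborel"
        by (intro borel_measurable_times_ennreal borel_measurable_indicator borel_measurable_const) auto
    qed (auto simp: nn_integral_cmult nn_integral_cmult_indicator)
    also have "\<dots> \<le> ennreal a * ennreal (?v * s ^ ?n) + ennreal (a * s ^ ?n / S) * ennreal S"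
      using s N1 by (intro add_mono mult_left_mono) (auto simp: emeasure_ball)
    also have "\<dots> = ennreal (a * (?v * s ^ ?n) + a * s ^ ?n / S * S)"
      using a s S v by (subst ennreal_plus) (auto simp: ennreal_mult'[symmetric])
    also have "a * (?v * s ^ ?n) + a * s ^ ?n / S * S = K * (s ^ ?n / s)"
      using S s by (simp add: a_def K_def field_simps)
    also have "s ^ ?n / s = s powr (real ?n - 2 + 1)"
    proof -
      have "s powr (real ?n - 2 + 1) = s powr real ?n / s powr 1"
        by (simp only: powr_diff[symmetric]) simp
      then show ?thesis using s by (simp add: powr_realpow)
    qed
    finally show ?thesis .
  qed
  have "(\<integral>\<^sup>+x. ennreal (\<bar>\<phi> x\<bar> powr (2 * (1 + 1 / ?n))) \<partial>lborel) = (\<integral>\<^sup>+x. f x * ennreal ((\<phi> x)\<^sup>2) \<partial>lborel)"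
  proof (intro nn_integral_cong)
    fix x
    have "\<bar>\<phi> x\<bar> powr (2 * (1 + 1 / ?n)) = \<bar>\<phi> x\<bar> powr (2 / ?n) * \<bar>\<phi> x\<bar> powr 2"
      by (simp only: powr_add[symmetric]) (simp add: algebra_simps)
    also have "\<bar>\<phi> x\<bar> powr 2 = (\<phi> x)\<^sup>2" by (simp add: powr_numeral)
    finally show "ennreal (\<bar>\<phi> x\<bar> powr (2 * (1 + 1 / ?n))) = f x * ennreal ((\<phi> x)\<^sup>2)"
      by (simp add: f_def ennreal_mult)
  qed
  also have "\<dots> \<le> ennreal (2 * K / ?v * 1 powr (1 - 2)) * (\<integral>\<^sup>+x. ennreal ((\<phi> x)\<^sup>2) \<partial>lborel) +
    ennreal (2 * (real 2)\<^sup>2 * K / ?v * 1 powr 1) * (\<integral>\<^sup>+x. ennreal ((norm (g x))\<^sup>2) \<partial>lborel)"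
    by (rule trace_inequality[OF \<phi>, where m=2 and \<kappa>=1]) (use grow K in auto)
  also have "\<dots> \<le> ennreal (2 * K / ?v) * ennreal S + ennreal (8 * K / ?v) * ennreal S"
    using N1 N2 by (simp add: add_mono mult_left_mono)
  also have "\<dots> = ennreal (2 * K / ?v * S + 8 * K / ?v * S)"
    using K v S by (subst ennreal_plus) (auto simp: ennreal_mult'[symmetric])
  also have "2 * K / ?v * S + 8 * K / ?v * S = 10 * (?v + 1) / ?v * S powr (1 + 1 / ?n)"
  proof -
    have "S powr (1 + 1 / ?n) = S * S powr (1 / ?n)" using S by (simp only: powr_add powr_one)
    moreover have "2 * K / ?v * S + 8 * K / ?v * S = 10 * K / ?v * S" using v0 by (simp add: field_simps)
    ultimately show ?thesis by (simp add: K_def mult_ac)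
  qed
  finally show ?thesis .
qed

section \<open>Caccioppoli estimates for weak subsolutions\<close>

text \<open>\<open>G'\<close> stands for the derivative of a truncated \<open>\<beta>\<close>-th power \<open>G = \<integral> G'\<close>; the test functions are
  built from \<open>\<integral> G'\<^sup>2\<close>, so that the good term of the equation becomes the square of \<open>G'(u) |\<nabla>u|\<close>.\<close>

definition power_like :: "real \<Rightarrow> (real \<Rightarrow> real) \<Rightarrow> bool" where
  "power_like \<beta> G' \<longleftrightarrow> continuous_on {0..} G' \<and> mono_on {0..} G' \<and>
     (\<forall>t\<ge>0. 0 \<le> G' t \<and> t * G' t \<le> \<beta> * integral {0..t} G')"

lemma integral_from_0_has_derivative:
  assumes "continuous_on {0..} h" "(t::real) \<ge> 0"
  shows "((\<lambda>t. integral {0..t} h) has_real_derivative h t) (at t within {0..})"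
proof -
  have "((\<lambda>t. integral {0..t} h) has_real_derivative h t) (at t within {0..t + 1})"
    using assms by (intro integral_has_real_derivative) (auto intro: continuous_on_subset)
  moreover have "at t within {0..t + 1} = at t within {0..}"
    by (rule at_within_nhd[of _ "{..<t + 1}"]) auto
  ultimately show ?thesis by simp
qed

text \<open>Monotonicity bounds one factor of the square by its value at the endpoint. This compares
  the primitive of the square, which enters the test function, with the product of \<open>G'\<close>
  and its own primitive, which enters the estimates.\<close>

lemma power_like_integral_sq_le:
  assumes "power_like \<beta> G'" "t \<ge> 0"
  shows "0 \<le> integral {0..t} G'" "0 \<le> integral {0..t} (\<lambda>s. (G' s)\<^sup>2)"
    "integral {0..t} (\<lambda>s. (G' s)\<^sup>2) \<le> G' t * integral {0..t} G'"
proof -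
  have c: "continuous_on {0..t} G'" and nn: "\<And>s. s \<in> {0..t} \<Longrightarrow> 0 \<le> G' s"
    and mono: "\<And>s. s \<in> {0..t} \<Longrightarrow> G' s \<le> G' t"
    using assms by (auto simp: power_like_def mono_on_def intro: continuous_on_subset)
  have c2: "continuous_on {0..t} (\<lambda>s. (G' s)\<^sup>2)" by (intro continuous_intros c)
  show "0 \<le> integral {0..t} G'" "0 \<le> integral {0..t} (\<lambda>s. (G' s)\<^sup>2)"
    using c c2 nn by (auto intro!: integral_nonneg integrable_continuous_real)
  have "integral {0..t} (\<lambda>s. (G' s)\<^sup>2) \<le> integral {0..t} (\<lambda>s. G' t * G' s)"
    using c nn mono
    by (intro integral_le integrable_continuous_real continuous_intros) (auto simp: power2_eq_square intro: mult_right_mono)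
  then show "integral {0..t} (\<lambda>s. (G' s)\<^sup>2) \<le> G' t * integral {0..t} G'" by simp
qed

text \<open>The bracket dominates the coefficients left by Young's inequality in
  \<open>caccioppoli\<close>. Dividing by \<theta>/2 and then doubling, for the square of a sum of
  two terms, gives the factor 4/\<theta> and the summand 2.\<close>

definition caccioppoli_const :: "real \<Rightarrow> real \<Rightarrow> real \<Rightarrow> real" where
  "caccioppoli_const \<theta> \<Lambda> C = 4 * (4 * \<Lambda>\<^sup>2 / \<theta> + C\<^sup>2 / \<theta> + 2 * C) / \<theta> + 2"

text \<open>The field \<open>a\<close> is the flux belonging to the gradient \<open>gu\<close>; its
  ellipticity is recorded by the two inequalities \<open>a_elliptic\<close> and
  \<open>a_bound\<close> instead of a coefficient matrix. The function \<open>b\<close> will be the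
  length of \<Gamma>.\<close>

locale weak_subsolution =
  fixes U :: "'a::euclidean_space set" and u :: "'a \<Rightarrow> real" and gu a :: "'a \<Rightarrow> 'a"
    and b :: "'a \<Rightarrow> real" and \<theta> \<Lambda> C :: real
  assumes open_U: "open U" and u_C1: "C1_grad_on U u gu" and u_nonneg: "x \<in> U \<Longrightarrow> 0 \<le> u x"
    and a_cont: "continuous_on U a" and b_cont: "continuous_on U b" and b_nonneg: "x \<in> U \<Longrightarrow> 0 \<le> b x"
    and csigns: "\<theta> > 0" "\<Lambda> \<ge> 0" "C \<ge> 0"
    and a_elliptic: "x \<in> U \<Longrightarrow> \<theta> * (norm (gu x))\<^sup>2 \<le> a x \<bullet> gu x"
    and a_bound: "x \<in> U \<Longrightarrow> norm (a x) \<le> \<Lambda> * norm (gu x)"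
    and weak: "test_fun U K \<phi> g\<phi> \<Longrightarrow> (\<And>x. 0 \<le> \<phi> x) \<Longrightarrow>
      (LINT x|lborel. a x \<bullet> g\<phi> x) \<le>
        C * (LINT x|lborel. (b x)\<^sup>2 * u x * \<phi> x + b x * u x * norm (g\<phi> x))"
begin

lemma u_cont: "continuous_on U u" and gu_cont: "continuous_on U gu"
  using u_C1 C1_grad_on_continuous by (auto simp: C1_grad_on_def)

lemma compose_C1:
  assumes "\<And>t. t \<ge> 0 \<Longrightarrow> (h has_real_derivative h' t) (at t within {0..})" "continuous_on {0..} h'"
  shows "C1_grad_on U (\<lambda>x. h (u x)) (\<lambda>x. h' (u x) *\<^sub>R gu x)"
  unfolding C1_grad_on_def
proof (intro conjI ballI)
  fix x assume x: "x \<in> U"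
  show "GDERIV (\<lambda>x. h (u x)) x :> h' (u x) *\<^sub>R gu x"
    using u_C1 x assms(1)[OF u_nonneg[OF x]] u_nonneg
    by (intro GDERIV_compose_within[OF _ _ open_U x]) (auto simp: C1_grad_on_def)
next
  show "continuous_on U (\<lambda>x. h' (u x) *\<^sub>R gu x)"
    using u_nonneg by (intro continuous_intros gu_cont continuous_on_compose2[OF assms(2) u_cont]) auto
qed

text \<open>The test function is the primitive of the square of \<open>G'\<close>, evaluated at
  \<open>u\<close>, times the square of \<open>\<zeta>\<close>. Every other term of the inequality
  is a product of two of the quantities \<open>X\<close> (good gradient), \<open>Y\<close> (cutoff
  gradient) and \<open>Z\<close> (drift). The parameter \<beta> enters only through
  \<open>u * G'\<close> being at most \<beta> times \<open>G\<close>, which trades the factor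
  \<open>u\<close> of the drift terms for \<open>G\<close>.\<close>

lemma caccioppoli:
  assumes \<zeta>: "test_fun U K \<zeta> g\<zeta>" "\<And>x. 0 \<le> \<zeta> x" and \<beta>: "\<beta> \<ge> 1" and G': "power_like \<beta> G'"
  defines "G \<equiv> \<lambda>x. integral {0..u x} G'"
  shows "(LINT x|lborel. (norm (G x *\<^sub>R g\<zeta> x + (\<zeta> x * G' (u x)) *\<^sub>R gu x))\<^sup>2) \<le>
    caccioppoli_const \<theta> \<Lambda> C *
      (LINT x|lborel. (norm (g\<zeta> x))\<^sup>2 * (G x)\<^sup>2 + \<beta>\<^sup>2 * ((b x)\<^sup>2 * (\<zeta> x * G x)\<^sup>2))"
proof -
  define g where "g x = integral {0..u x} (\<lambda>s. (G' s)\<^sup>2)" for x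
  have K: "compact K" "K \<subseteq> U" "C1_grad_on UNIV \<zeta> g\<zeta>" "\<And>x. x \<notin> K \<Longrightarrow> \<zeta> x = 0" "\<And>x. x \<notin> K \<Longrightarrow> g\<zeta> x = 0"
    using \<zeta> test_fun_grad_zero[OF \<zeta>(1)] by (auto simp: test_fun_def)
  have G'c: "continuous_on {0..} G'" using G' by (simp add: power_like_def)
  have g_C1: "C1_grad_on U g (\<lambda>x. (G' (u x))\<^sup>2 *\<^sub>R gu x)"
    unfolding g_def by (intro compose_C1 integral_from_0_has_derivative continuous_intros G'c)
  have G_C1: "C1_grad_on U G (\<lambda>x. G' (u x) *\<^sub>R gu x)"
    unfolding G_def by (intro compose_C1 integral_from_0_has_derivative continuous_intros G'c)
  have \<zeta>2: "test_fun U K (\<lambda>x. \<zeta> x * \<zeta> x) (\<lambda>x. \<zeta> x *\<^sub>R g\<zeta> x + \<zeta> x *\<^sub>R g\<zeta> x)"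
    by (rule test_fun_mult[OF open_U C1_grad_on_subset[OF K(3)] \<zeta>(1)]) simp
  define \<phi> where "\<phi> x = g x * (\<zeta> x * \<zeta> x)" for x
  define g\<phi> where "g\<phi> x = g x *\<^sub>R (\<zeta> x *\<^sub>R g\<zeta> x + \<zeta> x *\<^sub>R g\<zeta> x) + (\<zeta> x * \<zeta> x) *\<^sub>R ((G' (u x))\<^sup>2 *\<^sub>R gu x)" for x
  have \<phi>: "test_fun U K \<phi> g\<phi>"
    unfolding \<phi>_def g\<phi>_def by (rule test_fun_mult[OF open_U g_C1 \<zeta>2])
  have gG: "0 \<le> g x" "0 \<le> G x" "0 \<le> G' (u x)" "g x \<le> G' (u x) * G x" "u x * G' (u x) \<le> \<beta> * G x"
    if "x \<in> U" for x
    using power_like_integral_sq_le[OF G' u_nonneg[OF that]] u_nonneg[OF that] G'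
    by (auto simp: g_def G_def power_like_def)
  have \<phi>0: "0 \<le> \<phi> x" for x
    using gG(1)[of x] K(2,4) by (cases "x \<in> K") (auto simp: \<phi>_def)
  have cU: "continuous_on U (\<lambda>x. G' (u x))"
    using u_nonneg by (intro continuous_on_compose2[OF G'c u_cont]) auto
  have c: "continuous_on K \<zeta>" "continuous_on K g\<zeta>" "continuous_on K u" "continuous_on K gu"
    "continuous_on K a" "continuous_on K b" "continuous_on K G" "continuous_on K g"
    "continuous_on K (\<lambda>x. G' (u x))"
    using K(3) C1_grad_on_continuous[OF K(3)] C1_grad_on_continuous[OF G_C1] C1_grad_on_continuous[OF g_C1]
      u_cont gu_cont a_cont b_cont cU continuous_on_subset[OF _ K(2)] continuous_on_subset[OF _ subset_UNIV]
    by (auto simp: C1_grad_on_def)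
  define X where "X x = \<zeta> x * G' (u x) * norm (gu x)" for x
  define Y where "Y x = norm (g\<zeta> x) * G x" for x
  define Z where "Z x = b x * (\<zeta> x * G x)" for x
  define c1 where "c1 = 4 * \<Lambda>\<^sup>2 / \<theta> + C\<^sup>2 / \<theta> + 2 * C"
  have c1: "c1 \<ge> 0" using csigns by (simp add: c1_def)
  define L where "L x = a x \<bullet> g\<phi> x" for x
  define R where "R x = (b x)\<^sup>2 * u x * \<phi> x + b x * u x * norm (g\<phi> x)" for x
  have cXYZ: "continuous_on K X" "continuous_on K Y" "continuous_on K Z" "continuous_on K L" "continuous_on K R"
    unfolding X_def Y_def Z_def L_def R_def \<phi>_def g\<phi>_def by (intro continuous_intros c)+
  have zXYZ: "X x = 0" "Y x = 0" "Z x = 0" "L x = 0" "R x = 0" if "x \<notin> K" for x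
    using K(4,5)[OF that] by (auto simp: X_def Y_def Z_def L_def R_def \<phi>_def g\<phi>_def)
  note ii = integrable_compact_support[OF K(1)]
  have i: "integrable lborel (\<lambda>x. (X x)\<^sup>2)" "integrable lborel (\<lambda>x. (Y x)\<^sup>2)" "integrable lborel (\<lambda>x. (Z x)\<^sup>2)"
    "integrable lborel L" "integrable lborel R"
    by (intro ii continuous_intros cXYZ; simp add: zXYZ)+
  \<comment> \<open>Young's inequality is applied before integrating. Two quarters of \<theta> X^2
    pay for the products of X with Y and with Z, half remains, and \<open>L - C * R\<close> has
    nonpositive integral by \<open>weak\<close>.\<close>
  have pointwise: "\<theta> / 2 * (X x)\<^sup>2 \<le> L x - C * R x + c1 * ((Y x)\<^sup>2 + \<beta>\<^sup>2 * (Z x)\<^sup>2)" for x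
  proof (cases "x \<in> K")
    case True
    then have x: "x \<in> U" using K(2) by auto
    note n = gG[OF x] \<zeta>(2)[of x] b_nonneg[OF x] u_nonneg[OF x]
    have nn: "X x \<ge> 0" "Y x \<ge> 0" "Z x \<ge> 0" using n by (auto simp: X_def Y_def Z_def)
    have L: "L x \<ge> \<theta> * (X x)\<^sup>2 - 2 * \<Lambda> * (X x * Y x)"
    proof -
      have "L x = 2 * (g x * \<zeta> x) * (a x \<bullet> g\<zeta> x) + (\<zeta> x * G' (u x))\<^sup>2 * (a x \<bullet> gu x)"
        by (simp add: L_def g\<phi>_def inner_add_right power2_eq_square algebra_simps)
      moreover have "(\<zeta> x * G' (u x))\<^sup>2 * (a x \<bullet> gu x) \<ge> (\<zeta> x * G' (u x))\<^sup>2 * (\<theta> * (norm (gu x))\<^sup>2)"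
        using a_elliptic[OF x] by (intro mult_left_mono) auto
      moreover have "(g x * \<zeta> x) * (a x \<bullet> g\<zeta> x) \<ge> - (\<Lambda> * (X x * Y x))"
      proof -
        have "\<bar>a x \<bullet> g\<zeta> x\<bar> \<le> norm (a x) * norm (g\<zeta> x)" by (rule Cauchy_Schwarz_ineq2)
        also have "\<dots> \<le> (\<Lambda> * norm (gu x)) * norm (g\<zeta> x)" using a_bound[OF x] by (intro mult_right_mono) auto
        finally have "\<bar>(g x * \<zeta> x) * (a x \<bullet> g\<zeta> x)\<bar> \<le> (g x * \<zeta> x) * ((\<Lambda> * norm (gu x)) * norm (g\<zeta> x))"
          using n by (simp add: abs_mult mult_left_mono)
        also have "\<dots> \<le> ((G' (u x) * G x) * \<zeta> x) * ((\<Lambda> * norm (gu x)) * norm (g\<zeta> x))"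
          using n csigns by (intro mult_right_mono) auto
        also have "\<dots> = \<Lambda> * (X x * Y x)" by (simp add: X_def Y_def)
        finally show ?thesis by linarith
      qed
      ultimately show ?thesis by (simp add: X_def power_mult_distrib algebra_simps)
    qed
    have ug: "u x * g x \<le> \<beta> * (G x)\<^sup>2"
    proof -
      have "u x * g x \<le> u x * (G' (u x) * G x)" using n by (intro mult_left_mono) auto
      also have "\<dots> \<le> (\<beta> * G x) * G x" using n by (simp add: mult.assoc[symmetric] mult_right_mono)
      finally show ?thesis by (simp add: power2_eq_square mult.assoc)
    qed
    have R: "R x \<le> \<beta> * (Z x)\<^sup>2 + 2 * \<beta> * (Z x * Y x) + \<beta> * (Z x * X x)"
    proof -
      have "norm (g\<phi> x) \<le> norm (g x *\<^sub>R (\<zeta> x *\<^sub>R g\<zeta> x + \<zeta> x *\<^sub>R g\<zeta> x)) + norm ((\<zeta> x * \<zeta> x) *\<^sub>R ((G' (u x))\<^sup>2 *\<^sub>R gu x))"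
        unfolding g\<phi>_def by (rule norm_triangle_ineq)
      also have "\<zeta> x *\<^sub>R g\<zeta> x + \<zeta> x *\<^sub>R g\<zeta> x = (2 * \<zeta> x) *\<^sub>R g\<zeta> x" by (simp add: scaleR_2[symmetric])
      finally have "norm (g\<phi> x) \<le> 2 * (g x * \<zeta> x) * norm (g\<zeta> x) + (\<zeta> x * G' (u x))\<^sup>2 * norm (gu x)"
        using n by (simp add: power2_eq_square mult_ac)
      then have "b x * u x * norm (g\<phi> x) \<le> b x * u x * (2 * (g x * \<zeta> x) * norm (g\<zeta> x) + (\<zeta> x * G' (u x))\<^sup>2 * norm (gu x))"
        using n by (intro mult_left_mono) auto
      also have "\<dots> = (2 * b x * \<zeta> x * norm (g\<zeta> x)) * (u x * g x) + (b x * (\<zeta> x)\<^sup>2 * G' (u x) * norm (gu x)) * (u x * G' (u x))"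
        by (simp add: power2_eq_square algebra_simps)
      also have "\<dots> \<le> (2 * b x * \<zeta> x * norm (g\<zeta> x)) * (\<beta> * (G x)\<^sup>2) + (b x * (\<zeta> x)\<^sup>2 * G' (u x) * norm (gu x)) * (\<beta> * G x)"
        using n ug by (intro add_mono mult_left_mono) auto
      also have "\<dots> = 2 * \<beta> * (Z x * Y x) + \<beta> * (Z x * X x)"
        by (simp add: X_def Y_def Z_def power2_eq_square algebra_simps)
      finally have 1: "b x * u x * norm (g\<phi> x) \<le> 2 * \<beta> * (Z x * Y x) + \<beta> * (Z x * X x)" .
      have "(b x)\<^sup>2 * u x * \<phi> x = ((b x)\<^sup>2 * (\<zeta> x)\<^sup>2) * (u x * g x)"
        by (simp add: \<phi>_def power2_eq_square algebra_simps)
      also have "\<dots> \<le> ((b x)\<^sup>2 * (\<zeta> x)\<^sup>2) * (\<beta> * (G x)\<^sup>2)" using ug by (intro mult_left_mono) auto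
      also have "\<dots> = \<beta> * (Z x)\<^sup>2" by (simp add: Z_def power_mult_distrib)
      finally show ?thesis using 1 by (simp add: R_def)
    qed
    \<comment> \<open>Since \<beta> is at least 1, one factor \<beta> may be rounded up to
      \<beta>^2, so that all drift terms are expressed through the single quantity \<beta>
      Z.\<close>
    define W where "W = \<beta> * Z x"
    have W: "W \<ge> 0" using nn \<beta> by (simp add: W_def)
    have e1: "2 * \<Lambda> * (X x * Y x) \<le> \<theta> / 4 * (X x)\<^sup>2 + 4 * \<Lambda>\<^sup>2 / \<theta> * (Y x)\<^sup>2"
    proof -
      have "0 \<le> (\<theta> / 2 * X x - 2 * \<Lambda> * Y x)\<^sup>2 / \<theta>" using csigns by simp
      also have "\<dots> = \<theta> / 4 * (X x)\<^sup>2 + 4 * \<Lambda>\<^sup>2 / \<theta> * (Y x)\<^sup>2 - 2 * \<Lambda> * (X x * Y x)"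
        using csigns by (simp add: power2_eq_square field_simps)
      finally show ?thesis by simp
    qed
    have e2: "C * (W * X x) \<le> \<theta> / 4 * (X x)\<^sup>2 + C\<^sup>2 / \<theta> * W\<^sup>2"
    proof -
      have "0 \<le> (\<theta> / 2 * X x - C * W)\<^sup>2 / \<theta>" using csigns by simp
      also have "\<dots> = \<theta> / 4 * (X x)\<^sup>2 + C\<^sup>2 / \<theta> * W\<^sup>2 - C * (W * X x)"
        using csigns by (simp add: power2_eq_square field_simps)
      finally show ?thesis by simp
    qed
    have e3: "2 * (W * Y x) \<le> W\<^sup>2 + (Y x)\<^sup>2" using sum_squares_bound[of W "Y x"] by simp
    have e4: "\<beta> * (Z x)\<^sup>2 \<le> W\<^sup>2"
    proof -
      have "\<beta> * (Z x)\<^sup>2 \<le> (\<beta> * \<beta>) * (Z x)\<^sup>2"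
        using \<beta> by (intro mult_right_mono) (auto simp: mult_le_cancel_left1)
      then show ?thesis by (simp add: W_def power2_eq_square mult_ac)
    qed
    have "R x \<le> W\<^sup>2 + (W\<^sup>2 + (Y x)\<^sup>2) + W * X x"
      using R e3 e4 by (simp add: W_def mult_ac)
    then have "C * R x \<le> C * (W\<^sup>2 + (W\<^sup>2 + (Y x)\<^sup>2) + W * X x)"
      using csigns by (intro mult_left_mono) auto
    then have "C * R x \<le> 2 * C * W\<^sup>2 + C * (Y x)\<^sup>2 + (\<theta> / 4 * (X x)\<^sup>2 + C\<^sup>2 / \<theta> * W\<^sup>2)"
      using e2 by (simp add: algebra_simps)
    with L e1 have "\<theta> / 2 * (X x)\<^sup>2 \<le> L x - C * R x + (4 * \<Lambda>\<^sup>2 / \<theta> + C) * (Y x)\<^sup>2 + (2 * C + C\<^sup>2 / \<theta>) * W\<^sup>2"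
      by (simp add: algebra_simps)
    also have "\<dots> \<le> L x - C * R x + c1 * (Y x)\<^sup>2 + c1 * W\<^sup>2"
      using csigns by (intro add_mono mult_right_mono) (auto simp: c1_def)
    finally show ?thesis by (simp add: W_def power_mult_distrib algebra_simps)
  qed (simp add: zXYZ)
  have iYZ: "integrable lborel (\<lambda>x. (Y x)\<^sup>2 + \<beta>\<^sup>2 * (Z x)\<^sup>2)" using i by simp
  have "\<theta> / 2 * (LINT x|lborel. (X x)\<^sup>2) = (LINT x|lborel. \<theta> / 2 * (X x)\<^sup>2)" by simp
  also have "\<dots> \<le> (LINT x|lborel. L x - C * R x + c1 * ((Y x)\<^sup>2 + \<beta>\<^sup>2 * (Z x)\<^sup>2))"
    using i iYZ by (intro integral_mono pointwise) auto
  also have "\<dots> = (LINT x|lborel. L x) - C * (LINT x|lborel. R x) + c1 * (LINT x|lborel. (Y x)\<^sup>2 + \<beta>\<^sup>2 * (Z x)\<^sup>2)"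
    using i iYZ by simp
  also have "\<dots> \<le> c1 * (LINT x|lborel. (Y x)\<^sup>2 + \<beta>\<^sup>2 * (Z x)\<^sup>2)"
    using weak[OF \<phi> \<phi>0] by (simp add: L_def R_def)
  finally have X: "(LINT x|lborel. (X x)\<^sup>2) \<le> 2 * c1 / \<theta> * (LINT x|lborel. (Y x)\<^sup>2 + \<beta>\<^sup>2 * (Z x)\<^sup>2)"
    using csigns by (simp add: field_simps)
  have "(LINT x|lborel. (norm (G x *\<^sub>R g\<zeta> x + (\<zeta> x * G' (u x)) *\<^sub>R gu x))\<^sup>2) \<le>
      (LINT x|lborel. 2 * (X x)\<^sup>2 + 2 * ((Y x)\<^sup>2 + \<beta>\<^sup>2 * (Z x)\<^sup>2))"
  proof (rule integral_mono)
    show "integrable lborel (\<lambda>x. (norm (G x *\<^sub>R g\<zeta> x + (\<zeta> x * G' (u x)) *\<^sub>R gu x))\<^sup>2)"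
      by (intro ii continuous_intros c) (simp add: K)
    show "integrable lborel (\<lambda>x. 2 * (X x)\<^sup>2 + 2 * ((Y x)\<^sup>2 + \<beta>\<^sup>2 * (Z x)\<^sup>2))" using i iYZ by simp
    fix x
    show "(norm (G x *\<^sub>R g\<zeta> x + (\<zeta> x * G' (u x)) *\<^sub>R gu x))\<^sup>2 \<le> 2 * (X x)\<^sup>2 + 2 * ((Y x)\<^sup>2 + \<beta>\<^sup>2 * (Z x)\<^sup>2)"
    proof (cases "x \<in> K")
      case True
      then have x: "x \<in> U" using K(2) by auto
      have "norm (G x *\<^sub>R g\<zeta> x + (\<zeta> x * G' (u x)) *\<^sub>R gu x) \<le> norm (G x *\<^sub>R g\<zeta> x) + norm ((\<zeta> x * G' (u x)) *\<^sub>R gu x)"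
        by (rule norm_triangle_ineq)
      also have "\<dots> = Y x + X x" using gG[OF x] \<zeta>(2)[of x] by (simp add: X_def Y_def)
      finally have "(norm (G x *\<^sub>R g\<zeta> x + (\<zeta> x * G' (u x)) *\<^sub>R gu x))\<^sup>2 \<le> (Y x + X x)\<^sup>2"
        by (intro power_mono) auto
      also have "\<dots> \<le> 2 * (X x)\<^sup>2 + 2 * (Y x)\<^sup>2" using sum_squares_bound[of "Y x" "X x"] by (simp add: power2_sum)
      also have "\<dots> \<le> 2 * (X x)\<^sup>2 + 2 * ((Y x)\<^sup>2 + \<beta>\<^sup>2 * (Z x)\<^sup>2)" by simp
      finally show ?thesis .
    qed (simp add: K)
  qed
  also have "\<dots> = 2 * (LINT x|lborel. (X x)\<^sup>2) + 2 * (LINT x|lborel. (Y x)\<^sup>2 + \<beta>\<^sup>2 * (Z x)\<^sup>2)"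
    using i iYZ by simp
  also have "\<dots> \<le> 2 * (2 * c1 / \<theta> * (LINT x|lborel. (Y x)\<^sup>2 + \<beta>\<^sup>2 * (Z x)\<^sup>2)) + 2 * (LINT x|lborel. (Y x)\<^sup>2 + \<beta>\<^sup>2 * (Z x)\<^sup>2)"
    using X by (intro add_mono mult_left_mono) auto
  also have "\<dots> = caccioppoli_const \<theta> \<Lambda> C * (LINT x|lborel. (Y x)\<^sup>2 + \<beta>\<^sup>2 * (Z x)\<^sup>2)"
    unfolding caccioppoli_const_def c1_def[symmetric] by (simp add: algebra_simps)
  finally show ?thesis by (simp add: Y_def Z_def power_mult_distrib)
qed

end

section \<open>Absorption of the drift term under a Morrey condition\<close>

definition gain_const :: "real \<Rightarrow> real" where
  "gain_const n = 10 * (unit_ball_vol n + 1) / unit_ball_vol n"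

text \<open>The number added to 1 inside the power is the quantity \<open>D\<close> of
  \<open>energy_bound\<close>, and the exponent 2/\<kappa> comes from the negative power of the
  radius at which the drift is absorbed.\<close>

definition energy_const :: "real \<Rightarrow> real \<Rightarrow> real \<Rightarrow> real \<Rightarrow> real \<Rightarrow> real \<Rightarrow> real" where
  "energy_const n \<theta> \<Lambda> C M \<kappa> = 2 * caccioppoli_const \<theta> \<Lambda> C + 1 +
    2 * (1 + 4 * caccioppoli_const \<theta> \<Lambda> C * M * (real (nat \<lceil>2 / \<kappa>\<rceil>))\<^sup>2 / unit_ball_vol n) powr (2 / \<kappa>)"

locale morrey_subsolution = weak_subsolution U u gu a b \<theta> \<Lambda> C
  for U :: "'a::euclidean_space set" and u gu a b \<theta> \<Lambda> C +
  fixes M \<kappa> :: real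
  assumes morrey_signs: "M \<ge> 0" "0 < \<kappa>" "\<kappa> \<le> 1"
    and morrey: "0 < s \<Longrightarrow> s \<le> 1 \<Longrightarrow>
      (\<integral>\<^sup>+x. ennreal (indicator U x * (b x)\<^sup>2) * indicator (ball y s) x \<partial>lborel) \<le>
        ennreal (M * s powr (real DIM('a) - 2 + \<kappa>))"
begin

lemma caccioppoli_const_pos: "caccioppoli_const \<theta> \<Lambda> C > 0"
proof -
  have "0 \<le> 4 * (4 * \<Lambda>\<^sup>2 / \<theta> + C\<^sup>2 / \<theta> + 2 * C) / \<theta>" using csigns by simp
  then show ?thesis unfolding caccioppoli_const_def by linarith
qed

text \<open>Apply \<open>trace_inequality\<close> with weight \<open>b\<close> squared to
  \<open>G \<zeta>\<close>, at a radius depending on \<beta>. The radius must be so small that the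
  gradient coefficient beats the factor \<beta>^2 of \<open>caccioppoli\<close>. The price is the
  coefficient of the zeroth order term, which grows like \<beta> to the power 4/\<kappa>:
  polynomially, as the Moser iteration can afford.\<close>

lemma energy_bound:
  assumes \<zeta>: "test_fun U K \<zeta> g\<zeta>" "\<And>x. 0 \<le> \<zeta> x" and \<beta>: "\<beta> \<ge> 1" and G': "power_like \<beta> G'"
  defines "G \<equiv> \<lambda>x. integral {0..u x} G'"
  defines "g\<psi> \<equiv> \<lambda>x. G x *\<^sub>R g\<zeta> x + (\<zeta> x * G' (u x)) *\<^sub>R gu x"
  shows "test_fun U K (\<lambda>x. G x * \<zeta> x) g\<psi>"
    and "(LINT x|lborel. (\<zeta> x * G x)\<^sup>2) + (LINT x|lborel. (norm (g\<psi> x))\<^sup>2) \<le>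
      energy_const DIM('a) \<theta> \<Lambda> C M \<kappa> *
        (LINT x|lborel. (norm (g\<zeta> x))\<^sup>2 * (G x)\<^sup>2 + \<beta> powr (4 / \<kappa>) * (\<zeta> x * G x)\<^sup>2)"
proof -
  let ?c = "caccioppoli_const \<theta> \<Lambda> C" and ?v = "unit_ball_vol DIM('a)"
  \<comment> \<open>The least natural number with m \<kappa> at least 2, as
    \<open>trace_inequality\<close> demands.\<close>
  define m where "m = nat \<lceil>2 / \<kappa>\<rceil>"
  have G'c: "continuous_on {0..} G'" using G' by (simp add: power_like_def)
  have G_C1: "C1_grad_on U G (\<lambda>x. G' (u x) *\<^sub>R gu x)"
    unfolding G_def by (intro compose_C1 integral_from_0_has_derivative G'c)
  show \<psi>: "test_fun U K (\<lambda>x. G x * \<zeta> x) g\<psi>"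
    using test_fun_mult[OF open_U G_C1 \<zeta>(1)] by (simp add: g\<psi>_def)
  have K: "compact K" "K \<subseteq> U" "C1_grad_on UNIV \<zeta> g\<zeta>" "\<And>x. x \<notin> K \<Longrightarrow> \<zeta> x = 0" "\<And>x. x \<notin> K \<Longrightarrow> g\<zeta> x = 0"
    using \<zeta> test_fun_grad_zero[OF \<zeta>(1)] by (auto simp: test_fun_def)
  have \<psi>1: "C1_grad_on UNIV (\<lambda>x. G x * \<zeta> x) g\<psi>" "\<And>x. x \<notin> K \<Longrightarrow> g\<psi> x = 0"
    using \<psi> test_fun_grad_zero[OF \<psi>] by (auto simp: test_fun_def)
  have c: "continuous_on K \<zeta>" "continuous_on K g\<zeta>" "continuous_on K b" "continuous_on K G" "continuous_on K g\<psi>"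
    using K(3) C1_grad_on_continuous[OF K(3)] C1_grad_on_continuous[OF G_C1] \<psi>1(1)
      b_cont continuous_on_subset[OF _ K(2)] continuous_on_subset[OF _ subset_UNIV]
    by (auto simp: C1_grad_on_def)
  note ii = integrable_compact_support[OF K(1)]
  have i: "integrable lborel (\<lambda>x. (\<zeta> x * G x)\<^sup>2)" "integrable lborel (\<lambda>x. (norm (g\<psi> x))\<^sup>2)"
    "integrable lborel (\<lambda>x. (norm (g\<zeta> x))\<^sup>2 * (G x)\<^sup>2)" "integrable lborel (\<lambda>x. (b x)\<^sup>2 * (\<zeta> x * G x)\<^sup>2)"
    by (intro ii continuous_intros c; simp add: K \<psi>1)+
  define N where "N = (LINT x|lborel. (\<zeta> x * G x)\<^sup>2)"
  define E where "E = (LINT x|lborel. (norm (g\<psi> x))\<^sup>2)"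
  define Y where "Y = (LINT x|lborel. (norm (g\<zeta> x))\<^sup>2 * (G x)\<^sup>2)"
  define B where "B = (LINT x|lborel. (b x)\<^sup>2 * (\<zeta> x * G x)\<^sup>2)"
  have nn: "N \<ge> 0" "E \<ge> 0" "Y \<ge> 0" "B \<ge> 0"
    unfolding N_def E_def Y_def B_def by (auto intro!: integral_nonneg_AE)
  have v: "?v > 0" by (rule unit_ball_vol_pos) simp
  then have v0: "?v \<noteq> 0" by (rule less_imp_neq[symmetric])
  note cpos = caccioppoli_const_pos
  have E: "E \<le> ?c * (Y + \<beta>\<^sup>2 * B)"
    using caccioppoli[OF \<zeta> \<beta> G'] i(3,4) by (simp add: E_def Y_def B_def G_def g\<psi>_def)
  have m: "2 / \<kappa> \<le> real m" "1 \<le> m"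
  proof -
    show "2 / \<kappa> \<le> real m" unfolding m_def by linarith
    moreover have "2 / \<kappa> > 0" using morrey_signs by simp
    ultimately show "1 \<le> m" by (cases m) auto
  qed
  define D where "D = 4 * ?c * M * (real m)\<^sup>2 / ?v"
  have D: "D \<ge> 0" unfolding D_def using v cpos morrey_signs by simp
  \<comment> \<open>The radius \<open>r\<close> is then fixed by
    \<open>r powr \<kappa> = 1 / h\<close>. The gradient coefficient becomes (h - 1) / (2 h), below
    one half, and the zeroth order coefficient is at most
    \<open>h powr (2 / \<kappa>)\<close>.\<close>
  define h where "h = 1 + D * \<beta>\<^sup>2"
  have h: "h \<ge> 1" unfolding h_def using D by simp
  define r where "r = h powr (- (1 / \<kappa>))"
  have r: "0 < r" "r \<le> 1"
    using h morrey_signs powr_mono[of "- (1 / \<kappa>)" 0 h] by (auto simp: r_def)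
  have r\<kappa>: "r powr \<kappa> = 1 / h" "r powr (\<kappa> - 2) = 1 / h * h powr (2 / \<kappa>)"
  proof -
    have "r powr \<kappa> = h powr (- 1)"
      unfolding r_def powr_powr using morrey_signs by simp
    then show "r powr \<kappa> = 1 / h" using h by (simp add: powr_minus_divide)
    then have "r powr \<kappa> = 1 / h" .
    moreover have "r powr (- 2) = h powr (2 / \<kappa>)" by (simp add: r_def powr_powr)
    moreover have "r powr (\<kappa> - 2) = r powr \<kappa> * r powr (- 2)" by (simp only: powr_add[symmetric]) simp
    ultimately show "r powr (\<kappa> - 2) = 1 / h * h powr (2 / \<kappa>)" by simp
  qed
  have "(\<lambda>x. indicator U x *\<^sub>R (b x)\<^sup>2) \<in> borel_measurable borel"
    using open_U by (intro borel_measurable_continuous_on_indicator continuous_intros b_cont) auto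
  then have fm: "(\<lambda>x. ennreal (indicator U x * (b x)\<^sup>2)) \<in> borel_measurable borel" by simp
  have "(\<integral>\<^sup>+x. ennreal (indicator U x * (b x)\<^sup>2) * ennreal ((G x * \<zeta> x)\<^sup>2) \<partial>lborel) \<le>
    ennreal (2 * M / ?v * r powr (\<kappa> - 2)) * (\<integral>\<^sup>+x. ennreal ((G x * \<zeta> x)\<^sup>2) \<partial>lborel) +
    ennreal (2 * (real m)\<^sup>2 * M / ?v * r powr \<kappa>) * (\<integral>\<^sup>+x. ennreal ((norm (g\<psi> x))\<^sup>2) \<partial>lborel)"
    using morrey r m morrey_signs
    by (intro trace_inequality[OF \<psi>1(1) fm]) (auto simp: field_simps)
  moreover have "(\<integral>\<^sup>+x. ennreal (indicator U x * (b x)\<^sup>2) * ennreal ((G x * \<zeta> x)\<^sup>2) \<partial>lborel) = ennreal B"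
  proof -
    have "(\<integral>\<^sup>+x. ennreal (indicator U x * (b x)\<^sup>2) * ennreal ((G x * \<zeta> x)\<^sup>2) \<partial>lborel) =
        (\<integral>\<^sup>+x. ennreal ((b x)\<^sup>2 * (\<zeta> x * G x)\<^sup>2) \<partial>lborel)"
    proof (rule nn_integral_cong)
      fix x
      show "ennreal (indicator U x * (b x)\<^sup>2) * ennreal ((G x * \<zeta> x)\<^sup>2) = ennreal ((b x)\<^sup>2 * (\<zeta> x * G x)\<^sup>2)"
        using K(2,4) by (cases "x \<in> K") (auto simp: ennreal_mult mult.commute)
    qed
    then show ?thesis unfolding B_def using i(4) by (simp add: nn_integral_eq_integral)
  qed
  moreover have "(\<integral>\<^sup>+x. ennreal ((G x * \<zeta> x)\<^sup>2) \<partial>lborel) = ennreal N"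
    unfolding N_def using i(1) by (simp add: nn_integral_eq_integral mult.commute)
  moreover have "(\<integral>\<^sup>+x. ennreal ((norm (g\<psi> x))\<^sup>2) \<partial>lborel) = ennreal E"
    unfolding E_def using i(2) by (simp add: nn_integral_eq_integral)
  ultimately have "ennreal B \<le> ennreal (2 * M / ?v * r powr (\<kappa> - 2)) * ennreal N +
      ennreal (2 * (real m)\<^sup>2 * M / ?v * r powr \<kappa>) * ennreal E" by simp
  also have "\<dots> = ennreal (2 * M / ?v * r powr (\<kappa> - 2) * N + 2 * (real m)\<^sup>2 * M / ?v * r powr \<kappa> * E)"
    using nn v morrey_signs by (subst ennreal_plus) (auto simp: ennreal_mult''[symmetric])
  finally have B: "B \<le> 2 * M / ?v * r powr (\<kappa> - 2) * N + 2 * (real m)\<^sup>2 * M / ?v * r powr \<kappa> * E"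
    using nn v morrey_signs by (subst (asm) ennreal_le_iff) auto
  define T where "T = \<beta> powr (4 / \<kappa>)"
  have T: "T \<ge> 1" unfolding T_def using \<beta> morrey_signs by (simp add: ge_one_powr_ge_zero)
  define H where "H = (1 + D) powr (2 / \<kappa>)"
  have H: "H \<ge> 0" unfolding H_def by simp
  have e2: "?c * \<beta>\<^sup>2 * (2 * (real m)\<^sup>2 * M / ?v * r powr \<kappa>) \<le> 1 / 2"
  proof -
    have half: "?c * \<beta>\<^sup>2 * (2 * (real m)\<^sup>2 * M / ?v) = (h - 1) / 2"
      unfolding h_def D_def by simp
    have "?c * \<beta>\<^sup>2 * (2 * (real m)\<^sup>2 * M / ?v * r powr \<kappa>) =
        ?c * \<beta>\<^sup>2 * (2 * (real m)\<^sup>2 * M / ?v) * (1 / h)"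
      unfolding r\<kappa>(1) by (simp only: mult.assoc)
    also have "\<dots> = (h - 1) / (2 * h)" unfolding half by simp
    also have "\<dots> \<le> 1 / 2" using h by (simp add: field_simps)
    finally show ?thesis .
  qed
  have e1: "?c * \<beta>\<^sup>2 * (2 * M / ?v * r powr (\<kappa> - 2)) \<le> H * T"
  proof -
    have "?c * \<beta>\<^sup>2 * (2 * M / ?v * r powr (\<kappa> - 2)) = ?c * \<beta>\<^sup>2 * (2 * M / ?v * r powr \<kappa>) * h powr (2 / \<kappa>)"
      unfolding r\<kappa> by simp
    also have "\<dots> \<le> 1 * h powr (2 / \<kappa>)"
    proof (rule mult_right_mono)
      have "2 * M / ?v * r powr \<kappa> \<le> 2 * (real m)\<^sup>2 * M / ?v * r powr \<kappa>"
        using m morrey_signs v by (intro mult_right_mono divide_right_mono) auto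
      then have "?c * \<beta>\<^sup>2 * (2 * M / ?v * r powr \<kappa>) \<le> ?c * \<beta>\<^sup>2 * (2 * (real m)\<^sup>2 * M / ?v * r powr \<kappa>)"
        using cpos by (intro mult_left_mono) auto
      then show "?c * \<beta>\<^sup>2 * (2 * M / ?v * r powr \<kappa>) \<le> 1" using e2 by linarith
    qed simp
    also have "1 * h powr (2 / \<kappa>) \<le> ((1 + D) * \<beta>\<^sup>2) powr (2 / \<kappa>)"
    proof -
      have "1 \<le> \<beta>\<^sup>2" using \<beta> by simp
      then have "h \<le> (1 + D) * \<beta>\<^sup>2" unfolding h_def by (simp add: algebra_simps)
      then show ?thesis using h morrey_signs by (simp add: powr_mono2)
    qed
    also have "\<dots> = H * T"
    proof -
      have "\<beta>\<^sup>2 = \<beta> powr 2" using \<beta> by (simp add: powr_numeral)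
      then have "(\<beta>\<^sup>2) powr (2 / \<kappa>) = T" by (simp only: powr_powr T_def) simp
      then show ?thesis using D by (simp add: H_def powr_mult)
    qed
    finally show ?thesis .
  qed
  have "E \<le> ?c * Y + (?c * \<beta>\<^sup>2) * B" using E by (simp add: algebra_simps)
  also have "\<dots> \<le> ?c * Y + (?c * \<beta>\<^sup>2) * (2 * M / ?v * r powr (\<kappa> - 2) * N + 2 * (real m)\<^sup>2 * M / ?v * r powr \<kappa> * E)"
    using B cpos by (intro add_left_mono mult_left_mono) auto
  also have "\<dots> = ?c * Y + (?c * \<beta>\<^sup>2 * (2 * M / ?v * r powr (\<kappa> - 2))) * N + (?c * \<beta>\<^sup>2 * (2 * (real m)\<^sup>2 * M / ?v * r powr \<kappa>)) * E"
    by (simp add: algebra_simps)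
  also have "\<dots> \<le> ?c * Y + (H * T) * N + (1 / 2) * E"
    using e1 e2 nn by (intro add_mono mult_right_mono) auto
  \<comment> \<open>Half of \<open>E\<close> is moved to the left. This is legitimate because
    \<open>E\<close> is the integral of a continuous function with compact support, hence
    finite.\<close>
  finally have "E \<le> 2 * ?c * Y + 2 * (H * T * N)" by simp
  moreover have "N \<le> T * N" using T nn by (simp add: mult_le_cancel_right1)
  ultimately have "N + E \<le> 2 * ?c * Y + (2 * H + 1) * (T * N)" by (simp add: algebra_simps)
  also have "\<dots> \<le> (2 * ?c + 1 + 2 * H) * Y + (2 * ?c + 1 + 2 * H) * (T * N)"
    using nn H T cpos by (intro add_mono[OF mult_right_mono mult_right_mono]) auto
  also have "\<dots> = (2 * ?c + 1 + 2 * H) * (LINT x|lborel. (norm (g\<zeta> x))\<^sup>2 * (G x)\<^sup>2 + T * (\<zeta> x * G x)\<^sup>2)"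
    using i by (simp add: Y_def N_def distrib_left)
  finally show "(LINT x|lborel. (\<zeta> x * G x)\<^sup>2) + (LINT x|lborel. (norm (g\<psi> x))\<^sup>2) \<le>
      energy_const DIM('a) \<theta> \<Lambda> C M \<kappa> *
        (LINT x|lborel. (norm (g\<zeta> x))\<^sup>2 * (G x)\<^sup>2 + \<beta> powr (4 / \<kappa>) * (\<zeta> x * G x)\<^sup>2)"
    by (simp add: energy_const_def H_def D_def T_def m_def N_def E_def)
qed

text \<open>A positive upper bound \<open>S\<close> is used in place of the energy itself, since the
  energy may vanish while \<open>gain_of_integrability\<close> needs a positive number.\<close>

lemma reverse_gain:
  assumes \<zeta>: "test_fun U K \<zeta> g\<zeta>" "\<And>x. 0 \<le> \<zeta> x" and \<beta>: "\<beta> \<ge> 1" and G': "power_like \<beta> G'" and S: "S > 0"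
  defines "G \<equiv> \<lambda>x. integral {0..u x} G'"
  assumes "energy_const DIM('a) \<theta> \<Lambda> C M \<kappa> *
        (LINT x|lborel. (norm (g\<zeta> x))\<^sup>2 * (G x)\<^sup>2 + \<beta> powr (4 / \<kappa>) * (\<zeta> x * G x)\<^sup>2) \<le> S"
  shows "(\<integral>\<^sup>+x. ennreal (\<bar>G x * \<zeta> x\<bar> powr (2 * (1 + 1 / DIM('a)))) \<partial>lborel) \<le>
    ennreal (gain_const DIM('a) * S powr (1 + 1 / DIM('a)))"
proof -
  define g\<psi> where "g\<psi> = (\<lambda>x. G x *\<^sub>R g\<zeta> x + (\<zeta> x * G' (u x)) *\<^sub>R gu x)"
  have e: "test_fun U K (\<lambda>x. G x * \<zeta> x) g\<psi>"
    "(LINT x|lborel. (\<zeta> x * G x)\<^sup>2) + (LINT x|lborel. (norm (g\<psi> x))\<^sup>2) \<le>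
      energy_const DIM('a) \<theta> \<Lambda> C M \<kappa> *
        (LINT x|lborel. (norm (g\<zeta> x))\<^sup>2 * (G x)\<^sup>2 + \<beta> powr (4 / \<kappa>) * (\<zeta> x * G x)\<^sup>2)"
    using energy_bound[OF \<zeta> \<beta> G'] by (simp_all add: G_def g\<psi>_def)
  have K: "compact K" "C1_grad_on UNIV (\<lambda>x. G x * \<zeta> x) g\<psi>" "\<And>x. x \<notin> K \<Longrightarrow> G x * \<zeta> x = 0" "\<And>x. x \<notin> K \<Longrightarrow> g\<psi> x = 0"
    using e(1) test_fun_grad_zero[OF e(1)] by (auto simp: test_fun_def)
  have c: "continuous_on K (\<lambda>x. G x * \<zeta> x)" "continuous_on K g\<psi>"
    using K(2) C1_grad_on_continuous[OF K(2)] continuous_on_subset[OF _ subset_UNIV] by (auto simp: C1_grad_on_def)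
  have i: "integrable lborel (\<lambda>x. (G x * \<zeta> x)\<^sup>2)" "integrable lborel (\<lambda>x. (norm (g\<psi> x))\<^sup>2)"
    using K(3,4) by (intro integrable_compact_support[OF K(1)] continuous_intros c; force)+
  have le: "(LINT x|lborel. (G x * \<zeta> x)\<^sup>2) + (LINT x|lborel. (norm (g\<psi> x))\<^sup>2) \<le> S"
    using e(2) assms(7) by (simp add: mult.commute)
  have nn: "0 \<le> (LINT x|lborel. (G x * \<zeta> x)\<^sup>2)" "0 \<le> (LINT x|lborel. (norm (g\<psi> x))\<^sup>2)"
    by (auto intro!: integral_nonneg_AE)
  have le2: "(LINT x|lborel. (G x * \<zeta> x)\<^sup>2) \<le> S" "(LINT x|lborel. (norm (g\<psi> x))\<^sup>2) \<le> S"
    using le nn by linarith+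
  show ?thesis unfolding gain_const_def
  proof (rule gain_of_integrability[OF K(2) S])
    show "(\<integral>\<^sup>+x. ennreal ((G x * \<zeta> x)\<^sup>2) \<partial>lborel) \<le> ennreal S"
      using i(1) le2 by (simp add: nn_integral_eq_integral ennreal_leI)
    show "(\<integral>\<^sup>+x. ennreal ((norm (g\<psi> x))\<^sup>2) \<partial>lborel) \<le> ennreal S"
      using i(2) le2 by (simp add: nn_integral_eq_integral ennreal_leI)
  qed
qed

end

section \<open>Cutoff functions and truncated powers\<close>

text \<open>Fatou's lemma. Eventual domination at each point suffices, without monotonicity in the
  index; this serves both for the removal of the cutoffs at the point and for that of the
  truncation.\<close>

lemma nn_integral_le_eventually:
  fixes f :: "'a \<Rightarrow> ennreal" and F :: "nat \<Rightarrow> 'a \<Rightarrow> ennreal"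
  assumes "\<And>i. F i \<in> borel_measurable M" "\<And>x. eventually (\<lambda>i. f x \<le> F i x) sequentially"
    "eventually (\<lambda>i. integral\<^sup>N M (F i) \<le> c) sequentially"
  shows "integral\<^sup>N M f \<le> c"
proof -
  have "integral\<^sup>N M f \<le> (\<integral>\<^sup>+x. liminf (\<lambda>i. F i x) \<partial>M)"
    by (intro nn_integral_mono Liminf_bounded assms(2))
  also have "\<dots> \<le> liminf (\<lambda>i. integral\<^sup>N M (F i))" by (intro nn_integral_liminf assms(1))
  also have "\<dots> \<le> c" by (intro Liminf_le assms(3)) simp
  finally show ?thesis .
qed

section \<open>Explicit radial cutoffs of class C1\<close>

lemma has_derivative_max_sq: "((\<lambda>t::real. (max 0 t)\<^sup>2) has_real_derivative 2 * max 0 t) (at t)"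
proof -
  consider "t > 0" | "t < 0" | "t = 0" by linarith
  then show ?thesis
  proof cases
    case 1
    have "((\<lambda>t::real. t\<^sup>2) has_real_derivative 2 * t) (at t)" by (auto intro!: derivative_eq_intros)
    then have "((\<lambda>t::real. (max 0 t)\<^sup>2) has_real_derivative 2 * t) (at t)"
      by (rule has_field_derivative_transform_within_open[of _ _ _ "{0<..}"]) (use 1 in auto)
    then show ?thesis using 1 by simp
  next
    case 2
    have "((\<lambda>t::real. 0) has_real_derivative 0) (at t)" by simp
    then have "((\<lambda>t::real. (max 0 t)\<^sup>2) has_real_derivative 0) (at t)"
      by (rule has_field_derivative_transform_within_open[of _ _ _ "{..<0}"]) (use 2 in auto)
    then show ?thesis using 2 by simp
  next
    case 3
    have "((\<lambda>h::real. (max 0 h)\<^sup>2 / h) \<longlongrightarrow> 0) (at 0)"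
    proof (rule Lim_null_comparison)
      show "\<forall>\<^sub>F h::real in at 0. norm ((max 0 h)\<^sup>2 / h) \<le> \<bar>h\<bar>"
        by (intro always_eventually allI) (auto simp: max_def power2_eq_square)
      show "((\<lambda>h::real. \<bar>h\<bar>) \<longlongrightarrow> 0) (at 0)" by (intro tendsto_rabs_zero tendsto_ident_at)
    qed
    then show ?thesis using 3 by (simp add: DERIV_def)
  qed
qed

text \<open>A quadratic spline with knots 0, 1/2 and 1: the derivative is the tent that rises with
  slope 4 to its peak 2 and returns to 0.\<close>

lemma C1_step:
  obtains \<sigma> \<sigma>' :: "real \<Rightarrow> real" where "\<And>t. (\<sigma> has_real_derivative \<sigma>' t) (at t)" "continuous_on UNIV \<sigma>'"
    "\<And>t. 0 \<le> \<sigma> t \<and> \<sigma> t \<le> 1" "\<And>t. t \<le> 0 \<Longrightarrow> \<sigma> t = 0" "\<And>t. t \<ge> 1 \<Longrightarrow> \<sigma> t = 1"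
    "\<And>t. \<bar>\<sigma>' t\<bar> \<le> 2" "\<And>t. t \<ge> 1 \<Longrightarrow> \<sigma>' t = 0"
proof -
  define \<sigma> where "\<sigma> t = 2 * (max 0 t)\<^sup>2 - 4 * (max 0 (t - 1/2))\<^sup>2 + 2 * (max 0 (t - 1))\<^sup>2" for t :: real
  define \<sigma>' where "\<sigma>' t = 4 * max 0 t - 8 * max 0 (t - 1/2) + 4 * max 0 (t - 1)" for t :: real
  have sh: "((\<lambda>t. (max 0 (t - c))\<^sup>2) has_real_derivative 2 * max 0 (t - c)) (at t)" for c t :: real
  proof -
    have "((\<lambda>t. t - c) has_real_derivative 1) (at t)" by (auto intro!: derivative_eq_intros)
    from DERIV_chain2[OF has_derivative_max_sq this] show ?thesis by simp
  qed
  have forms: "\<sigma> t = (if t \<le> 0 then 0 else if t \<le> 1/2 then 2 * t\<^sup>2 else if t \<le> 1 then 1 - 2 * (1 - t)\<^sup>2 else 1)" for t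
    by (auto simp: \<sigma>_def max_def power2_eq_square algebra_simps)
  show ?thesis
  proof
    show "(\<sigma> has_real_derivative \<sigma>' t) (at t)" for t
      using DERIV_add[OF DERIV_diff[OF DERIV_cmult[OF sh[of 0 t], of 2]
            DERIV_cmult[OF sh[of "1/2" t], of 4]] DERIV_cmult[OF sh[of 1 t], of 2]]
      unfolding \<sigma>_def[abs_def] \<sigma>'_def by (simp add: algebra_simps)
    show "continuous_on UNIV \<sigma>'" unfolding \<sigma>'_def by (intro continuous_intros)
    show "0 \<le> \<sigma> t \<and> \<sigma> t \<le> 1" for t
    proof -
      consider "t \<le> 0" | "0 < t" "t \<le> 1/2" | "1/2 < t" "t \<le> 1" | "1 < t" by linarith
      then show ?thesis
      proof cases
        case 2
        then have "t\<^sup>2 \<le> (1/2)\<^sup>2" by (intro power_mono) auto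
        then show ?thesis using 2 by (simp add: forms power2_eq_square)
      next
        case 3
        then have "(1 - t)\<^sup>2 \<le> (1/2)\<^sup>2" by (intro power_mono) auto
        then show ?thesis using 3 by (simp add: forms power2_eq_square)
      qed (auto simp: forms)
    qed
    show "\<sigma> t = 0" if "t \<le> 0" for t using that by (simp add: forms)
    show "\<sigma> t = 1" if "t \<ge> 1" for t using that by (auto simp: forms)
    show "\<bar>\<sigma>' t\<bar> \<le> 2" for t by (auto simp: \<sigma>'_def max_def)
    show "\<sigma>' t = 0" if "t \<ge> 1" for t using that by (auto simp: \<sigma>'_def max_def)
  qed
qed

text \<open>The step is composed with the squared distance, which is differentiable at the centre as
  well. Factoring B^2 - A^2 as (B - A) (B + A) turns the gradient bound into a multiple of 1/(B -
  A).\<close>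

lemma radial_cutoff:
  fixes c :: "'a::euclidean_space"
  assumes "0 < A" "A < B"
  obtains \<eta> g\<eta> where "C1_grad_on UNIV \<eta> g\<eta>" "\<And>x. 0 \<le> \<eta> x \<and> \<eta> x \<le> 1"
    "\<And>x. dist c x \<le> A \<Longrightarrow> \<eta> x = 0" "\<And>x. dist c x \<ge> B \<Longrightarrow> \<eta> x = 1"
    "\<And>x. norm (g\<eta> x) \<le> 4 / (B - A)" "\<And>x. dist c x \<ge> B \<Longrightarrow> g\<eta> x = 0"
proof -
  obtain \<sigma> \<sigma>' :: "real \<Rightarrow> real" where \<sigma>: "\<And>t. (\<sigma> has_real_derivative \<sigma>' t) (at t)" "continuous_on UNIV \<sigma>'"
    "\<And>t. 0 \<le> \<sigma> t \<and> \<sigma> t \<le> 1" "\<And>t. t \<le> 0 \<Longrightarrow> \<sigma> t = 0" "\<And>t. t \<ge> 1 \<Longrightarrow> \<sigma> t = 1"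
    "\<And>t. \<bar>\<sigma>' t\<bar> \<le> 2" "\<And>t. t \<ge> 1 \<Longrightarrow> \<sigma>' t = 0"
    by (rule C1_step) blast
  define d where "d = B\<^sup>2 - A\<^sup>2"
  have d: "d > 0" using assms by (simp add: d_def power_strict_mono)
  define q where "q x = ((x - c) \<bullet> (x - c) - A\<^sup>2) / d" for x
  define \<eta> where "\<eta> x = \<sigma> (q x)" for x
  define g\<eta> where "g\<eta> x = (\<sigma>' (q x) * (2 / d)) *\<^sub>R (x - c)" for x
  have q: "q x \<le> 0" if "dist c x \<le> A" for x
  proof -
    have "(norm (x - c))\<^sup>2 \<le> A\<^sup>2" using that by (intro power_mono) (auto simp: dist_norm norm_minus_commute)
    then show ?thesis using d by (simp add: q_def divide_le_0_iff power2_norm_eq_inner)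
  qed
  have q1: "q x \<ge> 1" if "dist c x \<ge> B" for x
  proof -
    have "B\<^sup>2 \<le> (norm (x - c))\<^sup>2" using that assms by (intro power_mono) (auto simp: dist_norm norm_minus_commute)
    then show ?thesis using d by (simp add: q_def d_def power2_norm_eq_inner)
  qed
  have qc: "continuous_on UNIV q" unfolding q_def using d by (intro continuous_intros) auto
  show ?thesis
  proof
    show "C1_grad_on UNIV \<eta> g\<eta>" unfolding C1_grad_on_def
    proof (intro conjI ballI)
      fix x
      have "GDERIV q x :> (2 / d) *\<^sub>R (x - c)"
        unfolding gderiv_def q_def
        using d by (auto intro!: derivative_eq_intros simp: inner_commute divide_simps)
      from GDERIV_DERIV_compose[OF this \<sigma>(1)]
      show "GDERIV \<eta> x :> g\<eta> x" by (simp add: \<eta>_def[abs_def] g\<eta>_def)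
      show "continuous_on UNIV g\<eta>"
        unfolding g\<eta>_def by (intro continuous_intros continuous_on_compose2[OF \<sigma>(2) qc]) auto
    qed
    show "0 \<le> \<eta> x \<and> \<eta> x \<le> 1" for x using \<sigma>(3) by (simp add: \<eta>_def)
    show "\<eta> x = 0" if "dist c x \<le> A" for x using \<sigma>(4) q[OF that] by (simp add: \<eta>_def)
    show "\<eta> x = 1" if "dist c x \<ge> B" for x using \<sigma>(5) q1[OF that] by (simp add: \<eta>_def)
    show z: "g\<eta> x = 0" if "dist c x \<ge> B" for x using \<sigma>(7) q1[OF that] by (simp add: g\<eta>_def)
    show "norm (g\<eta> x) \<le> 4 / (B - A)" for x
    proof (cases "dist c x \<ge> B")
      case False
      have "norm (g\<eta> x) = \<bar>\<sigma>' (q x)\<bar> * (2 / d) * norm (x - c)" using d by (simp add: g\<eta>_def abs_mult)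
      also have "\<dots> \<le> 2 * (2 / d) * B"
        using \<sigma>(6)[of "q x"] False d by (intro mult_mono) (auto simp: dist_norm norm_minus_commute)
      also have "\<dots> \<le> 2 * (2 / d) * (B + A)" using d assms by (intro mult_left_mono) auto
      also have "d = (B - A) * (B + A)" by (simp add: d_def power2_eq_square algebra_simps)
      also have "2 * (2 / ((B - A) * (B + A))) * (B + A) = 4 / (B - A)" using assms by (simp add: divide_simps)
      finally show ?thesis .
    qed (use z assms in simp)
  qed
qed

text \<open>The derivative of the power is frozen at its value at \<open>l\<close>, so beyond
  \<open>l\<close> the primitive continues along its tangent line. It stays power-like with the same
  \<beta>, which keeps the energy estimate independent of \<open>l\<close>; only the linear growth
  constant \<open>L\<close> depends on \<open>l\<close>.\<close>

lemma truncated_power: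
  assumes \<beta>: "\<beta> \<ge> 1" and l: "(l::real) > 0"
  obtains G' L where "power_like \<beta> G'" "L \<ge> 0" "\<And>t. t \<ge> 0 \<Longrightarrow> integral {0..t} G' \<le> L * t"
    "\<And>t. t \<ge> 0 \<Longrightarrow> integral {0..t} G' \<le> t powr \<beta>"
    "\<And>t. 0 \<le> t \<Longrightarrow> t \<le> l \<Longrightarrow> integral {0..t} G' = t powr \<beta>"
\<comment> \<open>For \<beta> = 1 the general formula contains \<open>t powr 0\<close>, which is 0
  at t = 0 and 1 elsewhere, so it would not be continuous.\<close>
proof (cases "\<beta> = 1")
  case True
  show ?thesis
  proof (rule that[of "\<lambda>_. 1" 1])
    show "power_like \<beta> (\<lambda>_. 1)" using True by (auto simp: power_like_def intro: mono_onI)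
  qed (use True in auto)
next
  case False
  then have \<beta>1: "\<beta> > 1" using \<beta> by simp
  define G' where "G' t = \<beta> * (min t l) powr (\<beta> - 1)" for t
  have c: "continuous_on {0..} G'"
    unfolding G'_def using \<beta>1 l by (intro continuous_intros continuous_on_powr') auto
  have c': "continuous_on {0..} (\<lambda>t. \<beta> * t powr (\<beta> - 1))"
    using \<beta>1 by (intro continuous_intros continuous_on_powr') auto
  have int: "((\<lambda>s. \<beta> * s powr (\<beta> - 1)) has_integral t powr \<beta>) {0..t}" if "t \<ge> 0" for t
  proof -
    have "((\<lambda>s. \<beta> * s powr (\<beta> - 1)) has_integral t powr \<beta> - 0 powr \<beta>) {0..t}"
    proof (rule fundamental_theorem_of_calculus_interior[OF that])
      show "continuous_on {0..t} (\<lambda>s. s powr \<beta>)" using \<beta>1 by (intro continuous_on_powr' continuous_intros) auto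
      fix s assume "s \<in> {0<..<t}"
      then show "((\<lambda>s. s powr \<beta>) has_vector_derivative \<beta> * s powr (\<beta> - 1)) (at s)"
        unfolding has_real_derivative_iff_has_vector_derivative[symmetric]
        by (intro has_real_derivative_powr) auto
    qed
    then show ?thesis by simp
  qed
  have ex: "integral {0..t} G' = t powr \<beta>" if "0 \<le> t" "t \<le> l" for t
  proof -
    have "integral {0..t} G' = integral {0..t} (\<lambda>s. \<beta> * s powr (\<beta> - 1))"
      using that by (intro integral_cong) (auto simp: G'_def min_def)
    also have "\<dots> = t powr \<beta>" using int[OF that(1)] by (rule integral_unique)
    finally show ?thesis .
  qed
  have big: "integral {0..t} G' = l powr \<beta> + (t - l) * (\<beta> * l powr (\<beta> - 1))" if "t \<ge> l" for t
  proof -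
    have "integral {0..t} G' = integral {0..l} G' + integral {l..t} G'"
      using that l c by (intro Henstock_Kurzweil_Integration.integral_combine[symmetric] integrable_continuous_real)
        (auto intro: continuous_on_subset)
    also have "integral {l..t} G' = integral {l..t} (\<lambda>s. \<beta> * l powr (\<beta> - 1))"
      by (intro integral_cong) (auto simp: G'_def min_def)
    finally show ?thesis using ex[of l] l that by simp
  qed
  have G'le: "G' t \<le> \<beta> * t powr (\<beta> - 1)" "G' t \<le> \<beta> * l powr (\<beta> - 1)" "0 \<le> G' t" if "t \<ge> 0" for t
    unfolding G'_def using that l \<beta>1 by (auto intro!: mult_left_mono powr_mono2)
  have ll: "l powr \<beta> = l * l powr (\<beta> - 1)" using l by (simp add: powr_diff)
  show ?thesis
  proof (rule that[of G' "\<beta> * l powr (\<beta> - 1)"])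
    show "\<beta> * l powr (\<beta> - 1) \<ge> 0" using \<beta>1 by simp
    show "integral {0..t} G' = t powr \<beta>" if "0 \<le> t" "t \<le> l" for t using ex that .
    fix t :: real assume t: "t \<ge> 0"
    have ii: "G' integrable_on {0..t}" using c by (intro integrable_continuous_real continuous_on_subset[OF c]) auto
    have "integral {0..t} G' \<le> integral {0..t} (\<lambda>_. \<beta> * l powr (\<beta> - 1))"
      using G'le by (intro integral_le ii) auto
    then show "integral {0..t} G' \<le> \<beta> * l powr (\<beta> - 1) * t" using t by (simp add: mult_ac)
    have "integral {0..t} G' \<le> integral {0..t} (\<lambda>s. \<beta> * s powr (\<beta> - 1))"
      using G'le int[OF t] by (intro integral_le ii) (auto simp: has_integral_iff)
    also have "\<dots> = t powr \<beta>" using int[OF t] by (rule integral_unique)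
    finally show "integral {0..t} G' \<le> t powr \<beta>" .
  next
    have "t * G' t \<le> \<beta> * integral {0..t} G'" if t: "t \<ge> 0" for t
    proof (cases "t \<le> l")
      case True
      have "t * t powr (\<beta> - 1) = t powr \<beta>" using t \<beta>1 by (cases "t = 0") (auto simp: powr_diff)
      moreover have "t * G' t = \<beta> * (t * t powr (\<beta> - 1))" using True by (simp add: G'_def)
      ultimately show ?thesis using ex[OF t True] by simp
    next
      case False
      \<comment> \<open>On the tangent line the inequality reduces to t being at most l + \<beta> (t
        - l), after cancelling the common power of l.\<close>
      have "0 \<le> (\<beta> - 1) * (t - l)" using False \<beta>1 by simp
      then have "t \<le> l + \<beta> * (t - l)" by (simp add: algebra_simps)
      then have "\<beta> * l powr (\<beta> - 1) * t \<le> \<beta> * l powr (\<beta> - 1) * (l + \<beta> * (t - l))"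
        using \<beta>1 by (intro mult_left_mono) auto
      also have "\<dots> = \<beta> * integral {0..t} G'"
      proof -
        have "l \<le> t" using False by simp
        then have "integral {0..t} G' = l powr (\<beta> - 1) * (l + \<beta> * (t - l))"
          using big[of t] by (simp add: ll algebra_simps)
        then show ?thesis by simp
      qed
      also have "\<beta> * l powr (\<beta> - 1) * t = t * G' t" using False by (simp add: G'_def min_def)
      finally show ?thesis .
    qed
    moreover have "mono_on {0..} G'"
      unfolding G'_def using \<beta>1 l by (intro mono_onI mult_left_mono powr_mono2) auto
    ultimately show "power_like \<beta> G'" using c G'le(3) by (auto simp: power_like_def)
  qed
qed

text \<open>The exponent is critical: Young's inequality with exponents \<open>n/2\<close> and \<open>n/(n-2)\<close> turns the
  square of the factor \<open>j + 1\<close> into its \<open>n\<close>-th power, which the volume of the ball compensates exactly.\<close>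

lemma point_capacity_LIMSEQ:
  fixes p :: "'a::euclidean_space" and u :: "'a \<Rightarrow> real"
  assumes dim: "DIM('a) > 2" and u: "\<And>x. 0 \<le> u x" "u \<in> borel_measurable borel"
    and fin: "(\<integral>\<^sup>+x. ennreal (u x powr (2 * real DIM('a) / (real DIM('a) - 2))) \<partial>lborel) < \<infinity>"
  shows "(\<lambda>j. \<integral>\<^sup>+x. ennreal ((real (Suc j) * u x)\<^sup>2) * indicator (ball p (2 / real (Suc j))) x \<partial>lborel) \<longlonglongrightarrow> 0"
proof -
  let ?n = "real DIM('a)" and ?v = "unit_ball_vol DIM('a)"
  define q where "q = 2 * ?n / (?n - 2)"
  define P where "P = ?n / 2"
  define P' where "P' = ?n / (?n - 2)"
  have n: "?n > 2" using dim by simp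
  have P: "P > 1" "P' > 1" "1 / P + 1 / P' = 1" using n by (auto simp: P_def P'_def field_simps)
  have v: "?v > 0" by (rule unit_ball_vol_pos) simp
  note [measurable] = u(2)
  define I where "I j = (\<integral>\<^sup>+x. ennreal (u x powr q) * indicator (ball p (2 / real (Suc j))) x \<partial>lborel)" for j
  have I: "I \<longlonglongrightarrow> 0"
  proof -
    have "I \<longlonglongrightarrow> integral\<^sup>N lborel (\<lambda>_::'a. 0)" unfolding I_def[abs_def]
    proof (rule nn_integral_dominated_convergence[where w="\<lambda>x. ennreal (u x powr q)"])
      show "(\<lambda>x. ennreal (u x powr q) * indicator (ball p (2 / real (Suc j))) x) \<in> borel_measurable lborel" for j
        by (intro borel_measurable_times_ennreal borel_measurable_indicator) auto
      show "(\<integral>\<^sup>+x. ennreal (u x powr q) \<partial>lborel) < \<infinity>" using fin by (simp add: q_def)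
      have "AE x in lborel. x \<noteq> p" by (rule AE_lborel_singleton)
      then show "AE x in lborel. (\<lambda>j. ennreal (u x powr q) * indicator (ball p (2 / real (Suc j))) x) \<longlonglongrightarrow> 0"
      proof eventually_elim
        fix x assume x: "x \<noteq> p"
        have "eventually (\<lambda>j. 2 / real (Suc j) < dist p x) sequentially"
          using x by (intro order_tendstoD[OF LIMSEQ_divide_Suc]) auto
        then have "eventually (\<lambda>j. ennreal (u x powr q) * indicator (ball p (2 / real (Suc j))) x = 0) sequentially"
          by eventually_elim auto
        then show "(\<lambda>j. ennreal (u x powr q) * indicator (ball p (2 / real (Suc j))) x) \<longlonglongrightarrow> 0"
          by (rule tendsto_eventually)
      qed
    qed (auto simp: indicator_def)
    then show ?thesis by simp
  qed
  define F where "F j = (\<integral>\<^sup>+x. ennreal ((real (Suc j) * u x)\<^sup>2) * indicator (ball p (2 / real (Suc j))) x \<partial>lborel)" for j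
  have bound: "F j \<le> ennreal (\<tau> powr P * ?v * 2 ^ DIM('a)) + ennreal (\<tau> powr (- P')) * I j" if \<tau>: "\<tau> > 0" for \<tau> j
  proof -
    define k where "k = real (Suc j)"
    have k: "k > 0" by (simp add: k_def)
    have pt: "(k * u x)\<^sup>2 \<le> \<tau> powr P * k ^ DIM('a) + \<tau> powr (- P') * u x powr q" for x
    proof -
      have "(k * u x)\<^sup>2 = (\<tau> * k\<^sup>2) * ((u x)\<^sup>2 / \<tau>)" using \<tau> by (simp add: power_mult_distrib)
      also have "\<dots> \<le> (\<tau> * k\<^sup>2) powr P / P + ((u x)\<^sup>2 / \<tau>) powr P' / P'"
        using \<tau> by (intro Youngs_inequality P) auto
      also have "\<dots> \<le> (\<tau> * k\<^sup>2) powr P + ((u x)\<^sup>2 / \<tau>) powr P'"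
        using P by (intro add_mono) (auto simp: divide_le_eq mult_le_cancel_left1)
      also have "(\<tau> * k\<^sup>2) powr P = \<tau> powr P * k ^ DIM('a)"
      proof -
        have "(k\<^sup>2) powr P = (k powr 2) powr P" using k by (simp add: powr_numeral)
        also have "\<dots> = k powr ?n" by (simp only: powr_powr P_def) simp
        also have "\<dots> = k ^ DIM('a)" using k by (simp add: powr_realpow)
        finally show ?thesis using \<tau> by (simp add: powr_mult)
      qed
      also have "((u x)\<^sup>2 / \<tau>) powr P' = \<tau> powr (- P') * u x powr q"
      proof -
        have "(u x)\<^sup>2 powr P' = (u x powr 2) powr P'" using u(1)[of x] by (simp add: powr_numeral)
        also have "\<dots> = u x powr q" by (simp only: powr_powr P'_def q_def) simp
        finally show ?thesis using \<tau> by (simp add: powr_divide powr_minus_divide)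
      qed
      finally show ?thesis .
    qed
    have "F j \<le> (\<integral>\<^sup>+x. ennreal (\<tau> powr P * k ^ DIM('a)) * indicator (ball p (2 / k)) x +
        ennreal (\<tau> powr (- P')) * (ennreal (u x powr q) * indicator (ball p (2 / k)) x) \<partial>lborel)"
      unfolding F_def k_def[symmetric]
    proof (intro nn_integral_mono)
      fix x
      have "ennreal ((k * u x)\<^sup>2) \<le> ennreal (\<tau> powr P * k ^ DIM('a) + \<tau> powr (- P') * u x powr q)"
        by (rule ennreal_leI[OF pt])
      also have "\<dots> = ennreal (\<tau> powr P * k ^ DIM('a)) + ennreal (\<tau> powr (- P')) * ennreal (u x powr q)"
        using k by (subst ennreal_plus) (auto simp: ennreal_mult)
      finally show "ennreal ((k * u x)\<^sup>2) * indicator (ball p (2 / k)) x \<le>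
          ennreal (\<tau> powr P * k ^ DIM('a)) * indicator (ball p (2 / k)) x +
          ennreal (\<tau> powr (- P')) * (ennreal (u x powr q) * indicator (ball p (2 / k)) x)"
        by (auto simp: indicator_def)
    qed
    also have "\<dots> = ennreal (\<tau> powr P * k ^ DIM('a)) * emeasure lborel (ball p (2 / k)) +
        ennreal (\<tau> powr (- P')) * I j"
    proof (subst nn_integral_add)
      show "(\<lambda>x. ennreal (\<tau> powr P * k ^ DIM('a)) * indicator (ball p (2 / k)) x) \<in> borel_measurable lborel"
        by (intro borel_measurable_times_ennreal borel_measurable_indicator borel_measurable_const) auto
      have m1: "(\<lambda>x. ennreal (u x powr q)) \<in> borel_measurable lborel" by simp
      have m2: "(indicator (ball p (2 / k)) :: 'a \<Rightarrow> ennreal) \<in> borel_measurable lborel"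
        by (intro borel_measurable_indicator) auto
      have m: "(\<lambda>x. ennreal (u x powr q) * indicator (ball p (2 / k)) x) \<in> borel_measurable lborel"
        by (intro borel_measurable_times_ennreal m1 m2)
      then show "(\<lambda>x. ennreal (\<tau> powr (- P')) * (ennreal (u x powr q) * indicator (ball p (2 / k)) x)) \<in> borel_measurable lborel"
        by (rule borel_measurable_times_ennreal[OF borel_measurable_const])
      show "(\<integral>\<^sup>+x. ennreal (\<tau> powr P * k ^ DIM('a)) * indicator (ball p (2 / k)) x \<partial>lborel) +
         (\<integral>\<^sup>+x. ennreal (\<tau> powr (- P')) * (ennreal (u x powr q) * indicator (ball p (2 / k)) x) \<partial>lborel) =
         ennreal (\<tau> powr P * k ^ DIM('a)) * emeasure lborel (ball p (2 / k)) + ennreal (\<tau> powr (- P')) * I j"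
        using nn_integral_cmult[OF m, of "ennreal (\<tau> powr (- P'))"]
        by (simp add: nn_integral_cmult_indicator I_def k_def)
    qed
    also have "ennreal (\<tau> powr P * k ^ DIM('a)) * emeasure lborel (ball p (2 / k)) = ennreal (\<tau> powr P * ?v * 2 ^ DIM('a))"
    proof -
      have "ennreal (\<tau> powr P * k ^ DIM('a)) * emeasure lborel (ball p (2 / k)) =
          ennreal ((\<tau> powr P * k ^ DIM('a)) * (?v * (2 / k) ^ DIM('a)))"
        using k by (simp add: emeasure_ball ennreal_mult'[symmetric])
      then show ?thesis using k by (simp add: power_divide mult_ac)
    qed
    finally show ?thesis .
  qed
  have "F \<longlonglongrightarrow> 0"
  proof (rule tendsto_0_if_Limsup_eq_0_ennreal)
    have "Limsup sequentially F \<le> 0 + ennreal e" if e: "e > 0" for e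
    proof -
      \<comment> \<open>Chosen such that the volume term of \<open>bound\<close> equals e for every
        j. With \<tau> now fixed, the other term tends to 0 because the balls shrink to a null
        set.\<close>
      define \<tau> where "\<tau> = (e / (?v * 2 ^ DIM('a))) powr (1 / P)"
      have e': "e / (?v * 2 ^ DIM('a)) > 0" using e v by simp
      have \<tau>: "\<tau> > 0" unfolding \<tau>_def using e' by (metis powr_gt_zero less_irrefl)
      have \<tau>P: "\<tau> powr P * ?v * 2 ^ DIM('a) = e"
      proof -
        have "\<tau> powr P = e / (?v * 2 ^ DIM('a))"
          unfolding \<tau>_def powr_powr using P(1) e by simp
        then show ?thesis using v by (simp add: less_imp_neq[OF v, symmetric])
      qed
      have "(\<lambda>j. ennreal e + ennreal (\<tau> powr (- P')) * I j) \<longlonglongrightarrow> ennreal e + ennreal (\<tau> powr (- P')) * 0"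
        by (intro tendsto_add tendsto_const ennreal_tendsto_cmult I) auto
      then have "Limsup sequentially (\<lambda>j. ennreal e + ennreal (\<tau> powr (- P')) * I j) = ennreal e"
        by (intro lim_imp_Limsup) auto
      moreover have "Limsup sequentially F \<le> Limsup sequentially (\<lambda>j. ennreal e + ennreal (\<tau> powr (- P')) * I j)"
        using bound[OF \<tau>] by (intro Limsup_mono always_eventually) (simp add: \<tau>P)
      ultimately show ?thesis by simp
    qed
    then have "Limsup sequentially F \<le> 0" by (rule ennreal_le_epsilon)
    then show "Limsup sequentially F = 0" by (simp only: le_zero_eq)
  qed
  then show ?thesis unfolding F_def[abs_def] .
qed

section \<open>Moser iteration across a point\<close>

lemma C1_grad_on_one_minus:
  "C1_grad_on U f g \<Longrightarrow> C1_grad_on U (\<lambda>x. 1 - f x) (\<lambda>x. - g x)"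
  unfolding C1_grad_on_def using GDERIV_diff[OF GDERIV_const[of "1::real"]]
  by (force intro!: continuous_intros)

text \<open>The first maximum collects the factors common to all steps. The second must dominate the
  growth from step to step: 4 from halving the gap between the radii inside a square, and a power of
  1 + 1/n from the zeroth order coefficient of \<open>energy_bound\<close>. The maxima with numbers
  at least 1 allow exponents to be increased freely.\<close>

definition moser_base :: "real \<Rightarrow> real \<Rightarrow> real \<Rightarrow> real \<Rightarrow> real \<Rightarrow> real \<Rightarrow> real \<Rightarrow> real" where
  "moser_base n \<theta> \<Lambda> C M \<kappa> d =
     max 1 (gain_const n powr (1 / (1 + 1 / n)) * (energy_const n \<theta> \<Lambda> C M \<kappa> * (129 / d\<^sup>2 + 1))) *
     max 4 ((1 + 1 / n) powr (4 / \<kappa>))"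

text \<open>The exponent is the sum of the series with terms (i + 1) / \<xi>^i for \<xi> = 1 +
  1/n.\<close>

definition moser_const :: "real \<Rightarrow> real \<Rightarrow> real \<Rightarrow> real \<Rightarrow> real \<Rightarrow> real \<Rightarrow> real \<Rightarrow> real" where
  "moser_const n \<theta> \<Lambda> C M \<kappa> d = moser_base n \<theta> \<Lambda> C M \<kappa> d powr (1 / (1 - 1 / (1 + 1 / n))\<^sup>2)"

locale punctured_subsolution =
  morrey_subsolution "ball x0 \<rho> - {p}" u gu a b \<theta> \<Lambda> C M \<kappa>
  for x0 p :: "'a::euclidean_space" and \<rho> u gu a b \<theta> \<Lambda> C M \<kappa> +
  assumes dim: "DIM('a) > 2"
    and u_integrable: "(\<integral>\<^sup>+x. ennreal ((indicator (ball x0 \<rho> - {p}) x * u x) powr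
        (2 * real DIM('a) / (real DIM('a) - 2))) \<partial>lborel) < \<infinity>"
begin

abbreviation U where "U \<equiv> ball x0 \<rho> - {p}"

lemma energy_const_ge_1: "energy_const DIM('a) \<theta> \<Lambda> C M \<kappa> \<ge> 1"
  using caccioppoli_const_pos by (simp add: energy_const_def add.commute add_increasing)

lemma gain_const_pos: "gain_const DIM('a) > 0"
proof -
  have "unit_ball_vol DIM('a) > 0" by (rule unit_ball_vol_pos) simp
  then show ?thesis unfolding gain_const_def by (intro divide_pos_pos mult_pos_pos add_pos_pos) auto
qed

lemma borel_indicator_U:
  fixes f :: "'a \<Rightarrow> real"
  shows "continuous_on U f \<Longrightarrow> (\<lambda>x. indicator U x * f x) \<in> borel_measurable borel"
  using borel_measurable_continuous_on_indicator[of U f] open_U by simp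

text \<open>Multiply \<open>\<zeta>\<close> by cutoffs that vanish within 1/(j+1) of
  \<open>p\<close> and are 1 beyond 2/(j+1). The extra energy is at most 32 L^2 times the quantity
  that \<open>point_capacity_LIMSEQ\<close> sends to 0, because \<open>G\<close> is at most
  \<open>L u\<close>. The factor 2 at the gradient of \<open>\<zeta>\<close> comes from squaring the
  sum of the two gradients.\<close>

lemma reverse_gain_punctured:
  assumes \<zeta>: "test_fun (ball x0 \<rho>) K \<zeta> g\<zeta>" "\<And>x. 0 \<le> \<zeta> x \<and> \<zeta> x \<le> 1" and \<beta>: "\<beta> \<ge> 1"
    and G': "power_like \<beta> G'" and L: "L \<ge> 0" "\<And>t. t \<ge> 0 \<Longrightarrow> integral {0..t} G' \<le> L * t" and S: "S > 0"
  defines "G \<equiv> \<lambda>x. integral {0..u x} G'"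
  assumes less: "ennreal (energy_const DIM('a) \<theta> \<Lambda> C M \<kappa>) * (\<integral>\<^sup>+x. ennreal (indicator U x *
      (2 * (norm (g\<zeta> x))\<^sup>2 * (G x)\<^sup>2 + \<beta> powr (4 / \<kappa>) * (\<zeta> x * G x)\<^sup>2)) \<partial>lborel) < ennreal S"
  shows "(\<integral>\<^sup>+x. ennreal (indicator U x * \<bar>G x * \<zeta> x\<bar> powr (2 * (1 + 1 / DIM('a)))) \<partial>lborel) \<le>
    ennreal (gain_const DIM('a) * S powr (1 + 1 / DIM('a)))"
proof -
  let ?E = "energy_const DIM('a) \<theta> \<Lambda> C M \<kappa>"
  define T where "T = \<beta> powr (4 / \<kappa>)"
  have T: "T \<ge> 0" by (simp add: T_def)
  have G'c: "continuous_on {0..} G'" using G' by (simp add: power_like_def)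
  have G_C1: "C1_grad_on U G (\<lambda>x. G' (u x) *\<^sub>R gu x)"
    unfolding G_def by (intro compose_C1 integral_from_0_has_derivative G'c)
  have Gc: "continuous_on U G" using G_C1 by (rule C1_grad_on_continuous)
  have G0: "0 \<le> G x" "G x \<le> L * u x" if "x \<in> U" for x
    using power_like_integral_sq_le(1)[OF G' u_nonneg[OF that]] L(2)[OF u_nonneg[OF that]] by (auto simp: G_def)
  have K: "compact K" "K \<subseteq> ball x0 \<rho>" "C1_grad_on UNIV \<zeta> g\<zeta>" "\<And>x. x \<notin> K \<Longrightarrow> \<zeta> x = 0"
    using \<zeta> by (auto simp: test_fun_def)
  define uu where "uu x = indicator U x * u x" for x
  have uu: "0 \<le> uu x" for x using u_nonneg by (simp add: uu_def indicator_def)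
  have uum: "uu \<in> borel_measurable borel" unfolding uu_def by (rule borel_indicator_U[OF u_cont])
  define F where "F j = (\<integral>\<^sup>+x. ennreal ((real (Suc j) * uu x)\<^sup>2) * indicator (ball p (2 / real (Suc j))) x \<partial>lborel)" for j
  have F: "F \<longlonglongrightarrow> 0" unfolding F_def
    using u_integrable by (intro point_capacity_LIMSEQ dim uu uum) (simp add: uu_def)
  have "\<exists>\<eta> g\<eta>. C1_grad_on UNIV \<eta> g\<eta> \<and> (\<forall>x. 0 \<le> \<eta> x \<and> \<eta> x \<le> 1) \<and>
    (\<forall>x. dist p x \<le> 1 / real (Suc j) \<longrightarrow> \<eta> x = 0) \<and> (\<forall>x. dist p x \<ge> 2 / real (Suc j) \<longrightarrow> \<eta> x = 1) \<and>
    (\<forall>x. norm (g\<eta> x) \<le> 4 * real (Suc j)) \<and> (\<forall>x. dist p x \<ge> 2 / real (Suc j) \<longrightarrow> g\<eta> x = 0)" for j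
  proof -
    have AB: "0 < 1 / real (Suc j)" "1 / real (Suc j) < 2 / real (Suc j)"
      "4 / (2 / real (Suc j) - 1 / real (Suc j)) = 4 * real (Suc j)" by (auto simp: field_simps)
    show ?thesis unfolding AB(3)[symmetric] by (rule radial_cutoff[OF AB(1,2), of p]) blast
  qed
  then obtain \<eta> g\<eta> where \<eta>: "\<And>j. C1_grad_on UNIV (\<eta> j) (g\<eta> j)" "\<And>j x. 0 \<le> \<eta> j x \<and> \<eta> j x \<le> 1"
    "\<And>j x. dist p x \<le> 1 / real (Suc j) \<Longrightarrow> \<eta> j x = 0" "\<And>j x. dist p x \<ge> 2 / real (Suc j) \<Longrightarrow> \<eta> j x = 1"
    "\<And>j x. norm (g\<eta> j x) \<le> 4 * real (Suc j)" "\<And>j x. dist p x \<ge> 2 / real (Suc j) \<Longrightarrow> g\<eta> j x = 0"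
    by metis
  define \<zeta>j where "\<zeta>j j x = \<eta> j x * \<zeta> x" for j x
  define g\<zeta>j where "g\<zeta>j j x = \<eta> j x *\<^sub>R g\<zeta> x + \<zeta> x *\<^sub>R g\<eta> j x" for j x
  define Kj where "Kj j = K - ball p (1 / real (Suc j))" for j
  have Kj: "compact (Kj j)" "Kj j \<subseteq> U" for j
    using K(1,2) by (auto simp: Kj_def intro: compact_diff)
  have tj: "test_fun U (Kj j) (\<zeta>j j) (g\<zeta>j j)" for j
    unfolding test_fun_def
  proof (intro conjI allI impI Kj)
    show "C1_grad_on UNIV (\<zeta>j j) (g\<zeta>j j)"
      unfolding \<zeta>j_def[abs_def] g\<zeta>j_def[abs_def] by (rule C1_grad_on_mult[OF \<eta>(1) K(3)])
    show "\<zeta>j j x = 0" if "x \<notin> Kj j" for x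
      using that K(4)[of x] \<eta>(3)[of x j] by (auto simp: Kj_def \<zeta>j_def)
  qed
  have \<zeta>j0: "0 \<le> \<zeta>j j x" for j x using \<eta>(2)[of j x] \<zeta>(2)[of x] by (simp add: \<zeta>j_def)
  define h where "h j x = (norm (g\<zeta>j j x))\<^sup>2 * (G x)\<^sup>2 + T * (\<zeta>j j x * G x)\<^sup>2" for j x
  define h0 where "h0 x = 2 * (norm (g\<zeta> x))\<^sup>2 * (G x)\<^sup>2 + T * (\<zeta> x * G x)\<^sup>2" for x
  have hz: "h j x = 0" if "x \<notin> Kj j" for j x
    using test_fun_grad_zero[OF tj that] tj[of j] that by (simp add: h_def test_fun_def)
  have h_nn: "0 \<le> h j x" "0 \<le> h0 x" for j x using T by (auto simp: h_def h0_def)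
  \<comment> \<open>Near \<open>p\<close> the cutoff gradient is at most e = 4 (j+1), and 2 e^2 = 32
    (j+1)^2. Off the support of the cutoff function the left-hand side vanishes.\<close>
  have hle: "h j x \<le> indicator U x * h0 x + 32 * L\<^sup>2 * ((real (Suc j) * uu x)\<^sup>2 * indicator (ball p (2 / real (Suc j))) x)" for j x
  proof (cases "x \<in> Kj j")
    case True
    then have x: "x \<in> U" using Kj(2)[of j] by (rule subsetD[rotated])
    define e where "e = (if x \<in> ball p (2 / real (Suc j)) then 4 * real (Suc j) else 0)"
    have e: "norm (g\<eta> j x) \<le> e" "0 \<le> e" using \<eta>(5)[of j x] \<eta>(6)[of j x] by (auto simp: e_def)
    have "norm (g\<zeta>j j x) \<le> norm (\<eta> j x *\<^sub>R g\<zeta> x) + norm (\<zeta> x *\<^sub>R g\<eta> j x)"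
      unfolding g\<zeta>j_def by (rule norm_triangle_ineq)
    also have "\<dots> \<le> norm (g\<zeta> x) + e"
    proof (rule add_mono)
      show "norm (\<eta> j x *\<^sub>R g\<zeta> x) \<le> norm (g\<zeta> x)"
        using \<eta>(2)[of j x] by (simp add: mult_left_le_one_le)
      have "norm (\<zeta> x *\<^sub>R g\<eta> j x) \<le> norm (g\<eta> j x)"
        using \<zeta>(2)[of x] by (simp add: mult_left_le_one_le)
      then show "norm (\<zeta> x *\<^sub>R g\<eta> j x) \<le> e" using e(1) by (rule order_trans)
    qed
    finally have "(norm (g\<zeta>j j x))\<^sup>2 \<le> (norm (g\<zeta> x) + e)\<^sup>2" by (intro power_mono) auto
    also have "\<dots> \<le> 2 * (norm (g\<zeta> x))\<^sup>2 + 2 * e\<^sup>2"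
      using sum_squares_bound[of "norm (g\<zeta> x)" e] by (simp add: power2_sum)
    finally have "(norm (g\<zeta>j j x))\<^sup>2 * (G x)\<^sup>2 \<le> (2 * (norm (g\<zeta> x))\<^sup>2 + 2 * e\<^sup>2) * (G x)\<^sup>2"
      by (intro mult_right_mono) auto
    also have "\<dots> = 2 * (norm (g\<zeta> x))\<^sup>2 * (G x)\<^sup>2 + 2 * e\<^sup>2 * (G x)\<^sup>2" by (simp add: algebra_simps)
    also have "2 * e\<^sup>2 * (G x)\<^sup>2 \<le> 2 * e\<^sup>2 * (L * u x)\<^sup>2"
      using G0[OF x] by (intro mult_left_mono power_mono) auto
    also have "2 * e\<^sup>2 * (L * u x)\<^sup>2 = 32 * L\<^sup>2 * ((real (Suc j) * uu x)\<^sup>2 * indicator (ball p (2 / real (Suc j))) x)"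
      using x by (simp add: e_def uu_def power_mult_distrib del: of_nat_Suc)
    finally have 1: "(norm (g\<zeta>j j x))\<^sup>2 * (G x)\<^sup>2 \<le> 2 * (norm (g\<zeta> x))\<^sup>2 * (G x)\<^sup>2 +
        32 * L\<^sup>2 * ((real (Suc j) * uu x)\<^sup>2 * indicator (ball p (2 / real (Suc j))) x)" by simp
    have "\<zeta>j j x * G x \<le> \<zeta> x * G x"
      using \<eta>(2)[of j x] \<zeta>(2)[of x] G0[OF x] by (intro mult_right_mono) (auto simp: \<zeta>j_def mult_left_le_one_le)
    then have "(\<zeta>j j x * G x)\<^sup>2 \<le> (\<zeta> x * G x)\<^sup>2"
      using \<zeta>j0[of j x] G0[OF x] by (intro power_mono) auto
    then have "T * (\<zeta>j j x * G x)\<^sup>2 \<le> T * (\<zeta> x * G x)\<^sup>2" using T by (intro mult_left_mono) auto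
    then show ?thesis using 1 x by (simp add: h_def h0_def)
  next
    case False
    then show ?thesis using hz[OF False] h_nn(2)[of x] by (simp add: indicator_def)
  qed
  have h0m: "(\<lambda>x. indicator U x * h0 x) \<in> borel_measurable borel"
  proof (rule borel_indicator_U)
    have "continuous_on U \<zeta>" "continuous_on U g\<zeta>"
      using K(3) C1_grad_on_continuous[OF K(3)] continuous_on_subset[OF _ subset_UNIV] by (auto simp: C1_grad_on_def)
    then show "continuous_on U h0" unfolding h0_def by (intro continuous_intros Gc)
  qed
  define I0 where "I0 = (\<integral>\<^sup>+x. ennreal (indicator U x * h0 x) \<partial>lborel)"
  have hI: "(\<integral>\<^sup>+x. ennreal (h j x) \<partial>lborel) \<le> I0 + ennreal (32 * L\<^sup>2) * F j" for j
  proof -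
    have m: "(\<lambda>x. ennreal ((real (Suc j) * uu x)\<^sup>2) * indicator (ball p (2 / real (Suc j))) x) \<in> borel_measurable lborel"
      using uum by (intro borel_measurable_times_ennreal borel_measurable_indicator) auto
    have "(\<integral>\<^sup>+x. ennreal (h j x) \<partial>lborel) \<le> (\<integral>\<^sup>+x. ennreal (indicator U x * h0 x) +
        ennreal (32 * L\<^sup>2) * (ennreal ((real (Suc j) * uu x)\<^sup>2) * indicator (ball p (2 / real (Suc j))) x) \<partial>lborel)"
    proof (intro nn_integral_mono)
      fix x
      have "ennreal (h j x) \<le> ennreal (indicator U x * h0 x +
          32 * L\<^sup>2 * ((real (Suc j) * uu x)\<^sup>2 * indicator (ball p (2 / real (Suc j))) x))"
        by (rule ennreal_leI[OF hle])
      also have "\<dots> = ennreal (indicator U x * h0 x) +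
          ennreal (32 * L\<^sup>2) * (ennreal ((real (Suc j) * uu x)\<^sup>2) * indicator (ball p (2 / real (Suc j))) x)"
        using h_nn(2)[of x] by (subst ennreal_plus) (auto simp: ennreal_mult indicator_def)
      finally show "ennreal (h j x) \<le> ennreal (indicator U x * h0 x) +
        ennreal (32 * L\<^sup>2) * (ennreal ((real (Suc j) * uu x)\<^sup>2) * indicator (ball p (2 / real (Suc j))) x)" .
    qed
    also have "\<dots> = I0 + ennreal (32 * L\<^sup>2) * F j"
      unfolding I0_def F_def nn_integral_cmult[OF m, symmetric]
      using h0m by (intro nn_integral_add borel_measurable_times_ennreal[OF borel_measurable_const m]) auto
    finally show ?thesis .
  qed
  have hint: "ennreal (LINT x|lborel. h j x) = (\<integral>\<^sup>+x. ennreal (h j x) \<partial>lborel)" for j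
  proof -
    have tj': "C1_grad_on UNIV (\<zeta>j j) (g\<zeta>j j)" using tj[of j] by (simp add: test_fun_def)
    have "continuous_on (Kj j) (\<zeta>j j)" "continuous_on (Kj j) (g\<zeta>j j)" "continuous_on (Kj j) G"
      using tj' C1_grad_on_continuous[OF tj'] continuous_on_subset[OF _ subset_UNIV]
        continuous_on_subset[OF Gc Kj(2)] by (auto simp: C1_grad_on_def)
    then have "continuous_on (Kj j) (h j)" unfolding h_def by (intro continuous_intros)
    then have "integrable lborel (h j)" using hz by (intro integrable_compact_support[OF Kj(1)])
    then show ?thesis using h_nn by (simp add: nn_integral_eq_integral)
  qed
  have "(\<lambda>j. ennreal ?E * (I0 + ennreal (32 * L\<^sup>2) * F j)) \<longlonglongrightarrow> ennreal ?E * (I0 + ennreal (32 * L\<^sup>2) * 0)"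
    by (intro ennreal_tendsto_cmult tendsto_add tendsto_const F) auto
  then have "(\<lambda>j. ennreal ?E * (I0 + ennreal (32 * L\<^sup>2) * F j)) \<longlonglongrightarrow> ennreal ?E * I0" by simp
  \<comment> \<open>The strict inequality in the assumption leaves room for the vanishing capacity
    term, so the same \<open>S\<close> works for all large j.\<close>
  then have "eventually (\<lambda>j. ennreal ?E * (I0 + ennreal (32 * L\<^sup>2) * F j) < ennreal S) sequentially"
    using less by (intro order_tendstoD) (auto simp: I0_def h0_def T_def)
  then have ev: "eventually (\<lambda>j. (\<integral>\<^sup>+x. ennreal (\<bar>G x * \<zeta>j j x\<bar> powr (2 * (1 + 1 / DIM('a)))) \<partial>lborel) \<le>
      ennreal (gain_const DIM('a) * S powr (1 + 1 / DIM('a)))) sequentially"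
  proof eventually_elim
    case (elim j)
    have nn: "0 \<le> (LINT x|lborel. h j x)" using h_nn by (intro integral_nonneg_AE) auto
    have "ennreal (?E * (LINT x|lborel. h j x)) = ennreal ?E * (\<integral>\<^sup>+x. ennreal (h j x) \<partial>lborel)"
      using nn energy_const_ge_1 by (simp add: ennreal_mult hint[symmetric])
    also have "\<dots> \<le> ennreal ?E * (I0 + ennreal (32 * L\<^sup>2) * F j)" by (intro mult_left_mono hI) auto
    also have "\<dots> \<le> ennreal S" using elim by simp
    finally have "?E * (LINT x|lborel. h j x) \<le> S" using S by (simp add: ennreal_le_iff)
    then show ?case
      using reverse_gain[OF tj \<zeta>j0 \<beta> G' S] by (simp add: h_def T_def G_def)
  qed
  show ?thesis
  proof (rule nn_integral_le_eventually[OF _ _ ev])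
    show "(\<lambda>x. ennreal (\<bar>G x * \<zeta>j j x\<bar> powr (2 * (1 + 1 / DIM('a))))) \<in> borel_measurable lborel" for j
    proof -
      have "test_fun U (Kj j) (\<lambda>x. G x * \<zeta>j j x) (\<lambda>x. G x *\<^sub>R g\<zeta>j j x + \<zeta>j j x *\<^sub>R (G' (u x) *\<^sub>R gu x))"
        by (rule test_fun_mult[OF open_U G_C1 tj])
      then have "continuous_on UNIV (\<lambda>x. G x * \<zeta>j j x)"
        using C1_grad_on_continuous by (auto simp: test_fun_def)
      then have "(\<lambda>x. G x * \<zeta>j j x) \<in> borel_measurable borel" by (rule borel_measurable_continuous_onI)
      then show ?thesis by simp
    qed
    fix x
    show "eventually (\<lambda>j. ennreal (indicator U x * \<bar>G x * \<zeta> x\<bar> powr (2 * (1 + 1 / DIM('a)))) \<le>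
        ennreal (\<bar>G x * \<zeta>j j x\<bar> powr (2 * (1 + 1 / DIM('a))))) sequentially"
    proof (cases "x \<in> U")
      case True
      have "eventually (\<lambda>j. 2 / real (Suc j) < dist p x) sequentially"
        using True by (intro order_tendstoD[OF LIMSEQ_divide_Suc]) auto
      then show ?thesis
      proof eventually_elim
        case (elim j)
        then have "\<eta> j x = 1" using \<eta>(4)[of j x] by simp
        then show ?case using True by (simp add: \<zeta>j_def)
      qed
    qed simp
  qed
qed

text \<open>The s-th power of the L^s norm of \<open>u\<close> over a punctured ball. It is an
  extended number because finiteness for higher exponents is only obtained along the
  iteration.\<close>

definition \<Phi> :: "real \<Rightarrow> real \<Rightarrow> ennreal" where
  "\<Phi> s r = (\<integral>\<^sup>+x. ennreal (indicator (U \<inter> ball x0 r) x * u x powr s) \<partial>lborel)"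

text \<open>For each truncation level the bound of \<open>reverse_gain_punctured\<close> depends on
  neither the level nor its linear growth constant. Fatou's lemma therefore lets the level tend to
  infinity, where the truncated power becomes the true one.\<close>

lemma moser_step:
  assumes r: "0 < r'" "r' < r" "r \<le> \<rho>" and \<beta>: "\<beta> \<ge> 1" and S0: "S0 > 0" "\<Phi> (2 * \<beta>) r \<le> ennreal S0"
  shows "\<Phi> (2 * \<beta> * (1 + 1 / DIM('a))) r' \<le> ennreal (gain_const DIM('a) *
    (energy_const DIM('a) \<theta> \<Lambda> C M \<kappa> * (129 / (r - r')\<^sup>2 + \<beta> powr (4 / \<kappa>)) * S0) powr (1 + 1 / DIM('a)))"
proof -
  let ?E = "energy_const DIM('a) \<theta> \<Lambda> C M \<kappa>"
  define T where "T = \<beta> powr (4 / \<kappa>)"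
  have T: "T \<ge> 0" by (simp add: T_def)
  \<comment> \<open>With the midpoint the cutoff has compact support inside the ball of radius
    \<open>r\<close>, at the cost of the gradient bound 8 / (r - r'), whose doubled square yields
    the 128 below.\<close>
  define B where "B = (r + r') / 2"
  have B: "r' < B" "B < r" "4 / (B - r') = 8 / (r - r')" using r by (auto simp: B_def field_simps)
  obtain \<eta> g\<eta> where \<eta>: "C1_grad_on UNIV \<eta> g\<eta>" "\<And>x. 0 \<le> \<eta> x \<and> \<eta> x \<le> 1"
    "\<And>x. dist x0 x \<le> r' \<Longrightarrow> \<eta> x = 0" "\<And>x. dist x0 x \<ge> B \<Longrightarrow> \<eta> x = 1"
    "\<And>x. norm (g\<eta> x) \<le> 4 / (B - r')" "\<And>x. dist x0 x \<ge> B \<Longrightarrow> g\<eta> x = 0"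
    by (rule radial_cutoff[OF r(1) B(1), of x0], rule that)
  define \<zeta> where "\<zeta> x = 1 - \<eta> x" for x
  have \<zeta>: "test_fun (ball x0 \<rho>) (cball x0 B) \<zeta> (\<lambda>x. - g\<eta> x)"
    unfolding test_fun_def \<zeta>_def using C1_grad_on_one_minus[OF \<eta>(1)] \<eta>(4) B(2) r(3) by auto
  have \<zeta>1: "0 \<le> \<zeta> x \<and> \<zeta> x \<le> 1" for x using \<eta>(2)[of x] by (simp add: \<zeta>_def)
  have "\<exists>G' L. power_like \<beta> G' \<and> L \<ge> 0 \<and> (\<forall>t\<ge>0. integral {0..t} G' \<le> L * t) \<and>
    (\<forall>t\<ge>0. integral {0..t} G' \<le> t powr \<beta>) \<and>
    (\<forall>t. 0 \<le> t \<and> t \<le> real (Suc j) \<longrightarrow> integral {0..t} G' = t powr \<beta>)" for j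
  proof -
    have "real (Suc j) > 0" by simp
    then show ?thesis by (rule truncated_power[OF \<beta>]) blast
  qed
  then obtain G' L where G': "\<And>j. power_like \<beta> (G' j)" "\<And>j. L j \<ge> 0"
    "\<And>j t. t \<ge> 0 \<Longrightarrow> integral {0..t} (G' j) \<le> L j * t"
    "\<And>j t. t \<ge> 0 \<Longrightarrow> integral {0..t} (G' j) \<le> t powr \<beta>"
    "\<And>j t. 0 \<le> t \<Longrightarrow> t \<le> real (Suc j) \<Longrightarrow> integral {0..t} (G' j) = t powr \<beta>"
    by metis
  define G where "G j x = integral {0..u x} (G' j)" for j x
  have Gc: "continuous_on U (G j)" for j
  proof -
    have "C1_grad_on U (G j) (\<lambda>x. G' j (u x) *\<^sub>R gu x)"
      unfolding G_def using G'(1)[of j]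
      by (intro compose_C1 integral_from_0_has_derivative) (auto simp: power_like_def)
    then show ?thesis by (rule C1_grad_on_continuous)
  qed
  \<comment> \<open>The numbers 128 here and 129 in \<open>S\<close> differ only to produce the
    strict inequality that \<open>reverse_gain_punctured\<close> requires.\<close>
  define c where "c = 128 / (r - r')\<^sup>2 + T"
  define S where "S = ?E * (129 / (r - r')\<^sup>2 + T) * S0"
  have c: "c \<ge> 0" using T by (simp add: c_def)
  have cS: "?E * (c * S0) < S"
  proof -
    have "c < 129 / (r - r')\<^sup>2 + T" using r by (simp add: c_def divide_strict_right_mono)
    then have "?E * c * S0 < ?E * (129 / (r - r')\<^sup>2 + T) * S0"
      using S0 energy_const_ge_1 by (intro mult_strict_right_mono mult_strict_left_mono) auto
    then show ?thesis by (simp add: S_def mult.assoc)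
  qed
  have "0 \<le> ?E * (c * S0)" using c S0 energy_const_ge_1 by (intro mult_nonneg_nonneg) auto
  then have S: "S > 0" using cS by (rule le_less_trans)
  have step: "(\<integral>\<^sup>+x. ennreal (indicator U x * \<bar>G j x * \<zeta> x\<bar> powr (2 * (1 + 1 / DIM('a)))) \<partial>lborel) \<le>
    ennreal (gain_const DIM('a) * S powr (1 + 1 / DIM('a)))" for j
    unfolding G_def
  proof (rule reverse_gain_punctured[OF \<zeta> \<zeta>1 \<beta> G'(1,2,3) S])
    have "(\<integral>\<^sup>+x. ennreal (indicator U x * (2 * (norm (- g\<eta> x))\<^sup>2 * (integral {0..u x} (G' j))\<^sup>2 +
        \<beta> powr (4 / \<kappa>) * (\<zeta> x * integral {0..u x} (G' j))\<^sup>2)) \<partial>lborel) \<le>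
      (\<integral>\<^sup>+x. ennreal c * ennreal (indicator (U \<inter> ball x0 r) x * u x powr (2 * \<beta>)) \<partial>lborel)"
    proof (intro nn_integral_mono)
      fix x
      have "indicator U x * (2 * (norm (- g\<eta> x))\<^sup>2 * (integral {0..u x} (G' j))\<^sup>2 +
        \<beta> powr (4 / \<kappa>) * (\<zeta> x * integral {0..u x} (G' j))\<^sup>2) \<le> c * (indicator (U \<inter> ball x0 r) x * u x powr (2 * \<beta>))"
      proof (cases "x \<in> U \<inter> ball x0 r")
        case True
        then have x: "x \<in> U" by auto
        note u0 = u_nonneg[OF x]
        have g0: "0 \<le> integral {0..u x} (G' j)" by (rule power_like_integral_sq_le(1)[OF G'(1) u0])
        have "(integral {0..u x} (G' j))\<^sup>2 \<le> (u x powr \<beta>)\<^sup>2"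
          using G'(4)[OF u0] g0 by (intro power_mono) auto
        also have "\<dots> = u x powr (2 * \<beta>)" by (simp add: power2_eq_square powr_add[symmetric])
        finally have g: "(integral {0..u x} (G' j))\<^sup>2 \<le> u x powr (2 * \<beta>)" .
        have n: "2 * (norm (- g\<eta> x))\<^sup>2 \<le> 128 / (r - r')\<^sup>2"
        proof -
          have "(norm (g\<eta> x))\<^sup>2 \<le> (8 / (r - r'))\<^sup>2" using \<eta>(5)[of x] unfolding B(3) by (intro power_mono) auto
          then show ?thesis by (simp add: power_divide)
        qed
        have z: "(\<zeta> x * integral {0..u x} (G' j))\<^sup>2 \<le> u x powr (2 * \<beta>)"
        proof -
          have "(\<zeta> x)\<^sup>2 \<le> 1" using \<zeta>1[of x] by (simp add: power_le_one)
          then have "(\<zeta> x)\<^sup>2 * (integral {0..u x} (G' j))\<^sup>2 \<le> 1 * (integral {0..u x} (G' j))\<^sup>2"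
            by (intro mult_right_mono) auto
          then show ?thesis using g by (simp add: power_mult_distrib)
        qed
        have "2 * (norm (- g\<eta> x))\<^sup>2 * (integral {0..u x} (G' j))\<^sup>2 + T * (\<zeta> x * integral {0..u x} (G' j))\<^sup>2 \<le>
            128 / (r - r')\<^sup>2 * u x powr (2 * \<beta>) + T * u x powr (2 * \<beta>)"
          using g n z T by (intro add_mono mult_mono) auto
        then show ?thesis using True by (simp add: T_def c_def algebra_simps)
      next
        case False
        then have "x \<notin> U \<or> (\<eta> x = 1 \<and> g\<eta> x = 0)" using \<eta>(4,6)[of x] B by auto
        then show ?thesis using False by (auto simp: \<zeta>_def)
      qed
      then show "ennreal (indicator U x * (2 * (norm (- g\<eta> x))\<^sup>2 * (integral {0..u x} (G' j))\<^sup>2 +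
        \<beta> powr (4 / \<kappa>) * (\<zeta> x * integral {0..u x} (G' j))\<^sup>2)) \<le>
        ennreal c * ennreal (indicator (U \<inter> ball x0 r) x * u x powr (2 * \<beta>))"
        using c by (simp add: ennreal_mult'[symmetric] ennreal_leI)
    qed
    also have "\<dots> = ennreal c * \<Phi> (2 * \<beta>) r"
      unfolding \<Phi>_def
    proof (rule nn_integral_cmult)
      define w where "w x = indicator U x * u x" for x
      have [measurable]: "w \<in> borel_measurable borel" unfolding w_def by (rule borel_indicator_U[OF u_cont])
      have "(\<lambda>x. indicator (ball x0 r) x * w x powr (2 * \<beta>)) \<in> borel_measurable borel"
        by (intro borel_measurable_times borel_measurable_indicator) simp_all
      also have "(\<lambda>x. indicator (ball x0 r) x * w x powr (2 * \<beta>)) =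
          (\<lambda>x. indicator (U \<inter> ball x0 r) x * u x powr (2 * \<beta>))"
        by (auto simp: w_def indicator_def)
      finally show "(\<lambda>x. ennreal (indicator (U \<inter> ball x0 r) x * u x powr (2 * \<beta>))) \<in> borel_measurable lborel" by simp
    qed
    also have "\<dots> \<le> ennreal c * ennreal S0" by (intro mult_left_mono S0) auto
    finally have "ennreal ?E * (\<integral>\<^sup>+x. ennreal (indicator U x * (2 * (norm (- g\<eta> x))\<^sup>2 * (integral {0..u x} (G' j))\<^sup>2 +
        \<beta> powr (4 / \<kappa>) * (\<zeta> x * integral {0..u x} (G' j))\<^sup>2)) \<partial>lborel) \<le> ennreal ?E * (ennreal c * ennreal S0)"
      by (intro mult_left_mono) auto
    also have "\<dots> = ennreal (?E * (c * S0))"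
      using c S0 energy_const_ge_1 by (simp add: ennreal_mult'[symmetric])
    also have "\<dots> < ennreal S" using cS S by (intro ennreal_lessI) auto
    finally show "ennreal ?E * (\<integral>\<^sup>+x. ennreal (indicator U x * (2 * (norm (- g\<eta> x))\<^sup>2 * (integral {0..u x} (G' j))\<^sup>2 +
        \<beta> powr (4 / \<kappa>) * (\<zeta> x * integral {0..u x} (G' j))\<^sup>2)) \<partial>lborel) < ennreal S" .
  qed
  have "\<Phi> (2 * \<beta> * (1 + 1 / DIM('a))) r' \<le> ennreal (gain_const DIM('a) * S powr (1 + 1 / DIM('a)))"
    unfolding \<Phi>_def
  proof (rule nn_integral_le_eventually[OF _ _ always_eventually[OF allI[OF step]]])
    show "(\<lambda>x. ennreal (indicator U x * \<bar>G j x * \<zeta> x\<bar> powr (2 * (1 + 1 / DIM('a))))) \<in> borel_measurable lborel" for j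
    proof -
      have "continuous_on U \<zeta>"
        using \<eta>(1) C1_grad_on_continuous[OF \<eta>(1)] continuous_on_subset[OF _ subset_UNIV]
        by (auto simp: \<zeta>_def[abs_def] intro!: continuous_intros)
      then have "(\<lambda>x. indicator U x * (G j x * \<zeta> x)) \<in> borel_measurable borel"
        using Gc by (intro borel_indicator_U continuous_intros)
      then have "(\<lambda>x. \<bar>indicator U x * (G j x * \<zeta> x)\<bar> powr (2 * (1 + 1 / DIM('a)))) \<in> borel_measurable borel" by simp
      also have "(\<lambda>x. \<bar>indicator U x * (G j x * \<zeta> x)\<bar> powr (2 * (1 + 1 / DIM('a)))) = (\<lambda>x. indicator U x * \<bar>G j x * \<zeta> x\<bar> powr (2 * (1 + 1 / DIM('a))))"
        by (auto simp: indicator_def)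
      finally show ?thesis by simp
    qed
    fix x
    show "eventually (\<lambda>j. ennreal (indicator (U \<inter> ball x0 r') x * u x powr (2 * \<beta> * (1 + 1 / DIM('a)))) \<le>
        ennreal (indicator U x * \<bar>G j x * \<zeta> x\<bar> powr (2 * (1 + 1 / DIM('a))))) sequentially"
    proof (cases "x \<in> U \<inter> ball x0 r'")
      case True
      then have x: "x \<in> U" "\<zeta> x = 1" using \<eta>(3)[of x] by (auto simp: \<zeta>_def)
      obtain N where N: "u x \<le> real N" using real_arch_simple by blast
      show ?thesis
      proof (rule eventually_sequentiallyI[of N])
        fix j assume "N \<le> j"
        then have "u x \<le> real (Suc j)" using N by linarith
        then have "G j x = u x powr \<beta>" using G'(5)[OF u_nonneg[OF x(1)]] by (simp add: G_def)
        then have "\<bar>G j x * \<zeta> x\<bar> powr (2 * (1 + 1 / DIM('a))) = u x powr (\<beta> * (2 * (1 + 1 / DIM('a))))"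
          using x by (simp only: powr_powr mult_1_right) (simp add: powr_powr)
        also have "\<beta> * (2 * (1 + 1 / DIM('a))) = 2 * \<beta> * (1 + 1 / DIM('a))" by simp
        finally show "ennreal (indicator (U \<inter> ball x0 r') x * u x powr (2 * \<beta> * (1 + 1 / DIM('a)))) \<le>
          ennreal (indicator U x * \<bar>G j x * \<zeta> x\<bar> powr (2 * (1 + 1 / DIM('a))))" using True by simp
      qed
    qed simp
  qed
  then show ?thesis by (simp add: S_def T_def)
qed

text \<open>Here \<rho> is the outer radius, and the radii decrease to \<open>R\<close>. Step i
  multiplies the current bound by at most \<open>B\<close> to the power i + 1 before raising it to
  \<xi>. Measured relative to the accumulated exponent \<xi>^i this costs (i + 1) / \<xi>^i in the
  exponent of \<open>B\<close>, a summable amount.\<close>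

lemma moser_iteration:
  assumes R: "0 < R" "R < \<rho>" and S0: "S0 > 0" "\<Phi> 2 \<rho> \<le> ennreal S0"
  defines "\<xi> \<equiv> 1 + 1 / real DIM('a)"
  defines "B \<equiv> moser_base DIM('a) \<theta> \<Lambda> C M \<kappa> (\<rho> - R)"
  shows "\<Phi> (2 * \<xi> ^ k) (R + (\<rho> - R) / 2 ^ k) \<le>
    ennreal ((B powr (\<Sum>i<k. real (Suc i) * (1 / \<xi>) ^ i) * S0) powr (\<xi> ^ k))"
proof (induction k)
  case 0
  have "B > 0" unfolding B_def moser_base_def by (intro mult_pos_pos) auto
  then show ?case using S0 by simp
next
  case (Suc k)
  let ?E = "energy_const DIM('a) \<theta> \<Lambda> C M \<kappa>" and ?g = "gain_const DIM('a)"
  define d where "d = \<rho> - R"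
  \<comment> \<open>A single geometric rate for two effects: the factor 4 per step from the halved
    gap of radii and the factor \<open>\<xi> powr (4 / \<kappa>)\<close> from the growing exponent
    \<beta> = \<xi>^k.\<close>
  define b1 where "b1 = max 4 (\<xi> powr (4 / \<kappa>))"
  define c6 where "c6 = max 1 (?g powr (1 / \<xi>) * (?E * (129 / d\<^sup>2 + 1)))"
  define s where "s = (\<Sum>i<k. real (Suc i) * (1 / \<xi>) ^ i)"
  define Sk where "Sk = (B powr s * S0) powr (\<xi> ^ k)"
  have B: "B = c6 * b1" by (simp add: B_def moser_base_def c6_def b1_def \<xi>_def d_def)
  have d: "d > 0" using R by (simp add: d_def)
  have b1: "b1 \<ge> 1" "b1 \<ge> 4" "b1 \<ge> \<xi> powr (4 / \<kappa>)" by (auto simp: b1_def)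
  have c6: "c6 \<ge> 1" "?g powr (1 / \<xi>) * (?E * (129 / d\<^sup>2 + 1)) \<le> c6" by (auto simp: c6_def)
  have B0: "B > 0" using b1 c6 by (simp add: B)
  have \<xi>: "\<xi> > 1" by (simp add: \<xi>_def)
  have Sk: "Sk > 0" using B0 S0 by (simp add: Sk_def)
  have \<xi>k: "\<xi> ^ k \<ge> 1" using \<xi> by (simp add: one_le_power)
  have gap: "(R + d / 2 ^ k) - (R + d / 2 ^ Suc k) = d / 2 ^ Suc k" by (simp add: field_simps)
  have "\<Phi> (2 * \<xi> ^ k * (1 + 1 / DIM('a))) (R + d / 2 ^ Suc k) \<le> ennreal (?g *
    (?E * (129 / ((R + d / 2 ^ k) - (R + d / 2 ^ Suc k))\<^sup>2 + (\<xi> ^ k) powr (4 / \<kappa>)) * Sk) powr (1 + 1 / DIM('a)))"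
  proof (rule moser_step)
    show "0 < R + d / 2 ^ Suc k" using R d by (intro add_pos_pos divide_pos_pos) auto
    have "0 < d / 2 ^ Suc k" using d by simp
    then show "R + d / 2 ^ Suc k < R + d / 2 ^ k" using gap by linarith
    have "d / 2 ^ k \<le> d" using d by (simp add: divide_le_eq mult_le_cancel_left1)
    then show "R + d / 2 ^ k \<le> \<rho>" by (simp add: d_def)
    show "\<Phi> (2 * \<xi> ^ k) (R + d / 2 ^ k) \<le> ennreal Sk" using Suc.IH by (simp add: Sk_def s_def d_def)
  qed (use Sk \<xi>k in auto)
  then have step: "\<Phi> (2 * \<xi> ^ k * \<xi>) (R + d / 2 ^ Suc k) \<le> ennreal (?g *
    (?E * (129 / (d / 2 ^ Suc k)\<^sup>2 + (\<xi> ^ k) powr (4 / \<kappa>)) * Sk) powr \<xi>)"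
    unfolding gap \<xi>_def .
  have "?E * (129 / (d / 2 ^ Suc k)\<^sup>2 + (\<xi> ^ k) powr (4 / \<kappa>)) \<le> ?E * ((129 / d\<^sup>2 + 1) * b1 ^ Suc k)"
  proof (rule mult_left_mono)
    have "129 / (d / 2 ^ Suc k)\<^sup>2 = 129 / d\<^sup>2 * 4 ^ Suc k"
    proof -
      have "(2 ^ Suc k)\<^sup>2 = (4::real) ^ Suc k" by (simp only: power2_eq_square power_mult_distrib[symmetric]) simp
      then show ?thesis by (simp only: power_divide divide_divide_eq_right times_divide_eq_left)
    qed
    also have "\<dots> \<le> 129 / d\<^sup>2 * b1 ^ Suc k" using b1(2) by (intro mult_left_mono power_mono) auto
    finally have 1: "129 / (d / 2 ^ Suc k)\<^sup>2 \<le> 129 / d\<^sup>2 * b1 ^ Suc k" .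
    have "(\<xi> ^ k) powr (4 / \<kappa>) = (\<xi> powr (4 / \<kappa>)) ^ k"
      using \<xi> by (simp add: powr_realpow[symmetric] powr_powr mult.commute)
    also have "\<dots> \<le> b1 ^ k" using b1(3) by (intro power_mono) auto
    also have "\<dots> \<le> b1 ^ Suc k" using b1(1) by (intro power_increasing) auto
    finally show "129 / (d / 2 ^ Suc k)\<^sup>2 + (\<xi> ^ k) powr (4 / \<kappa>) \<le> (129 / d\<^sup>2 + 1) * b1 ^ Suc k"
      using 1 by (simp add: algebra_simps)
  qed (use energy_const_ge_1 in simp)
  then have "?E * (129 / (d / 2 ^ Suc k)\<^sup>2 + (\<xi> ^ k) powr (4 / \<kappa>)) * Sk \<le> ?E * ((129 / d\<^sup>2 + 1) * b1 ^ Suc k) * Sk"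
    using Sk by (intro mult_right_mono) auto
  moreover have "0 \<le> ?E * (129 / (d / 2 ^ Suc k)\<^sup>2 + (\<xi> ^ k) powr (4 / \<kappa>)) * Sk"
    using energy_const_ge_1 Sk by (intro mult_nonneg_nonneg add_nonneg_nonneg) auto
  ultimately have "(?E * (129 / (d / 2 ^ Suc k)\<^sup>2 + (\<xi> ^ k) powr (4 / \<kappa>)) * Sk) powr \<xi> \<le>
      (?E * ((129 / d\<^sup>2 + 1) * b1 ^ Suc k) * Sk) powr \<xi>"
    using \<xi> by (intro powr_mono2) auto
  then have "?g * (?E * (129 / (d / 2 ^ Suc k)\<^sup>2 + (\<xi> ^ k) powr (4 / \<kappa>)) * Sk) powr \<xi> \<le>
      ?g * (?E * ((129 / d\<^sup>2 + 1) * b1 ^ Suc k) * Sk) powr \<xi>"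
    using gain_const_pos by (intro mult_left_mono) auto
  also have "\<dots> = (?g powr (1 / \<xi>)) powr \<xi> * (?E * ((129 / d\<^sup>2 + 1) * b1 ^ Suc k) * Sk) powr \<xi>"
    using gain_const_pos \<xi> by (simp add: powr_powr)
  also have "\<dots> = ((?g powr (1 / \<xi>)) * (?E * ((129 / d\<^sup>2 + 1) * b1 ^ Suc k) * Sk)) powr \<xi>"
    by (rule powr_mult[symmetric])
  also have "\<dots> \<le> (B ^ Suc k * Sk) powr \<xi>"
  proof (rule powr_mono2)
    have "(?g powr (1 / \<xi>)) * (?E * ((129 / d\<^sup>2 + 1) * b1 ^ Suc k) * Sk) =
        (?g powr (1 / \<xi>) * (?E * (129 / d\<^sup>2 + 1))) * (b1 ^ Suc k * Sk)" by (simp only: mult_ac)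
    \<comment> \<open>Deliberately wasteful: raising the constant \<open>c6\<close>, at least 1, to
      the same power as \<open>b1\<close> merges the two into a power of \<open>B\<close>.\<close>
    also have "\<dots> \<le> c6 ^ Suc k * (b1 ^ Suc k * Sk)"
    proof (rule mult_right_mono)
      have "c6 \<le> c6 ^ Suc k" using c6(1) by (intro self_le_power) auto
      then show "?g powr (1 / \<xi>) * (?E * (129 / d\<^sup>2 + 1)) \<le> c6 ^ Suc k" using c6(2) by linarith
    qed (use Sk b1 in simp)
    also have "\<dots> = B ^ Suc k * Sk" by (simp only: B power_mult_distrib mult.assoc)
    finally show "(?g powr (1 / \<xi>)) * (?E * ((129 / d\<^sup>2 + 1) * b1 ^ Suc k) * Sk) \<le> B ^ Suc k * Sk" .
    show "0 \<le> (?g powr (1 / \<xi>)) * (?E * ((129 / d\<^sup>2 + 1) * b1 ^ Suc k) * Sk)"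
      using energy_const_ge_1 Sk b1 by (intro mult_nonneg_nonneg add_nonneg_nonneg) auto
  qed (use \<xi> in simp)
  also have "\<dots> = (B powr (\<Sum>i<Suc k. real (Suc i) * (1 / \<xi>) ^ i) * S0) powr (\<xi> ^ Suc k)"
  proof -
    have "B ^ Suc k = (B powr (real (Suc k) * (1 / \<xi>) ^ k)) powr (\<xi> ^ k)"
    proof -
      have "real (Suc k) * (1 / \<xi>) ^ k * \<xi> ^ k = real (Suc k)"
        using \<xi> by (simp add: power_divide)
      then have "(B powr (real (Suc k) * (1 / \<xi>) ^ k)) powr (\<xi> ^ k) = B powr real (Suc k)"
        by (simp only: powr_powr)
      then show ?thesis using B0 by (simp only: powr_realpow)
    qed
    then have "B ^ Suc k * Sk = (B powr (real (Suc k) * (1 / \<xi>) ^ k) * (B powr s * S0)) powr (\<xi> ^ k)"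
      by (simp only: Sk_def powr_mult)
    also have "B powr (real (Suc k) * (1 / \<xi>) ^ k) * (B powr s * S0) =
        B powr (\<Sum>i<Suc k. real (Suc i) * (1 / \<xi>) ^ i) * S0"
      by (simp only: s_def sum.lessThan_Suc powr_add mult_ac)
    finally show ?thesis by (simp only: powr_powr power_Suc mult.commute)
  qed
  finally have "?g * (?E * (129 / (d / 2 ^ Suc k)\<^sup>2 + (\<xi> ^ k) powr (4 / \<kappa>)) * Sk) powr \<xi> \<le>
      (B powr (\<Sum>i<Suc k. real (Suc i) * (1 / \<xi>) ^ i) * S0) powr (\<xi> ^ Suc k)" .
  from order_trans[OF step ennreal_leI[OF this]] show ?case
    by (simp only: d_def power_Suc mult_ac)
qed

text \<open>If the square of \<open>u\<close> exceeded the bound at a point, it would by continuity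
  exceed a larger number V' on a whole ball. The iteration then compares V' and V, raised to the
  power \<xi>^k, up to the fixed measure m of that ball; the ratio grows without bound, which is
  impossible.\<close>

lemma sup_bound:
  assumes R: "0 < R" "R < \<rho>" and x: "x \<in> ball x0 R - {p}"
    and J: "J \<ge> 0" "(\<integral>\<^sup>+y. ennreal (indicator U y * (u y)\<^sup>2) \<partial>lborel) \<le> ennreal J"
  shows "(u x)\<^sup>2 \<le> moser_const DIM('a) \<theta> \<Lambda> C M \<kappa> (\<rho> - R) * J"
proof -
  define \<xi> where "\<xi> = 1 + 1 / real DIM('a)"
  define B where "B = moser_base DIM('a) \<theta> \<Lambda> C M \<kappa> (\<rho> - R)"
  have \<xi>: "\<xi> > 1" by (simp add: \<xi>_def)
  have B: "B \<ge> 1"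
  proof -
    have "1 * 1 \<le> B" unfolding B_def moser_base_def by (intro mult_mono) auto
    then show ?thesis by simp
  qed
  define s where "s = 1 / (1 - 1 / \<xi>)\<^sup>2"
  have mc: "moser_const DIM('a) \<theta> \<Lambda> C M \<kappa> (\<rho> - R) = B powr s"
    by (simp add: moser_const_def B_def s_def \<xi>_def)
  have sums: "(\<lambda>i. real (Suc i) * (1 / \<xi>) ^ i) sums s"
    unfolding s_def using geometric_deriv_sums[of "1 / \<xi>"] \<xi> by simp
  have sk: "(\<Sum>i<k. real (Suc i) * (1 / \<xi>) ^ i) \<le> s" for k
    using sums \<xi> sum_le_suminf[OF sums_summable[OF sums], of "{..<k}"] by (simp add: sums_iff)
  \<comment> \<open>A positive S0 above \<open>J\<close> is needed because the iteration divides by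
    its bound and \<open>J\<close> may be 0. At the end S0 tends to \<open>J\<close>.\<close>
  have eps: "(u x)\<^sup>2 \<le> B powr s * S0" if S0: "S0 > 0" "J \<le> S0" for S0
  proof (rule ccontr)
    assume neg: "\<not> (u x)\<^sup>2 \<le> B powr s * S0"
    define V where "V = B powr s * S0"
    define V' where "V' = (V + (u x)\<^sup>2) / 2"
    have "V < (u x)\<^sup>2" using neg by (simp only: V_def not_le)
    moreover have "V > 0" using S0 B by (simp add: V_def)
    ultimately have V: "V > 0" "V < V'" "V' < (u x)\<^sup>2" by (auto simp: V'_def)
    have \<Phi>2: "\<Phi> 2 \<rho> \<le> ennreal S0"
    proof -
      have "\<Phi> 2 \<rho> = (\<integral>\<^sup>+y. ennreal (indicator U y * (u y)\<^sup>2) \<partial>lborel)"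
        unfolding \<Phi>_def
      proof (intro nn_integral_cong)
        fix y show "ennreal (indicator (U \<inter> ball x0 \<rho>) y * u y powr 2) = ennreal (indicator U y * (u y)\<^sup>2)"
          using u_nonneg[of y] by (auto simp: indicator_def)
      qed
      also have "\<dots> \<le> ennreal S0" using J S0 by (meson ennreal_leI order_trans)
      finally show ?thesis .
    qed
    have sub: "ball x0 R - {p} \<subseteq> U" using R by auto
    have "continuous_on (ball x0 R - {p}) (\<lambda>y. (u y)\<^sup>2)"
      using continuous_on_subset[OF u_cont sub] by (intro continuous_intros)
    then have "isCont (\<lambda>y. (u y)\<^sup>2) x" using x by (simp add: continuous_on_eq_continuous_at open_Diff)
    then have "eventually (\<lambda>y. V' < (u y)\<^sup>2) (nhds x)"
      using V(3) unfolding isCont_def tendsto_at_iff_tendsto_nhds[of "\<lambda>y. (u y)\<^sup>2" x]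
      by (intro order_tendstoD(1))
    moreover have "eventually (\<lambda>y. y \<in> ball x0 R - {p}) (nhds x)"
      using x by (intro eventually_nhds_in_open open_Diff) auto
    ultimately have "eventually (\<lambda>y. V' < (u y)\<^sup>2 \<and> y \<in> ball x0 R - {p}) (nhds x)"
      by (rule eventually_conj)
    then obtain e where e: "e > 0" "\<And>y. y \<in> ball x e \<Longrightarrow> V' < (u y)\<^sup>2 \<and> y \<in> ball x0 R - {p}"
      by (auto simp: eventually_nhds_metric dist_commute)
    define m where "m = unit_ball_vol DIM('a) * e ^ DIM('a)"
    have m: "m > 0" unfolding m_def using e(1) by (intro mult_pos_pos unit_ball_vol_pos) auto
    have em: "emeasure lborel (ball x e) = ennreal m" using e(1) by (simp add: emeasure_ball m_def)
    define z where "z = ln (V' / V)"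
    have z: "z > 0" using V by (simp add: z_def)
    \<comment> \<open>The exponential growth of the ratio is used only through 1 + y being at most
      exp y. Bernoulli's inequality then shows that \<xi>^k grows at least linearly, which suffices
      for the contradiction.\<close>
    have key: "m * (1 + \<xi> ^ k * z) \<le> 1" for k
    proof -
      have "ennreal (V' powr (\<xi> ^ k) * m) = (\<integral>\<^sup>+y. ennreal (V' powr (\<xi> ^ k)) * indicator (ball x e) y \<partial>lborel)"
        using m by (simp add: nn_integral_cmult_indicator em ennreal_mult)
      also have "\<dots> \<le> \<Phi> (2 * \<xi> ^ k) (R + (\<rho> - R) / 2 ^ k)"
        unfolding \<Phi>_def
      proof (intro nn_integral_mono)
        fix y
        show "ennreal (V' powr (\<xi> ^ k)) * indicator (ball x e) y \<le>
            ennreal (indicator (U \<inter> ball x0 (R + (\<rho> - R) / 2 ^ k)) y * u y powr (2 * \<xi> ^ k))"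
        proof (cases "y \<in> ball x e")
          case True
          note ey = e(2)[OF True]
          have yU: "y \<in> U" using ey sub by auto
          have "0 < (\<rho> - R) / 2 ^ k" using R by simp
          then have "y \<in> ball x0 (R + (\<rho> - R) / 2 ^ k)" using ey by (simp add: less_trans)
          moreover have "V' powr (\<xi> ^ k) \<le> u y powr (2 * \<xi> ^ k)"
          proof -
            have "V' powr (\<xi> ^ k) \<le> ((u y)\<^sup>2) powr (\<xi> ^ k)" using V ey \<xi> by (intro powr_mono2) auto
            also have "(u y)\<^sup>2 = u y powr 2" using u_nonneg[OF yU] by (simp add: powr_numeral)
            also have "(u y powr 2) powr (\<xi> ^ k) = u y powr (2 * \<xi> ^ k)" by (simp only: powr_powr)
            finally show ?thesis .
          qed
          ultimately show ?thesis using True yU by (simp add: ennreal_leI)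
        qed simp
      qed
      also have "\<dots> \<le> ennreal ((B powr (\<Sum>i<k. real (Suc i) * (1 / \<xi>) ^ i) * S0) powr (\<xi> ^ k))"
        using moser_iteration[OF R S0(1) \<Phi>2, of k] by (simp add: \<xi>_def B_def)
      also have "\<dots> \<le> ennreal (V powr (\<xi> ^ k))"
        unfolding V_def using sk[of k] B S0 \<xi>
        by (intro ennreal_leI powr_mono2 mult_right_mono powr_mono) auto
      finally have le: "V' powr (\<xi> ^ k) * m \<le> V powr (\<xi> ^ k)" by (simp add: ennreal_le_iff)
      have "1 + \<xi> ^ k * z \<le> exp (\<xi> ^ k * z)" by (rule exp_ge_add_one_self)
      also have "\<dots> = (V' / V) powr (\<xi> ^ k)" using V by (simp add: powr_def z_def)
      also have "\<dots> = V' powr (\<xi> ^ k) / V powr (\<xi> ^ k)" using V by (simp add: powr_divide)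
      finally have "m * (1 + \<xi> ^ k * z) \<le> m * (V' powr (\<xi> ^ k) / V powr (\<xi> ^ k))"
        using m by (intro mult_left_mono) auto
      also have "\<dots> \<le> 1" using le V by (simp add: divide_le_eq mult.commute)
      finally show ?thesis .
    qed
    define h where "h = 1 / real DIM('a)"
    have h: "h > 0" by (simp add: h_def)
    obtain k where k: "1 / (m * z * h) < real k" using reals_Archimedean2 by blast
    have "1 + real k * h \<le> \<xi> ^ k" unfolding \<xi>_def h_def[symmetric] using h by (intro Bernoulli_inequality) auto
    then have "real k * h \<le> \<xi> ^ k" by simp
    then have "m * (real k * h * z) \<le> m * (1 + \<xi> ^ k * z)"
      using m z by (intro mult_left_mono) (auto intro: add_increasing mult_right_mono)
    also have "\<dots> \<le> 1" by (rule key)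
    finally have "real k \<le> 1 / (m * z * h)" using m z h by (simp add: field_simps)
    then show False using k by simp
  qed
  show ?thesis
  proof (rule field_le_epsilon)
    fix e :: real assume e: "e > 0"
    have Bs: "B powr s > 0" using B by simp
    have "(u x)\<^sup>2 \<le> B powr s * (J + e / B powr s)"
      using J e Bs by (intro eps) (auto intro: add_nonneg_pos)
    also have "\<dots> = B powr s * J + e" using Bs by (simp add: distrib_left)
    finally show "(u x)\<^sup>2 \<le> moser_const DIM('a) \<theta> \<Lambda> C M \<kappa> (\<rho> - R) * J + e"
      by (simp add: mc)
  qed
qed

end

section \<open>A pointwise Bochner estimate\<close>

text \<open>Linear algebra at a single point: \<open>m j\<close> is the gradient of the j-th
  component of \<omega>, \<open>W\<close> is \<omega>, \<open>G\<close> is \<Gamma>, and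
  \<open>q\<close> is the gradient of Q.\<close>

context
  fixes m :: "'n::finite \<Rightarrow> real^'n" and W G q :: "real^'n"
  assumes curl: "\<And>i j. m j $ i - m i $ j = G $ i * W $ j - G $ j * W $ i"
    and q: "q = (\<Sum>j\<in>UNIV. (2 * W $ j) *\<^sub>R m j)"
begin

text \<open>By the chain rule half of \<open>q $ k\<close> pairs \<open>W\<close> with the k-th
  derivatives of its components. Exchanging the two indices by the curl equation produces the terms
  in \<open>G\<close>.\<close>

lemma inner_grad_W: "m k \<bullet> W = q $ k / 2 - G $ k * (W \<bullet> W) + (G \<bullet> W) * W $ k"
proof -
  have "q $ k = (\<Sum>j\<in>UNIV. 2 * W $ j * m j $ k)" by (simp add: q)
  also have "\<dots> = (\<Sum>j\<in>UNIV. 2 * (m k $ j * W $ j) + 2 * G $ k * (W $ j * W $ j) - 2 * W $ k * (G $ j * W $ j))"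
  proof (intro sum.cong refl)
    fix j
    have e: "m j $ k = m k $ j + G $ k * W $ j - G $ j * W $ k" using curl[of j k] by simp
    show "2 * W $ j * m j $ k = 2 * (m k $ j * W $ j) + 2 * G $ k * (W $ j * W $ j) - 2 * W $ k * (G $ j * W $ j)"
      unfolding e by (simp add: algebra_simps)
  qed
  also have "\<dots> = 2 * (m k \<bullet> W) + 2 * G $ k * (W \<bullet> W) - 2 * W $ k * (G \<bullet> W)"
    by (simp add: inner_vec_def sum.distrib sum_subtractf sum_distrib_left)
  finally show ?thesis by (simp add: field_simps)
qed

text \<open>The factors on the left are the k-th derivative of the i-th component of \<rho>(Q)
  \<omega> and the i-th derivative of the k-th component of \<phi> \<omega>, with \<open>z\<close>
  the gradient of \<phi>. Each transposition of \<open>m\<close> costs terms linear in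
  \<open>G\<close>; what remains is the full squared gradient and the squared gradient of Q.\<close>

lemma bochner_identity:
  "(\<Sum>i\<in>UNIV. \<Sum>k\<in>UNIV. (r * m i $ k + r' * W $ i * q $ k) * (W $ k * z $ i + \<phi> * m k $ i)) =
    r * ((q \<bullet> z) / 2 - (W \<bullet> W) * (G \<bullet> z) + (G \<bullet> W) * (W \<bullet> z)) + r' * (q \<bullet> W) * (W \<bullet> z) +
    \<phi> * (r * ((\<Sum>k\<in>UNIV. m k \<bullet> m k) + (\<Sum>k\<in>UNIV. G $ k * (m k \<bullet> W)) - (\<Sum>k\<in>UNIV. W $ k * (m k \<bullet> G))) +
      r' * ((q \<bullet> q) / 2 - (W \<bullet> W) * (G \<bullet> q) + (G \<bullet> W) * (W \<bullet> q)))"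
proof -
  have "(\<Sum>i\<in>UNIV. \<Sum>k\<in>UNIV. (r * m i $ k + r' * W $ i * q $ k) * (W $ k * z $ i + \<phi> * m k $ i)) =
      (\<Sum>i\<in>UNIV. \<Sum>k\<in>UNIV. r * (z $ i * (m i $ k * W $ k)) + r' * ((W $ i * z $ i) * (q $ k * W $ k)) +
        (\<phi> * r) * (m i $ k * m k $ i) + (\<phi> * r') * (q $ k * (m k $ i * W $ i)))"
    by (intro sum.cong refl) (simp add: algebra_simps)
  also have "\<dots> = r * (\<Sum>i\<in>UNIV. \<Sum>k\<in>UNIV. z $ i * (m i $ k * W $ k)) +
      r' * (\<Sum>i\<in>UNIV. \<Sum>k\<in>UNIV. (W $ i * z $ i) * (q $ k * W $ k)) +
      (\<phi> * r) * (\<Sum>i\<in>UNIV. \<Sum>k\<in>UNIV. m i $ k * m k $ i) +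
      (\<phi> * r') * (\<Sum>i\<in>UNIV. \<Sum>k\<in>UNIV. q $ k * (m k $ i * W $ i))"
    by (simp add: sum.distrib sum_distrib_left)
  also have "(\<Sum>i\<in>UNIV. \<Sum>k\<in>UNIV. z $ i * (m i $ k * W $ k)) = (\<Sum>i\<in>UNIV. z $ i * (m i \<bullet> W))"
    by (simp add: inner_vec_def sum_distrib_left)
  also have "\<dots> = (\<Sum>i\<in>UNIV. (1 / 2) * (q $ i * z $ i) - (W \<bullet> W) * (G $ i * z $ i) + (G \<bullet> W) * (W $ i * z $ i))"
    by (intro sum.cong refl) (simp add: inner_grad_W algebra_simps)
  also have "\<dots> = (q \<bullet> z) / 2 - (W \<bullet> W) * (G \<bullet> z) + (G \<bullet> W) * (W \<bullet> z)"
    unfolding sum.distrib sum_subtractf sum_distrib_left[symmetric] by (simp add: inner_vec_def)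
  also have "(\<Sum>i\<in>UNIV. \<Sum>k\<in>UNIV. (W $ i * z $ i) * (q $ k * W $ k)) = (q \<bullet> W) * (W \<bullet> z)"
    unfolding sum_product[symmetric] by (simp add: inner_vec_def mult.commute)
  also have "(\<Sum>i\<in>UNIV. \<Sum>k\<in>UNIV. m i $ k * m k $ i) =
      (\<Sum>i\<in>UNIV. \<Sum>k\<in>UNIV. m k $ i * m k $ i + G $ k * (m k $ i * W $ i) - W $ k * (m k $ i * G $ i))"
  proof (intro sum.cong refl)
    fix i k
    have e: "m i $ k = m k $ i + G $ k * W $ i - G $ i * W $ k" using curl[of i k] by simp
    show "m i $ k * m k $ i = m k $ i * m k $ i + G $ k * (m k $ i * W $ i) - W $ k * (m k $ i * G $ i)"
      unfolding e by (simp add: algebra_simps)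
  qed
  also have "\<dots> = (\<Sum>k\<in>UNIV. \<Sum>i\<in>UNIV. m k $ i * m k $ i + G $ k * (m k $ i * W $ i) - W $ k * (m k $ i * G $ i))"
    by (rule sum.swap)
  also have "\<dots> = (\<Sum>k\<in>UNIV. m k \<bullet> m k) + (\<Sum>k\<in>UNIV. G $ k * (m k \<bullet> W)) - (\<Sum>k\<in>UNIV. W $ k * (m k \<bullet> G))"
    by (simp add: inner_vec_def sum.distrib sum_subtractf sum_distrib_left)
  also have "(\<Sum>i\<in>UNIV. \<Sum>k\<in>UNIV. q $ k * (m k $ i * W $ i)) = (\<Sum>k\<in>UNIV. \<Sum>i\<in>UNIV. q $ k * (m k $ i * W $ i))"
    by (rule sum.swap)
  also have "\<dots> = (\<Sum>k\<in>UNIV. q $ k * (m k \<bullet> W))"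
    by (simp add: inner_vec_def sum_distrib_left)
  also have "\<dots> = (\<Sum>k\<in>UNIV. (1 / 2) * (q $ k * q $ k) - (W \<bullet> W) * (G $ k * q $ k) + (G \<bullet> W) * (W $ k * q $ k))"
    by (intro sum.cong refl) (simp add: inner_grad_W algebra_simps)
  also have "\<dots> = (q \<bullet> q) / 2 - (W \<bullet> W) * (G \<bullet> q) + (G \<bullet> W) * (W \<bullet> q)"
    unfolding sum.distrib sum_subtractf sum_distrib_left[symmetric] by (simp add: inner_vec_def)
  finally show ?thesis by (simp add: algebra_simps)
qed

lemma sum_mult_inner_le:
  fixes a v :: "real^'n"
  shows "\<bar>\<Sum>k\<in>UNIV. a $ k * (m k \<bullet> v)\<bar> \<le> norm a * norm v * L2_set (\<lambda>k. norm (m k)) UNIV"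
proof -
  have "\<bar>\<Sum>k\<in>UNIV. a $ k * (m k \<bullet> v)\<bar> \<le> (\<Sum>k\<in>UNIV. \<bar>a $ k * (m k \<bullet> v)\<bar>)" by (rule sum_abs)
  also have "\<dots> \<le> (\<Sum>k\<in>UNIV. norm v * (\<bar>a $ k\<bar> * \<bar>norm (m k)\<bar>))"
  proof (rule sum_mono)
    fix k
    have "\<bar>m k \<bullet> v\<bar> \<le> norm (m k) * norm v" by (rule Cauchy_Schwarz_ineq2)
    then have "\<bar>a $ k\<bar> * \<bar>m k \<bullet> v\<bar> \<le> \<bar>a $ k\<bar> * (norm (m k) * norm v)" by (rule mult_left_mono) simp
    then show "\<bar>a $ k * (m k \<bullet> v)\<bar> \<le> norm v * (\<bar>a $ k\<bar> * \<bar>norm (m k)\<bar>)" by (simp add: abs_mult mult_ac)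
  qed
  also have "\<dots> = norm v * (\<Sum>k\<in>UNIV. \<bar>a $ k\<bar> * \<bar>norm (m k)\<bar>)" by (rule sum_distrib_left[symmetric])
  also have "\<dots> \<le> norm v * (L2_set (\<lambda>k. a $ k) UNIV * L2_set (\<lambda>k. norm (m k)) UNIV)"
    by (intro mult_left_mono L2_set_mult_ineq) simp
  also have "L2_set (\<lambda>k. a $ k) UNIV = norm a" by (simp add: norm_vec_def L2_set_def)
  finally show ?thesis by (simp add: mult_ac)
qed

lemma norm_q_le: "norm q \<le> 2 * norm W * L2_set (\<lambda>k. norm (m k)) UNIV"
proof -
  have "norm q \<le> (\<Sum>k\<in>UNIV. norm ((2 * W $ k) *\<^sub>R m k))" unfolding q by (rule norm_sum)
  also have "\<dots> = 2 * (\<Sum>k\<in>UNIV. \<bar>W $ k\<bar> * \<bar>norm (m k)\<bar>)" by (simp add: sum_distrib_left abs_mult mult_ac)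
  also have "\<dots> \<le> 2 * (L2_set (\<lambda>k. W $ k) UNIV * L2_set (\<lambda>k. norm (m k)) UNIV)"
    by (intro mult_left_mono L2_set_mult_ineq) simp
  also have "L2_set (\<lambda>k. W $ k) UNIV = norm W" by (simp add: norm_vec_def L2_set_def)
  finally show ?thesis by simp
qed

text \<open>All errors at \<phi> are at most r t times a constant, where t is the product of the
  norms of \<open>W\<close>, \<open>G\<close> and the full gradient S. The constant adds 2 from
  transposing \<open>m\<close>, 4 L from the terms with r', and the dimension from the trace.
  Completing the square against the good term l r S^2 gives the denominator 4 l. The 3 counts the
  products of \<open>G\<close> with \<open>z\<close>, one of which comes from the divergence
  term.\<close>

lemma bochner_estimate:
  assumes r: "r > 0" and \<phi>: "\<phi> \<ge> 0" and L: "\<bar>r'\<bar> * (W \<bullet> W) \<le> L * r" and l: "l > 0" "l \<le> 1"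
    "r' < 0 \<Longrightarrow> l * r \<le> r + 2 * r' * (W \<bullet> W)"
  shows "(r / 2) * (q \<bullet> z) + r' * (q \<bullet> W) * (W \<bullet> z) \<le>
    (\<Sum>i\<in>UNIV. \<Sum>k\<in>UNIV. (r * m i $ k + r' * W $ i * q $ k) * (W $ k * z $ i + \<phi> * m k $ i)) +
    r * (G \<bullet> W) * ((W \<bullet> z) + \<phi> * (\<Sum>k\<in>UNIV. m k $ k)) +
    r * (W \<bullet> W) * ((2 + 4 * L + real CARD('n))\<^sup>2 / (4 * l) * (norm G)\<^sup>2 * \<phi> + 3 * norm G * norm z)"
proof -
  define S where "S = L2_set (\<lambda>k. norm (m k)) UNIV"
  have S: "S \<ge> 0" unfolding S_def by (rule L2_set_nonneg)
  have S2: "(\<Sum>k\<in>UNIV. m k \<bullet> m k) = S\<^sup>2" by (simp add: S_def L2_set_def sum_nonneg power2_norm_eq_inner)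
  have WW: "W \<bullet> W = (norm W)\<^sup>2" by (simp add: power2_norm_eq_inner)
  define t where "t = norm W * norm G * S"
  have t: "t \<ge> 0" unfolding t_def using S by simp
  have nq: "norm q \<le> 2 * norm W * S" using norm_q_le by (simp add: S_def)
  have CS: "\<bar>x \<bullet> y\<bar> \<le> norm x * norm y" for x y :: "real^'n" by (rule Cauchy_Schwarz_ineq2)
  have a1: "\<bar>\<Sum>k\<in>UNIV. G $ k * (m k \<bullet> W)\<bar> \<le> t" "\<bar>\<Sum>k\<in>UNIV. W $ k * (m k \<bullet> G)\<bar> \<le> t"
    using sum_mult_inner_le[of G W] sum_mult_inner_le[of W G] by (simp_all add: t_def S_def mult_ac)
  have a2: "\<bar>r' * (- (W \<bullet> W) * (G \<bullet> q) + (G \<bullet> W) * (W \<bullet> q))\<bar> \<le> 4 * L * r * t"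
  proof -
    have "\<bar>- (W \<bullet> W) * (G \<bullet> q) + (G \<bullet> W) * (W \<bullet> q)\<bar> \<le> \<bar>(W \<bullet> W) * (G \<bullet> q)\<bar> + \<bar>(G \<bullet> W) * (W \<bullet> q)\<bar>"
      by linarith
    also have "\<dots> \<le> (W \<bullet> W) * (norm G * norm q) + (norm G * norm W) * (norm W * norm q)"
      unfolding abs_mult using CS by (intro add_mono mult_mono) auto
    also have "\<dots> = 2 * ((W \<bullet> W) * (norm G * norm q))" by (simp add: WW power2_eq_square)
    also have "\<dots> \<le> 2 * ((W \<bullet> W) * (norm G * (2 * norm W * S)))"
      using nq by (intro mult_left_mono) auto
    also have "\<dots> = 4 * (W \<bullet> W) * t" by (simp add: t_def)
    finally have "\<bar>r'\<bar> * \<bar>- (W \<bullet> W) * (G \<bullet> q) + (G \<bullet> W) * (W \<bullet> q)\<bar> \<le> \<bar>r'\<bar> * (4 * (W \<bullet> W) * t)"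
      by (rule mult_left_mono) simp
    also have "\<dots> = 4 * t * (\<bar>r'\<bar> * (W \<bullet> W))" by simp
    also have "\<dots> \<le> 4 * t * (L * r)" using L t by (intro mult_left_mono) auto
    finally show ?thesis by (simp add: abs_mult mult_ac)
  qed
  have a3: "\<bar>(G \<bullet> W) * (\<Sum>k\<in>UNIV. m k $ k)\<bar> \<le> real CARD('n) * t"
  proof -
    have "\<bar>\<Sum>k\<in>UNIV. m k $ k\<bar> \<le> (\<Sum>k\<in>UNIV. \<bar>m k $ k\<bar>)" by (rule sum_abs)
    also have "\<dots> \<le> (\<Sum>k\<in>(UNIV::'n set). S)"
    proof (rule sum_mono)
      fix k
      have "\<bar>m k $ k\<bar> \<le> norm (m k)" by (rule component_le_norm_cart)
      also have "\<dots> \<le> S" unfolding S_def by (rule member_le_L2_set) auto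
      finally show "\<bar>m k $ k\<bar> \<le> S" .
    qed
    finally have "\<bar>\<Sum>k\<in>UNIV. m k $ k\<bar> \<le> real CARD('n) * S" by simp
    then have "\<bar>G \<bullet> W\<bar> * \<bar>\<Sum>k\<in>UNIV. m k $ k\<bar> \<le> (norm G * norm W) * (real CARD('n) * S)"
      using CS[of G W] by (intro mult_mono) auto
    then show ?thesis by (simp add: abs_mult t_def mult_ac)
  qed
  \<comment> \<open>For nonnegative r' the gradient of Q only helps. For negative r' it is estimated
    by S through \<open>norm_q_le\<close>, and the assumption on l preserves a positive fraction of
    the good term.\<close>
  have main: "l * r * S\<^sup>2 \<le> r * S\<^sup>2 + r' * ((q \<bullet> q) / 2)"
  proof (cases "r' < 0")
    case False
    have "l * r * S\<^sup>2 \<le> 1 * r * S\<^sup>2" using l r by (intro mult_right_mono) auto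
    moreover have "0 \<le> r' * ((q \<bullet> q) / 2)" using False by (intro mult_nonneg_nonneg) auto
    ultimately show ?thesis by simp
  next
    case True
    have "q \<bullet> q = (norm q)\<^sup>2" by (simp add: power2_norm_eq_inner)
    also have "\<dots> \<le> (2 * norm W * S)\<^sup>2" using nq by (intro power_mono) auto
    finally have "q \<bullet> q / 2 \<le> 2 * (W \<bullet> W) * S\<^sup>2" by (simp add: WW power_mult_distrib)
    then have "r' * (2 * (W \<bullet> W) * S\<^sup>2) \<le> r' * (q \<bullet> q / 2)" using True by (intro mult_left_mono_neg) auto
    moreover have "l * r * S\<^sup>2 \<le> (r + 2 * r' * (W \<bullet> W)) * S\<^sup>2" using l(3)[OF True] by (intro mult_right_mono) auto
    ultimately show ?thesis by (simp add: algebra_simps)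
  qed
  define c where "c = 2 + 4 * L + real CARD('n)"
  define X where "X = r * ((\<Sum>k\<in>UNIV. m k \<bullet> m k) + (\<Sum>k\<in>UNIV. G $ k * (m k \<bullet> W)) - (\<Sum>k\<in>UNIV. W $ k * (m k \<bullet> G))) +
      r' * ((q \<bullet> q) / 2 - (W \<bullet> W) * (G \<bullet> q) + (G \<bullet> W) * (W \<bullet> q)) + r * ((G \<bullet> W) * (\<Sum>k\<in>UNIV. m k $ k))"
  have X: "X \<ge> - (r * (W \<bullet> W) * (c\<^sup>2 / (4 * l) * (norm G)\<^sup>2))"
  proof -
    have "r * (\<Sum>k\<in>UNIV. G $ k * (m k \<bullet> W)) \<ge> r * (- t)" "r * (\<Sum>k\<in>UNIV. W $ k * (m k \<bullet> G)) \<le> r * t"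
      "r * ((G \<bullet> W) * (\<Sum>k\<in>UNIV. m k $ k)) \<ge> r * (- (real CARD('n) * t))"
      using a1 a3 r by (intro mult_left_mono; linarith)+
    moreover have "r' * (- (W \<bullet> W) * (G \<bullet> q) + (G \<bullet> W) * (W \<bullet> q)) \<ge> - (4 * L * r * t)" using a2 by linarith
    moreover have "X = r * S\<^sup>2 + r' * ((q \<bullet> q) / 2) + r * (\<Sum>k\<in>UNIV. G $ k * (m k \<bullet> W)) - r * (\<Sum>k\<in>UNIV. W $ k * (m k \<bullet> G)) +
        r' * (- (W \<bullet> W) * (G \<bullet> q) + (G \<bullet> W) * (W \<bullet> q)) + r * ((G \<bullet> W) * (\<Sum>k\<in>UNIV. m k $ k))"
      unfolding X_def S2 by (simp add: algebra_simps)
    ultimately have "X \<ge> l * r * S\<^sup>2 - r * c * t"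
      using main by (simp add: c_def algebra_simps)
    moreover have "r * (l * S\<^sup>2 - c * t) \<ge> r * (- (c * (norm W * norm G))\<^sup>2 / (4 * l))"
    proof (rule mult_left_mono)
      have "0 \<le> (2 * l * S - c * (norm W * norm G))\<^sup>2 / (4 * l)" using l by simp
      also have "\<dots> = l * S\<^sup>2 - c * t + (c * (norm W * norm G))\<^sup>2 / (4 * l)"
        using l by (simp add: t_def power2_eq_square field_simps)
      finally show "- (c * (norm W * norm G))\<^sup>2 / (4 * l) \<le> l * S\<^sup>2 - c * t" by simp
    qed (use r in simp)
    ultimately show ?thesis by (simp add: WW power_mult_distrib algebra_simps)
  qed
  have Z: "r * (- (W \<bullet> W) * (G \<bullet> z) + 2 * (G \<bullet> W) * (W \<bullet> z)) \<ge> - (r * (W \<bullet> W) * (3 * norm G * norm z))"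
  proof -
    have "\<bar>- (W \<bullet> W) * (G \<bullet> z) + 2 * (G \<bullet> W) * (W \<bullet> z)\<bar> \<le> \<bar>(W \<bullet> W) * (G \<bullet> z)\<bar> + 2 * \<bar>(G \<bullet> W) * (W \<bullet> z)\<bar>"
      by linarith
    also have "\<dots> \<le> (W \<bullet> W) * (norm G * norm z) + 2 * ((norm G * norm W) * (norm W * norm z))"
      unfolding abs_mult using CS by (intro add_mono mult_mono mult_left_mono) auto
    also have "\<dots> = (W \<bullet> W) * (3 * norm G * norm z)" by (simp add: WW power2_eq_square)
    finally have "- (W \<bullet> W) * (G \<bullet> z) + 2 * (G \<bullet> W) * (W \<bullet> z) \<ge> - ((W \<bullet> W) * (3 * norm G * norm z))" by linarith
    then have "r * (- ((W \<bullet> W) * (3 * norm G * norm z))) \<le> r * (- (W \<bullet> W) * (G \<bullet> z) + 2 * (G \<bullet> W) * (W \<bullet> z))"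
      using r by (intro mult_left_mono) auto
    then show ?thesis by (simp add: mult_ac)
  qed
  have "\<phi> * X \<ge> \<phi> * - (r * (W \<bullet> W) * (c\<^sup>2 / (4 * l) * (norm G)\<^sup>2))" using X \<phi> by (intro mult_left_mono) auto
  with Z have "(r / 2) * (q \<bullet> z) + r' * (q \<bullet> W) * (W \<bullet> z) \<le>
     (r / 2) * (q \<bullet> z) + r' * (q \<bullet> W) * (W \<bullet> z) + r * (- (W \<bullet> W) * (G \<bullet> z) + 2 * (G \<bullet> W) * (W \<bullet> z)) + \<phi> * X +
     (r * (W \<bullet> W) * (3 * norm G * norm z) + \<phi> * (r * (W \<bullet> W) * (c\<^sup>2 / (4 * l) * (norm G)\<^sup>2)))"
    by simp
  also have "\<dots> = (\<Sum>i\<in>UNIV. \<Sum>k\<in>UNIV. (r * m i $ k + r' * W $ i * q $ k) * (W $ k * z $ i + \<phi> * m k $ i)) +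
    r * (G \<bullet> W) * ((W \<bullet> z) + \<phi> * (\<Sum>k\<in>UNIV. m k $ k)) +
    r * (W \<bullet> W) * (c\<^sup>2 / (4 * l) * (norm G)\<^sup>2 * \<phi> + 3 * norm G * norm z)"
    unfolding bochner_identity X_def by (simp add: algebra_simps)
  finally show ?thesis unfolding c_def .
qed

end

section \<open>The subsolution property of H\<close>

text \<open>The lower bound for H'/\<rho>: the value 1/2 serves where \<rho>' is nonnegative, the
  inverse of C0 where it is negative.\<close>

definition ellipticity :: "real \<Rightarrow> real" where "ellipticity C0 = min (1 / 2) (inverse C0)"

text \<open>\<open>bochner_estimate\<close> with L = C0 + 1 and l twice the ellipticity, whence the
  8. The first factor converts Q \<rho>(Q) into H.\<close>

definition drift_const :: "real \<Rightarrow> real \<Rightarrow> real" where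
  "drift_const n C0 = (1 + 1 / (2 * ellipticity C0)) *
     ((2 + 4 * (C0 + 1) + n)\<^sup>2 / (8 * ellipticity C0) + 3)"

lemma GDERIV_sum_squares:
  fixes w :: "'n::finite \<Rightarrow> 'a::real_inner \<Rightarrow> real"
  assumes "\<And>i. GDERIV (w i) x :> dw i"
  shows "GDERIV (\<lambda>x. (\<chi> i. w i x) \<bullet> (\<chi> i. w i x)) x :> (\<Sum>j\<in>UNIV. (2 * w j x) *\<^sub>R dw j)"
proof -
  have "((\<lambda>x. \<Sum>j\<in>UNIV. w j x * w j x) has_derivative (\<lambda>h. \<Sum>j\<in>UNIV. h \<bullet> (w j x *\<^sub>R dw j + w j x *\<^sub>R dw j))) (at x)"
  proof (rule has_derivative_sum)
    show "((\<lambda>x. w j x * w j x) has_derivative (\<lambda>h. h \<bullet> (w j x *\<^sub>R dw j + w j x *\<^sub>R dw j))) (at x)" for j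
      using GDERIV_mult[OF assms[of j] assms[of j]] by (simp only: gderiv_def)
  qed
  moreover have "(\<lambda>h. \<Sum>j\<in>UNIV. h \<bullet> (w j x *\<^sub>R dw j + w j x *\<^sub>R dw j)) =
      (\<lambda>h. h \<bullet> (\<Sum>j\<in>UNIV. (2 * w j x) *\<^sub>R dw j))"
    by (simp only: inner_sum_right inner_add_right inner_scaleR_right) (simp add: mult.assoc)
  ultimately show ?thesis by (simp add: gderiv_def inner_vec_def)
qed

section \<open>Consequences of the hypotheses on the density\<close>

locale density =
  fixes C0 :: real and \<rho> \<rho>' H H' :: "real \<Rightarrow> real"
  assumes C0: "C0 > 0" and \<rho>'_cont: "continuous_on {0..} \<rho>'"
    and \<rho>_pos: "t \<ge> 0 \<Longrightarrow> \<rho> t > 0"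
    and \<rho>_deriv: "t \<ge> 0 \<Longrightarrow> (\<rho> has_real_derivative \<rho>' t) (at t within {0..})"
    and H_0: "H 0 = 0" and H'_eq: "t \<ge> 0 \<Longrightarrow> H' t = 1/2 * \<rho> t + t * \<rho>' t"
    and H_deriv: "t \<ge> 0 \<Longrightarrow> (H has_real_derivative H' t) (at t within {0..})"
    and upper: "t \<ge> 0 \<Longrightarrow> \<rho>' t > 0 \<Longrightarrow> H' t \<le> C0 * \<rho> t"
    and lower: "t \<ge> 0 \<Longrightarrow> \<rho>' t < 0 \<Longrightarrow> H' t \<ge> inverse C0 * \<rho> t"
begin

lemma ellipticity_pos: "0 < ellipticity C0" "ellipticity C0 \<le> 1 / 2"
  using C0 by (auto simp: ellipticity_def)

text \<open>Where \<rho>' has the sign not covered by a hypothesis, the term t \<rho>' has the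
  favourable sign and H' is compared with \<rho>/2 directly. The bound on \<rho>' follows since t
  \<rho>' is H' - \<rho>/2.\<close>

lemma H'_bounds:
  assumes "t \<ge> 0"
  shows "ellipticity C0 * \<rho> t \<le> H' t" "H' t \<le> (C0 + 1) * \<rho> t" "\<bar>\<rho>' t\<bar> * t \<le> (C0 + 1) * \<rho> t"
proof -
  note p = \<rho>_pos[OF assms]
  have e: "ellipticity C0 * \<rho> t \<le> 1 / 2 * \<rho> t" "ellipticity C0 * \<rho> t \<le> inverse C0 * \<rho> t"
    using p by (auto simp: ellipticity_def intro!: mult_right_mono)
  show l: "ellipticity C0 * \<rho> t \<le> H' t"
  proof (cases "\<rho>' t < 0")
    case True
    then show ?thesis using lower[OF assms] e by linarith
  next
    case False
    then have "0 \<le> t * \<rho>' t" using assms by simp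
    then show ?thesis using e H'_eq[OF assms] by linarith
  qed
  have c: "C0 * \<rho> t > 0" using C0 p by simp
  show u: "H' t \<le> (C0 + 1) * \<rho> t"
  proof (cases "\<rho>' t > 0")
    case True
    then show ?thesis using upper[OF assms] p by (simp add: distrib_right)
  next
    case False
    then have "t * \<rho>' t \<le> 0" using assms by (simp add: mult_nonneg_nonpos)
    moreover have "(C0 + 1) * \<rho> t = C0 * \<rho> t + \<rho> t" by (simp add: distrib_right)
    ultimately show ?thesis using c p H'_eq[OF assms] by linarith
  qed
  have "0 < ellipticity C0 * \<rho> t" using ellipticity_pos p by simp
  moreover have "\<bar>\<rho>' t\<bar> * t = \<bar>t * \<rho>' t\<bar>" using assms by (simp add: abs_mult mult.commute)
  moreover have "t * \<rho>' t = H' t - 1 / 2 * \<rho> t" using H'_eq[OF assms] by simp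
  moreover have "(C0 + 1) * \<rho> t = C0 * \<rho> t + \<rho> t" by (simp add: distrib_right)
  ultimately show "\<bar>\<rho>' t\<bar> * t \<le> (C0 + 1) * \<rho> t" using l u c p by linarith
qed

lemma \<rho>_cont: "continuous_on {0..} \<rho>"
  using \<rho>_deriv by (intro DERIV_continuous_on[of _ _ \<rho>']) auto

lemma H_cont: "continuous_on {0..} H"
  using H_deriv by (intro DERIV_continuous_on[of _ _ H']) auto

lemma H'_cont: "continuous_on {0..} H'"
proof -
  have "continuous_on {0..} (\<lambda>t. 1/2 * \<rho> t + t * \<rho>' t)"
    by (intro continuous_intros \<rho>_cont \<rho>'_cont)
  then show ?thesis using H'_eq by (subst continuous_on_cong[OF refl, of _ _ "\<lambda>t. 1/2 * \<rho> t + t * \<rho>' t"]) auto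
qed

text \<open>Both sides vanish at 0, and the derivative of t \<rho> is H' + \<rho>/2, where \<rho> is
  at most H' divided by the ellipticity.\<close>

lemma flux_le_H:
  assumes t: "t \<ge> 0"
  shows "t * \<rho> t \<le> (1 + 1 / (2 * ellipticity C0)) * H t"
proof -
  let ?e = "ellipticity C0"
  define F where "F s = (1 + 1 / (2 * ?e)) * H s - s * \<rho> s" for s
  have "F 0 \<le> F t"
  proof (rule DERIV_nonneg_imp_increasing_open[OF t])
    show "continuous_on {0..t} F" unfolding F_def
      using continuous_on_subset[OF H_cont] continuous_on_subset[OF \<rho>_cont] by (intro continuous_intros) auto
    fix s assume s: "0 < s" "s < t"
    then have at: "at s within {0..} = at s" by (intro at_within_interior) simp
    have "(F has_real_derivative (1 + 1 / (2 * ?e)) * H' s - (s * \<rho>' s + \<rho> s)) (at s)"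
      unfolding F_def using H_deriv[of s] \<rho>_deriv[of s] s
      by (auto simp: at intro!: derivative_eq_intros)
    moreover have "0 \<le> (1 + 1 / (2 * ?e)) * H' s - (s * \<rho>' s + \<rho> s)"
    proof -
      have "s * \<rho>' s + \<rho> s = H' s + 1 / (2 * ?e) * (?e * \<rho> s)" using H'_eq[of s] s ellipticity_pos by simp
      moreover have "1 / (2 * ?e) * (?e * \<rho> s) \<le> 1 / (2 * ?e) * H' s"
        using H'_bounds(1)[of s] s ellipticity_pos by (intro mult_left_mono) auto
      ultimately show ?thesis by (simp add: distrib_right)
    qed
    ultimately show "\<exists>y. (F has_real_derivative y) (at s) \<and> 0 \<le> y" by blast
  qed
  then show ?thesis by (simp add: F_def H_0)
qed

lemma H_nonneg: "t \<ge> 0 \<Longrightarrow> 0 \<le> H t"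
proof -
  assume t: "t \<ge> 0"
  then have "0 \<le> t * \<rho> t" using \<rho>_pos[OF t] by simp
  then have "0 \<le> (1 + 1 / (2 * ellipticity C0)) * H t" using flux_le_H[OF t] by linarith
  moreover have "1 + 1 / (2 * ellipticity C0) > 0" using ellipticity_pos by (simp add: add_pos_pos)
  ultimately show ?thesis by (simp add: zero_le_mult_iff)
qed

text \<open>\<open>integral_swap_partial_derivs\<close>, applied to the components of \<rho>(Q)
  \<omega> and \<phi> \<omega>, shows that the sum \<open>T1\<close> of mixed products and the
  product \<open>T2\<close> of the two divergences have equal integrals. Adding their difference to
  the integrand is therefore free, and \<open>bochner_estimate\<close> bounds the flux pointwise by
  it and the drift. The ellipticity constants of the conclusion refer to the gradient of H(Q), which
  is H' q; this accounts for the divisions by C0 + 1 and by the ellipticity.\<close>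

lemma weak_subsolution_H:
  fixes w :: "'n::finite \<Rightarrow> real^'n \<Rightarrow> real" and dw :: "'n \<Rightarrow> real^'n \<Rightarrow> real^'n" and \<Gamma> :: "real^'n \<Rightarrow> real^'n"
  defines "W \<equiv> \<lambda>x. \<chi> i. w i x"
  defines "Q \<equiv> \<lambda>x. W x \<bullet> W x"
  defines "q \<equiv> \<lambda>x. \<Sum>j\<in>UNIV. (2 * w j x) *\<^sub>R dw j x"
  assumes U: "open U" and w: "\<And>i. C1_grad_on U (w i) (dw i)" and \<Gamma>: "continuous_on U \<Gamma>"
    and curl: "\<And>x i j. x \<in> U \<Longrightarrow> dw j x $ i - dw i x $ j = \<Gamma> x $ i * w j x - \<Gamma> x $ j * w i x"
    and div: "\<And>x. x \<in> U \<Longrightarrow> (\<Sum>i\<in>UNIV. \<rho> (Q x) * dw i x $ i + \<rho>' (Q x) * w i x * q x $ i) =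
      - \<rho> (Q x) * (\<Gamma> x \<bullet> W x)"
  shows "weak_subsolution U (\<lambda>x. H (Q x)) (\<lambda>x. H' (Q x) *\<^sub>R q x)
    (\<lambda>x. (\<rho> (Q x) / 2) *\<^sub>R q x + (\<rho>' (Q x) * (q x \<bullet> W x)) *\<^sub>R W x) (\<lambda>x. norm (\<Gamma> x))
    (ellipticity C0 / (C0 + 1)) ((3 / 2 + C0) / ellipticity C0) (drift_const CARD('n) C0)"
proof -
  let ?e = "ellipticity C0"
  note e = ellipticity_pos
  have Q0: "Q x \<ge> 0" for x by (simp add: Q_def)
  have wc: "continuous_on U (w i)" "continuous_on U (dw i)" for i
    using w[of i] C1_grad_on_continuous[OF w[of i]] by (auto simp: C1_grad_on_def)
  have Wc: "continuous_on U W" unfolding W_def by (intro continuous_on_vec_lambda wc)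
  have Qc: "continuous_on U Q" unfolding Q_def by (intro continuous_intros Wc)
  have qc: "continuous_on U q" unfolding q_def by (intro continuous_intros wc)
  have comp: "continuous_on U (\<lambda>x. h (Q x))" if "continuous_on {0..} h" for h :: "real \<Rightarrow> real"
    using Q0 by (intro continuous_on_compose2[OF that Qc]) auto
  have QG: "GDERIV Q x :> q x" if "x \<in> U" for x
    unfolding Q_def W_def q_def using w that by (intro GDERIV_sum_squares) (auto simp: C1_grad_on_def)
  have compG: "C1_grad_on U (\<lambda>x. h (Q x)) (\<lambda>x. h' (Q x) *\<^sub>R q x)"
    if "\<And>t. t \<ge> 0 \<Longrightarrow> (h has_real_derivative h' t) (at t within {0..})" "continuous_on {0..} h'" for h h'
    unfolding C1_grad_on_def
    using that Q0 by (auto intro!: GDERIV_compose_within[OF QG _ U] continuous_intros comp qc)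
  have pw: "\<rho> (Q x) > 0" "?e * \<rho> (Q x) \<le> H' (Q x)" "H' (Q x) \<le> (C0 + 1) * \<rho> (Q x)"
    "\<bar>\<rho>' (Q x)\<bar> * Q x \<le> (C0 + 1) * \<rho> (Q x)" for x
    using H'_bounds[OF Q0[of x]] \<rho>_pos[OF Q0[of x]] by auto
  have qW: "(q x \<bullet> W x)\<^sup>2 \<le> Q x * (norm (q x))\<^sup>2" for x
  proof -
    have "(q x \<bullet> W x)\<^sup>2 \<le> (norm (q x) * norm (W x))\<^sup>2"
      using Cauchy_Schwarz_ineq2[of "q x" "W x"] by (simp add: abs_le_square_iff[symmetric])
    then show ?thesis by (simp add: Q_def power_mult_distrib power2_norm_eq_inner mult.commute)
  qed
  show ?thesis
  proof
    show "open U" by (rule U)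
    show "C1_grad_on U (\<lambda>x. H (Q x)) (\<lambda>x. H' (Q x) *\<^sub>R q x)" by (rule compG[OF H_deriv H'_cont])
    show "0 \<le> H (Q x)" for x by (rule H_nonneg[OF Q0])
    show "continuous_on U (\<lambda>x. (\<rho> (Q x) / 2) *\<^sub>R q x + (\<rho>' (Q x) * (q x \<bullet> W x)) *\<^sub>R W x)"
      by (intro continuous_intros comp \<rho>_cont \<rho>'_cont qc Wc) auto
    show "continuous_on U (\<lambda>x. norm (\<Gamma> x))" by (intro continuous_intros \<Gamma>)
    show "0 \<le> norm (\<Gamma> x)" for x by simp
    show "?e / (C0 + 1) > 0" "(3 / 2 + C0) / ?e \<ge> 0" using e C0 by auto
    show "drift_const CARD('n) C0 \<ge> 0"
      unfolding drift_const_def using e C0 by (intro mult_nonneg_nonneg add_nonneg_nonneg divide_nonneg_nonneg) auto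
  next
    fix x assume x: "x \<in> U"
    let ?r = "\<rho> (Q x)" and ?r' = "\<rho>' (Q x)" and ?h = "H' (Q x)"
    let ?a = "(?r / 2) *\<^sub>R q x + (?r' * (q x \<bullet> W x)) *\<^sub>R W x"
    have h0: "?h > 0" using pw[of x] e by (smt (verit) mult_pos_pos)
    \<comment> \<open>The flux applies to \<open>q\<close> the identity times \<rho>/2 plus \<rho>'
      times the square of the direction \<open>W\<close>. Along \<open>W\<close> its eigenvalue is
      \<rho>/2 + Q \<rho>' = H', across \<open>W\<close> it is \<rho>/2; which is smaller depends on
      the sign of \<rho>'.\<close>
    have "?e * ?r * (norm (q x))\<^sup>2 \<le> ?r / 2 * (norm (q x))\<^sup>2 + ?r' * (q x \<bullet> W x)\<^sup>2"
    proof (cases "?r' < 0")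
      case True
      have "?r' * (Q x * (norm (q x))\<^sup>2) \<le> ?r' * (q x \<bullet> W x)\<^sup>2"
        using qW True by (intro mult_left_mono_neg) auto
      moreover have "?e * ?r * (norm (q x))\<^sup>2 \<le> (1/2 * ?r + Q x * ?r') * (norm (q x))\<^sup>2"
        using pw(2)[of x] H'_eq[OF Q0[of x]] by (intro mult_right_mono) auto
      ultimately show ?thesis by (simp add: algebra_simps)
    next
      case False
      have "?e * ?r * (norm (q x))\<^sup>2 \<le> 1/2 * ?r * (norm (q x))\<^sup>2"
        using e pw(1)[of x] by (intro mult_right_mono) auto
      moreover have "0 \<le> ?r' * (q x \<bullet> W x)\<^sup>2" using False by simp
      ultimately show ?thesis by simp
    qed
    then have "?h * (?e * ?r * (norm (q x))\<^sup>2) \<le> ?h * (?r / 2 * (norm (q x))\<^sup>2 + ?r' * (q x \<bullet> W x)\<^sup>2)"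
      using h0 by (intro mult_left_mono) auto
    also have "\<dots> = ?a \<bullet> (?h *\<^sub>R q x)"
      unfolding power2_norm_eq_inner by (simp add: inner_add_left power2_eq_square inner_commute algebra_simps)
    finally have 1: "?h * (?e * ?r * (norm (q x))\<^sup>2) \<le> ?a \<bullet> (?h *\<^sub>R q x)" .
    have "?e / (C0 + 1) * (norm (?h *\<^sub>R q x))\<^sup>2 = ?e * (?h * (norm (q x))\<^sup>2) * (?h / (C0 + 1))"
      by (simp add: power_mult_distrib power2_eq_square)
    also have "\<dots> \<le> ?e * (?h * (norm (q x))\<^sup>2) * ?r"
      using pw(3)[of x] h0 e C0 by (intro mult_left_mono) (auto simp: divide_le_eq mult.commute)
    also have "\<dots> = ?h * (?e * ?r * (norm (q x))\<^sup>2)" by simp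
    finally show "?e / (C0 + 1) * (norm (?h *\<^sub>R q x))\<^sup>2 \<le> ?a \<bullet> (?h *\<^sub>R q x)" using 1 by linarith
    have "norm ?a \<le> norm ((?r / 2) *\<^sub>R q x) + norm ((?r' * (q x \<bullet> W x)) *\<^sub>R W x)" by (rule norm_triangle_ineq)
    also have "\<dots> \<le> ?r / 2 * norm (q x) + (C0 + 1) * ?r * norm (q x)"
    proof (rule add_mono)
      show "norm ((?r / 2) *\<^sub>R q x) \<le> ?r / 2 * norm (q x)" using pw(1)[of x] by simp
      have "norm ((?r' * (q x \<bullet> W x)) *\<^sub>R W x) = \<bar>?r'\<bar> * (\<bar>q x \<bullet> W x\<bar> * norm (W x))" by (simp add: abs_mult)
      also have "\<dots> \<le> \<bar>?r'\<bar> * ((norm (q x) * norm (W x)) * norm (W x))"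
        by (intro mult_left_mono mult_right_mono Cauchy_Schwarz_ineq2) auto
      also have "\<dots> = \<bar>?r'\<bar> * Q x * norm (q x)" by (simp add: Q_def power2_norm_eq_inner[symmetric] power2_eq_square)
      also have "\<dots> \<le> (C0 + 1) * ?r * norm (q x)" using pw(4)[of x] by (intro mult_right_mono) auto
      finally show "norm ((?r' * (q x \<bullet> W x)) *\<^sub>R W x) \<le> (C0 + 1) * ?r * norm (q x)" .
    qed
    also have "\<dots> = (3 / 2 + C0) * norm (q x) / ?e * (?e * ?r)" using e by (simp add: field_simps)
    also have "\<dots> \<le> (3 / 2 + C0) * norm (q x) / ?e * ?h"
      using pw(2)[of x] e C0 by (intro mult_left_mono) auto
    also have "\<dots> = (3 / 2 + C0) / ?e * norm (?h *\<^sub>R q x)" using h0 by simp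
    finally show "norm ?a \<le> (3 / 2 + C0) / ?e * norm (?h *\<^sub>R q x)" .
  next
    fix K \<phi> z assume \<phi>: "test_fun U K \<phi> z" "\<And>x. 0 \<le> \<phi> x"
    have K: "compact K" "K \<subseteq> U" "C1_grad_on UNIV \<phi> z" "\<And>x. x \<notin> K \<Longrightarrow> \<phi> x = 0" "\<And>x. x \<notin> K \<Longrightarrow> z x = 0"
      using \<phi> test_fun_grad_zero[OF \<phi>(1)] by (auto simp: test_fun_def)
    define a where "a x = (\<rho> (Q x) / 2) *\<^sub>R q x + (\<rho>' (Q x) * (q x \<bullet> W x)) *\<^sub>R W x" for x
    define dV where "dV i x = \<rho> (Q x) *\<^sub>R dw i x + w i x *\<^sub>R (\<rho>' (Q x) *\<^sub>R q x)" for i x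
    have V: "C1_grad_on U (\<lambda>x. \<rho> (Q x) * w i x) (dV i)" for i
      unfolding dV_def by (rule C1_grad_on_mult[OF compG[OF \<rho>_deriv \<rho>'_cont] w])
    define dT where "dT k x = w k x *\<^sub>R z x + \<phi> x *\<^sub>R dw k x" for k x
    have T: "test_fun U K (\<lambda>x. w k x * \<phi> x) (dT k)" for k
      unfolding dT_def by (rule test_fun_mult[OF U w \<phi>(1)])
    have swap: "(LINT x|lborel. dV i x $ k * dT k x $ i) = (LINT x|lborel. dV i x $ i * dT k x $ k)" for i k
      using integral_swap_partial_derivs[OF U V T, of "axis k 1" "axis i 1" i k] by (simp add: inner_axis norm_axis_1)
    have onK: "continuous_on K f" if "continuous_on U f" for f :: "real^'n \<Rightarrow> real"
      using that K(2) by (rule continuous_on_subset)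
    have cK: "continuous_on K \<phi>" "continuous_on K z" "continuous_on K (w i)" "continuous_on K (dw i)"
      "continuous_on K (dV i)" "continuous_on K (dT i)" "continuous_on K a" for i
    proof -
      show 1: "continuous_on K \<phi>" "continuous_on K z" 
        using K(3) C1_grad_on_continuous[OF K(3)] continuous_on_subset[OF _ subset_UNIV] by (auto simp: C1_grad_on_def)
      show 2: "continuous_on K (w i)" "continuous_on K (dw i)" by (intro continuous_on_subset[OF _ K(2)] wc)+
      show "continuous_on K (dV i)" using V[of i] continuous_on_subset[OF _ K(2)] by (auto simp: C1_grad_on_def)
      show "continuous_on K (dT i)" unfolding dT_def by (intro continuous_intros 1 2)
      show "continuous_on K a" unfolding a_def
        by (intro continuous_on_subset[OF _ K(2)] continuous_intros comp \<rho>_cont \<rho>'_cont qc Wc) auto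
    qed
    have dTz: "dT k x = 0" if "x \<notin> K" for k x using K(4,5)[OF that] by (simp add: dT_def)
    note ii = integrable_compact_support[OF K(1)]
    have i: "integrable lborel (\<lambda>x. dV i x $ k * dT j x $ l)" for i j k l
      by (intro ii continuous_intros continuous_on_component cK) (simp add: dTz)
    define T1 where "T1 x = (\<Sum>i\<in>UNIV. \<Sum>k\<in>UNIV. dV i x $ k * dT k x $ i)" for x
    define T2 where "T2 x = (\<Sum>i\<in>UNIV. \<Sum>k\<in>UNIV. dV i x $ i * dT k x $ k)" for x
    define R where "R x = (norm (\<Gamma> x))\<^sup>2 * H (Q x) * \<phi> x + norm (\<Gamma> x) * H (Q x) * norm (z x)" for x
    have T12: "integrable lborel T1" "integrable lborel T2" "(LINT x|lborel. T1 x) = (LINT x|lborel. T2 x)"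
      unfolding T1_def T2_def using i swap by simp_all
    have iR: "integrable lborel R"
    proof (rule ii)
      show "continuous_on K R" unfolding R_def
        by (intro continuous_intros cK onK comp H_cont \<Gamma> continuous_on_subset[OF \<Gamma> K(2)])
    qed (simp add: R_def K)
    have ia: "integrable lborel (\<lambda>x. a x \<bullet> z x)" by (intro ii continuous_intros cK) (simp add: K)
    have le: "a x \<bullet> z x \<le> T1 x - T2 x + drift_const CARD('n) C0 * R x" for x
    proof (cases "x \<in> K")
      case False
      then show ?thesis by (simp add: T1_def T2_def R_def K dTz)
    next
      case True
      then have x: "x \<in> U" using K(2) by auto
      let ?r = "\<rho> (Q x)" and ?r' = "\<rho>' (Q x)"
      define A where "A = (2 + 4 * (C0 + 1) + real CARD('n))\<^sup>2 / (8 * ?e)"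
      have A: "A \<ge> 0" using e by (simp add: A_def)
      have "?r / 2 * (q x \<bullet> z x) + ?r' * (q x \<bullet> W x) * (W x \<bullet> z x) \<le>
        (\<Sum>i\<in>UNIV. \<Sum>k\<in>UNIV. (?r * dw i x $ k + ?r' * W x $ i * q x $ k) * (W x $ k * z x $ i + \<phi> x * dw k x $ i)) +
        ?r * (\<Gamma> x \<bullet> W x) * ((W x \<bullet> z x) + \<phi> x * (\<Sum>k\<in>UNIV. dw k x $ k)) +
        ?r * (W x \<bullet> W x) * ((2 + 4 * (C0 + 1) + real CARD('n))\<^sup>2 / (4 * (2 * ?e)) * (norm (\<Gamma> x))\<^sup>2 * \<phi> x + 3 * norm (\<Gamma> x) * norm (z x))"
      proof (rule bochner_estimate)
        show "dw j x $ i - dw i x $ j = \<Gamma> x $ i * W x $ j - \<Gamma> x $ j * W x $ i" for i j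
          using curl[OF x] by (simp add: W_def)
        show "q x = (\<Sum>j\<in>UNIV. (2 * W x $ j) *\<^sub>R dw j x)" by (simp add: q_def W_def)
        show "\<bar>?r'\<bar> * (W x \<bullet> W x) \<le> (C0 + 1) * ?r" using pw(4)[of x] by (simp add: Q_def)
        show "2 * ?e * ?r \<le> ?r + 2 * ?r' * (W x \<bullet> W x)"
          using pw(2)[of x] H'_eq[OF Q0[of x]] by (simp add: Q_def algebra_simps)
      qed (use pw \<phi> e in auto)
      also have "(\<Sum>i\<in>UNIV. \<Sum>k\<in>UNIV. (?r * dw i x $ k + ?r' * W x $ i * q x $ k) * (W x $ k * z x $ i + \<phi> x * dw k x $ i)) = T1 x"
        by (simp add: T1_def dV_def dT_def W_def mult_ac)
      also have "?r * (\<Gamma> x \<bullet> W x) * ((W x \<bullet> z x) + \<phi> x * (\<Sum>k\<in>UNIV. dw k x $ k)) = - T2 x"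
      proof -
        have "T2 x = (\<Sum>i\<in>UNIV. dV i x $ i) * (\<Sum>k\<in>UNIV. dT k x $ k)" unfolding T2_def by (simp add: sum_product)
        also have "(\<Sum>i\<in>UNIV. dV i x $ i) = - ?r * (\<Gamma> x \<bullet> W x)"
          using div[OF x] by (simp add: dV_def mult_ac)
        also have "(\<Sum>k\<in>UNIV. dT k x $ k) = (W x \<bullet> z x) + \<phi> x * (\<Sum>k\<in>UNIV. dw k x $ k)"
          by (simp add: dT_def W_def inner_vec_def sum.distrib sum_distrib_left)
        finally show ?thesis by simp
      qed
      also have "?r * (W x \<bullet> W x) * ((2 + 4 * (C0 + 1) + real CARD('n))\<^sup>2 / (4 * (2 * ?e)) * (norm (\<Gamma> x))\<^sup>2 * \<phi> x + 3 * norm (\<Gamma> x) * norm (z x)) =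
          (Q x * ?r) * (A * ((norm (\<Gamma> x))\<^sup>2 * \<phi> x) + 3 * (norm (\<Gamma> x) * norm (z x)))"
        by (simp add: A_def Q_def)
      also have "\<dots> \<le> ((1 + 1 / (2 * ?e)) * H (Q x)) * ((A + 3) * ((norm (\<Gamma> x))\<^sup>2 * \<phi> x + norm (\<Gamma> x) * norm (z x)))"
      proof (rule mult_mono)
        show "Q x * ?r \<le> (1 + 1 / (2 * ?e)) * H (Q x)" by (rule flux_le_H[OF Q0])
        have "A * ((norm (\<Gamma> x))\<^sup>2 * \<phi> x) \<le> (A + 3) * ((norm (\<Gamma> x))\<^sup>2 * \<phi> x)"
          "3 * (norm (\<Gamma> x) * norm (z x)) \<le> (A + 3) * (norm (\<Gamma> x) * norm (z x))"
          using A \<phi>(2)[of x] by (intro mult_right_mono; simp)+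
        then show "A * ((norm (\<Gamma> x))\<^sup>2 * \<phi> x) + 3 * (norm (\<Gamma> x) * norm (z x)) \<le> (A + 3) * ((norm (\<Gamma> x))\<^sup>2 * \<phi> x + norm (\<Gamma> x) * norm (z x))"
          by (simp add: distrib_left)
        show "0 \<le> (1 + 1 / (2 * ?e)) * H (Q x)" using H_nonneg[OF Q0[of x]] e by simp
        show "0 \<le> A * ((norm (\<Gamma> x))\<^sup>2 * \<phi> x) + 3 * (norm (\<Gamma> x) * norm (z x))" using A \<phi>(2)[of x] by simp
      qed
      also have "\<dots> = drift_const CARD('n) C0 * R x" 
      proof -
        have "(c * h) * (B * (x * f + y * v)) = c * B * (x * h * f + y * h * v)" for c h B x f y v :: real
          by (simp add: algebra_simps)
        then show ?thesis unfolding drift_const_def A_def[symmetric] R_def .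
      qed
      finally have main: "?r / 2 * (q x \<bullet> z x) + ?r' * (q x \<bullet> W x) * (W x \<bullet> z x) \<le> T1 x + - T2 x + drift_const CARD('n) C0 * R x"
        by simp
      have "a x \<bullet> z x = ?r / 2 * (q x \<bullet> z x) + ?r' * (q x \<bullet> W x) * (W x \<bullet> z x)"
        by (simp add: a_def inner_add_left)
      then show ?thesis using main by simp
    qed
    have "(LINT x|lborel. a x \<bullet> z x) \<le> (LINT x|lborel. T1 x - T2 x + drift_const CARD('n) C0 * R x)"
      using ia T12 iR by (intro integral_mono le) auto
    also have "\<dots> = drift_const CARD('n) C0 * (LINT x|lborel. R x)" using T12 iR by simp
    finally show "(LINT x|lborel. ((\<rho> (Q x) / 2) *\<^sub>R q x + (\<rho>' (Q x) * (q x \<bullet> W x)) *\<^sub>R W x) \<bullet> z x) \<le>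
      drift_const CARD('n) C0 * (LINT x|lborel. (norm (\<Gamma> x))\<^sup>2 * H (Q x) * \<phi> x + norm (\<Gamma> x) * H (Q x) * norm (z x))"
      by (simp add: a_def R_def)
  qed
qed

end

section \<open>Forms in coordinates\<close>

lemma shuffle_sign_sq: "shuffle_sign I J * shuffle_sign I J = 1"
  by (simp add: shuffle_sign_def power_mult_distrib[symmetric])

lemma shuffle_sign_empty: "shuffle_sign I {} = 1"
  by (simp add: shuffle_sign_def)

lemma shuffle_sign_singletons: "shuffle_sign {i} {j} = (if j < i then -1 else 1)"
proof -
  have "{(a, b). a \<in> {i} \<and> b \<in> {j} \<and> b < a} = (if j < i then {(i, j)} else {})" by auto
  then show ?thesis by (simp add: shuffle_sign_def)
qed

lemma hodge_star_empty: "hodge_star \<alpha> $ {} = \<alpha> $ UNIV"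
  by (simp add: hodge_star_def shuffle_sign_empty)

text \<open>The same shuffle sign arises once from the wedge product and once from the star, and its
  square is 1.\<close>

lemma form_inner_eq_sum: "form_inner \<alpha> \<beta> = (\<Sum>I\<in>UNIV. \<alpha> $ I * \<beta> $ I)"
proof -
  have "form_inner \<alpha> \<beta> = (\<Sum>I\<in>UNIV. shuffle_sign I (UNIV - I) * \<alpha> $ I * (shuffle_sign (- (UNIV - I)) (UNIV - I) * \<beta> $ (- (UNIV - I))))"
    by (simp add: form_inner_def hodge_star_empty wedge_def hodge_star_def shuffle_sign_empty)
  also have "\<dots> = (\<Sum>I\<in>UNIV. \<alpha> $ I * \<beta> $ I)"
  proof (intro sum.cong refl)
    fix I :: "'a set"
    have "- (UNIV - I) = I" by auto
    then have "shuffle_sign I (UNIV - I) * \<alpha> $ I * (shuffle_sign (- (UNIV - I)) (UNIV - I) * \<beta> $ (- (UNIV - I))) =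
        (shuffle_sign I (UNIV - I) * shuffle_sign I (UNIV - I)) * (\<alpha> $ I * \<beta> $ I)" by (simp only: mult_ac)
    then show "shuffle_sign I (UNIV - I) * \<alpha> $ I * (shuffle_sign (- (UNIV - I)) (UNIV - I) * \<beta> $ (- (UNIV - I))) = \<alpha> $ I * \<beta> $ I"
      by (simp only: shuffle_sign_sq mult_1_left)
  qed
  finally show ?thesis .
qed

lemma form_inner_one_form:
  fixes \<alpha> :: "'n::{finite,linorder} covec"
  assumes "\<And>I. card I \<noteq> 1 \<Longrightarrow> \<alpha> $ I = 0"
  shows "form_inner \<alpha> \<beta> = (\<Sum>i\<in>UNIV. \<alpha> $ {i} * \<beta> $ {i})"
proof -
  have "form_inner \<alpha> \<beta> = (\<Sum>I\<in>range (\<lambda>i. {i}). \<alpha> $ I * \<beta> $ I)"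
    unfolding form_inner_eq_sum
    by (rule sum.mono_neutral_right) (use assms card_1_singletonE in \<open>auto, metis rangeI\<close>)
  also have "\<dots> = (\<Sum>i\<in>UNIV. \<alpha> $ {i} * \<beta> $ {i})"
    by (subst sum.reindex) (auto simp: inj_on_def)
  finally show ?thesis .
qed

lemma form_norm_sq: "(form_norm \<alpha>)\<^sup>2 = form_inner \<alpha> \<alpha>"
proof -
  have "form_inner \<alpha> \<alpha> \<ge> 0" unfolding form_inner_eq_sum by (intro sum_nonneg) simp
  then show ?thesis by (simp add: form_norm_def)
qed

lemma wedge_axis: "(axis {i} 1 \<and>\<^sub>e \<beta>) $ K = (if i \<in> K then shuffle_sign {i} (K - {i}) * \<beta> $ (K - {i}) else 0)"
proof -
  have "(axis {i} 1 \<and>\<^sub>e \<beta>) $ K = (\<Sum>I\<in>Pow K. if I = {i} then shuffle_sign {i} (K - {i}) * \<beta> $ (K - {i}) else 0)"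
    unfolding wedge_def axis_def vec_lambda_beta by (intro sum.cong refl) auto
  also have "\<dots> = (if i \<in> K then shuffle_sign {i} (K - {i}) * \<beta> $ (K - {i}) else 0)"
    by (subst sum.delta) auto
  finally show ?thesis .
qed

lemma ext_deriv_component:
  "ext_deriv \<alpha> x $ K = (\<Sum>i\<in>K. shuffle_sign {i} (K - {i}) * partial_deriv i \<alpha> x $ (K - {i}))"
proof -
  have "ext_deriv \<alpha> x $ K = (\<Sum>i\<in>UNIV. if i \<in> K then shuffle_sign {i} (K - {i}) * partial_deriv i \<alpha> x $ (K - {i}) else 0)"
    by (simp add: ext_deriv_def wedge_axis)
  then show ?thesis by (simp add: sum.If_cases)
qed

text \<open>Compare the coefficients at \<open>{i, j}\<close> for i < j; the wedge of two 1-forms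
  receives contributions from the two singletons only. The remaining cases follow by
  antisymmetry.\<close>

lemma curl_equation:
  fixes \<omega> :: "'n::{finite,linorder} form"
  assumes eq: "ext_deriv \<omega> x = \<gamma> \<and>\<^sub>e \<omega> x" and one: "\<And>I. card I \<noteq> 1 \<Longrightarrow> \<gamma> $ I = 0" "\<And>I. card I \<noteq> 1 \<Longrightarrow> \<omega> x $ I = 0"
  shows "partial_deriv i \<omega> x $ {j} - partial_deriv j \<omega> x $ {i} = \<gamma> $ {i} * \<omega> x $ {j} - \<gamma> $ {j} * \<omega> x $ {i}"
proof -
  have less: "partial_deriv i \<omega> x $ {j} - partial_deriv j \<omega> x $ {i} = \<gamma> $ {i} * \<omega> x $ {j} - \<gamma> $ {j} * \<omega> x $ {i}"
    if ij: "i < j" for i j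
  proof -
    have s: "{i, j} - {i} = {j}" "{i, j} - {j} = {i}" "i \<noteq> j" "\<not> j < i" using ij by auto
    have "ext_deriv \<omega> x $ {i, j} = partial_deriv i \<omega> x $ {j} - partial_deriv j \<omega> x $ {i}"
      unfolding ext_deriv_component using s ij by (simp add: shuffle_sign_singletons)
    moreover have "(\<gamma> \<and>\<^sub>e \<omega> x) $ {i, j} = \<gamma> $ {i} * \<omega> x $ {j} - \<gamma> $ {j} * \<omega> x $ {i}"
    proof -
      have P: "Pow {i, j} = {{}, {i}, {j}, {i, j}}" by auto
      have d: "{} \<noteq> {i}" "{} \<noteq> {j}" "{} \<noteq> {i, j}" "{i} \<noteq> {j}" "{i} \<noteq> {i, j}" "{j} \<noteq> {i, j}" using s by auto
      have "\<gamma> $ {} = 0" "\<omega> x $ {} = 0" using one by auto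
      then show ?thesis
        unfolding wedge_def using s d ij by (simp add: P shuffle_sign_singletons)
    qed
    ultimately show ?thesis using eq by simp
  qed
  consider "i < j" | "j < i" | "i = j" by fastforce
  then show ?thesis
  proof cases
    case 2
    from less[OF 2] show ?thesis by simp
  qed (use less in auto)
qed

lemma linear_hodge_star: "linear (hodge_star :: 'n::{finite,linorder} covec \<Rightarrow> 'n covec)"
  by (rule linearI) (simp_all add: hodge_star_def vec_eq_iff algebra_simps)

text \<open>For degree 1 the exponent of the sign is 2 n + 1, hence odd. The star is linear and
  commutes with partial derivatives, and its shuffle signs cancel those of the exterior
  derivative.\<close>

lemma codiff_one_form_component:
  fixes \<alpha> :: "'n::{finite,linorder} form"
  assumes "\<alpha> differentiable (at x)"
  shows "codiff 1 \<alpha> x $ {} = - (\<Sum>i\<in>UNIV. partial_deriv i \<alpha> x $ {i})"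
proof -
  have bl: "bounded_linear (hodge_star :: 'n covec \<Rightarrow> 'n covec)"
    using linear_hodge_star by (simp add: linear_conv_bounded_linear)
  have "(\<alpha> has_derivative frechet_derivative \<alpha> (at x)) (at x)" using assms frechet_derivative_works by blast
  then have "((\<lambda>y. hodge_star (\<alpha> y)) has_derivative (\<lambda>h. hodge_star (frechet_derivative \<alpha> (at x) h))) (at x)"
    by (rule bounded_linear.has_derivative[OF bl])
  then have "frechet_derivative (\<lambda>y. hodge_star (\<alpha> y)) (at x) = (\<lambda>h. hodge_star (frechet_derivative \<alpha> (at x) h))"
    by (rule frechet_derivative_at[symmetric])
  then have pd: "partial_deriv i (\<lambda>y. hodge_star (\<alpha> y)) x = hodge_star (partial_deriv i \<alpha> x)" for i
    by (simp add: partial_deriv_def)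
  have "codiff 1 \<alpha> x $ {} = - (\<Sum>i\<in>UNIV. shuffle_sign {i} (UNIV - {i}) * hodge_star (partial_deriv i \<alpha> x) $ (UNIV - {i}))"
    by (simp add: codiff_def hodge_star_empty ext_deriv_component pd)
  also have "(\<Sum>i\<in>UNIV. shuffle_sign {i} (UNIV - {i}) * hodge_star (partial_deriv i \<alpha> x) $ (UNIV - {i})) =
      (\<Sum>i\<in>UNIV. partial_deriv i \<alpha> x $ {i})"
  proof (intro sum.cong refl)
    fix i :: 'n
    have "- (UNIV - {i}) = {i}" by auto
    then have "shuffle_sign {i} (UNIV - {i}) * hodge_star (partial_deriv i \<alpha> x) $ (UNIV - {i}) =
       (shuffle_sign {i} (UNIV - {i}) * shuffle_sign {i} (UNIV - {i})) * partial_deriv i \<alpha> x $ {i}"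
      by (simp add: hodge_star_def)
    then show "shuffle_sign {i} (UNIV - {i}) * hodge_star (partial_deriv i \<alpha> x) $ (UNIV - {i}) = partial_deriv i \<alpha> x $ {i}"
      by (simp only: shuffle_sign_sq mult_1_left)
  qed
  finally show ?thesis .
qed

section \<open>From smooth forms to scalar gradients\<close>

lemma GDERIV_vec_nth:
  fixes f :: "real^'n::finite \<Rightarrow> real^'m::finite"
  assumes "f differentiable (at x)"
  shows "GDERIV (\<lambda>y. f y $ I) x :> (\<chi> k. frechet_derivative f (at x) (axis k 1) $ I)"
proof -
  let ?D = "frechet_derivative f (at x)"
  have D: "(f has_derivative ?D) (at x)" using assms frechet_derivative_works by blast
  have lin: "linear ?D" using D has_derivative_linear by blast
  have "?D h $ I = h \<bullet> (\<chi> k. ?D (axis k 1) $ I)" for h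
  proof -
    have "?D h = ?D (\<Sum>k\<in>UNIV. (h $ k) *\<^sub>R axis k 1)"
      using basis_expansion[of h] by (simp add: scalar_mult_eq_scaleR)
    also have "\<dots> = (\<Sum>k\<in>UNIV. (h $ k) *\<^sub>R ?D (axis k 1))"
      by (simp add: linear_sum[OF lin] linear_scale[OF lin])
    finally show ?thesis by (simp add: inner_vec_def)
  qed
  then have eq: "(\<lambda>h. ?D h $ I) = (\<lambda>h. h \<bullet> (\<chi> k. ?D (axis k 1) $ I))" by (rule ext)
  have "((\<lambda>y. f y $ I) has_derivative (\<lambda>h. ?D h $ I)) (at x)"
    by (rule bounded_linear.has_derivative[OF bounded_linear_vec_nth D])
  then show ?thesis unfolding gderiv_def by (rule has_derivative_eq_rhs[OF _ eq])
qed

lemma smooth_on_component_C1: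
  fixes \<omega> :: "'n::{finite,linorder} form"
  assumes "smooth_on S \<omega>"
  shows "C1_grad_on S (\<lambda>x. \<omega> x $ I) (\<lambda>x. \<chi> k. partial_deriv k \<omega> x $ I)"
    and "x \<in> S \<Longrightarrow> \<omega> differentiable (at x)" and "continuous_on S \<omega>"
proof -
  have "Ck_on (Suc 0) S \<omega>" "Ck_on 0 S \<omega>" using assms by (auto simp only: smooth_on_def)
  then have d: "\<And>x. x \<in> S \<Longrightarrow> \<omega> differentiable (at x)"
    and c: "\<And>v. continuous_on S (\<lambda>x. frechet_derivative \<omega> (at x) v)" and c0: "continuous_on S \<omega>" by auto
  show "C1_grad_on S (\<lambda>x. \<omega> x $ I) (\<lambda>x. \<chi> k. partial_deriv k \<omega> x $ I)"
    unfolding C1_grad_on_def partial_deriv_def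
    using GDERIV_vec_nth[OF d] c by (auto intro!: continuous_intros continuous_on_vec_lambda)
  show "x \<in> S \<Longrightarrow> \<omega> differentiable (at x)" by (rule d)
  show "continuous_on S \<omega>" by (rule c0)
qed

text \<open>Both sides of the second field equation are read at the empty index set, where the
  right-hand side is by definition the inner product of \<Gamma> with \<rho>(Q) \<omega>.\<close>

lemma divergence_equation:
  fixes \<omega> :: "'n::{finite,linorder} form"
  assumes \<omega>: "\<omega> differentiable (at x)" and Q: "GDERIV Q x :> q"
    and \<rho>: "GDERIV (\<lambda>y. \<rho> (Q y)) x :> r' *\<^sub>R q"
    and eq: "codiff 1 (\<lambda>y. \<rho> (Q y) *\<^sub>R \<omega> y) x = hodge_star (\<gamma> \<and>\<^sub>e hodge_star (\<rho> (Q x) *\<^sub>R \<omega> x))"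
    and one: "\<And>I. card I \<noteq> 1 \<Longrightarrow> \<gamma> $ I = 0"
  shows "(\<Sum>i\<in>UNIV. \<rho> (Q x) * partial_deriv i \<omega> x $ {i} + r' * \<omega> x $ {i} * q $ i) =
    - \<rho> (Q x) * (\<Sum>i\<in>UNIV. \<gamma> $ {i} * \<omega> x $ {i})"
proof -
  let ?D = "frechet_derivative \<omega> (at x)"
  have "(\<omega> has_derivative ?D) (at x)" using \<omega> frechet_derivative_works by blast
  then have der: "((\<lambda>y. \<rho> (Q y) *\<^sub>R \<omega> y) has_derivative (\<lambda>h. \<rho> (Q x) *\<^sub>R ?D h + (h \<bullet> (r' *\<^sub>R q)) *\<^sub>R \<omega> x)) (at x)"
    using \<rho> unfolding gderiv_def by (intro has_derivative_scaleR)
  then have fd: "frechet_derivative (\<lambda>y. \<rho> (Q y) *\<^sub>R \<omega> y) (at x) = (\<lambda>h. \<rho> (Q x) *\<^sub>R ?D h + (h \<bullet> (r' *\<^sub>R q)) *\<^sub>R \<omega> x)"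
    by (rule frechet_derivative_at[symmetric])
  have "codiff 1 (\<lambda>y. \<rho> (Q y) *\<^sub>R \<omega> y) x $ {} = - (\<Sum>i\<in>UNIV. partial_deriv i (\<lambda>y. \<rho> (Q y) *\<^sub>R \<omega> y) x $ {i})"
    using der by (intro codiff_one_form_component) (auto simp: differentiable_def)
  also have "(\<Sum>i\<in>UNIV. partial_deriv i (\<lambda>y. \<rho> (Q y) *\<^sub>R \<omega> y) x $ {i}) =
      (\<Sum>i\<in>UNIV. \<rho> (Q x) * partial_deriv i \<omega> x $ {i} + r' * \<omega> x $ {i} * q $ i)"
    unfolding partial_deriv_def fd by (intro sum.cong refl) (simp add: inner_axis' mult_ac)
  finally have "(\<Sum>i\<in>UNIV. \<rho> (Q x) * partial_deriv i \<omega> x $ {i} + r' * \<omega> x $ {i} * q $ i) =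
      - (hodge_star (\<gamma> \<and>\<^sub>e hodge_star (\<rho> (Q x) *\<^sub>R \<omega> x)) $ {})" using eq by simp
  also have "hodge_star (\<gamma> \<and>\<^sub>e hodge_star (\<rho> (Q x) *\<^sub>R \<omega> x)) $ {} = form_inner \<gamma> (\<rho> (Q x) *\<^sub>R \<omega> x)"
    by (simp add: form_inner_def)
  also have "\<dots> = \<rho> (Q x) * (\<Sum>i\<in>UNIV. \<gamma> $ {i} * \<omega> x $ {i})"
    by (subst form_inner_one_form[OF one]) (auto simp: sum_distrib_left mult_ac)
  finally show ?thesis by simp
qed

section \<open>The local bound\<close>

text \<open>Neither \<Omega> nor the growth constants occur. This allows Morrey constants to be
  selected from \<Gamma> and the ball alone.\<close>

definition morrey_on :: "'a::euclidean_space set \<Rightarrow> ('a \<Rightarrow> real) \<Rightarrow> real \<Rightarrow> real \<Rightarrow> bool" where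
  "morrey_on D F M \<kappa> \<longleftrightarrow> M \<ge> 0 \<and> 0 < \<kappa> \<and> \<kappa> \<le> 1 \<and> (\<forall>y s. 0 < s \<longrightarrow> s \<le> 1 \<longrightarrow>
     (\<integral>\<^sup>+x. ennreal (indicator D x * F x) * indicator (ball y s) x \<partial>lborel) \<le>
       ennreal (M * s powr (real DIM('a) - 2 + \<kappa>)))"

text \<open>On a ball of radius s, a number t is at most 1 + t^P with P = n/2; use this for t equal
  to |f| times s to the power 2 - k. The choice k P = \<kappa>0 makes the volume and the growth
  bound contribute the same power n - 2 + k of s. As s is at most 1, k may be lowered to at most
  1.\<close>

lemma morrey_on_growth:
  fixes f F :: "'a::euclidean_space \<Rightarrow> real"
  assumes dim: "DIM('a) > 2" and Lp: "Lp_on (real DIM('a) / 2) \<Omega> f" and \<Omega>: "open \<Omega>" "D \<subseteq> \<Omega>"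
    and pos: "\<kappa>0 > 0" "C1 > 0"
    and grow: "\<And>y r. r > 0 \<Longrightarrow>
      (LINT x:ball y r \<inter> \<Omega>|lebesgue. \<bar>f x\<bar> powr (real DIM('a) / 2)) \<le> C1 * r powr \<kappa>0"
    and F: "\<And>x. x \<in> D - {p} \<Longrightarrow> F x \<le> \<bar>f x\<bar>"
  shows "\<exists>M \<kappa>. morrey_on D F M \<kappa>"
proof -
  let ?n = "real DIM('a)" and ?v = "unit_ball_vol DIM('a)"
  define P where "P = ?n / 2"
  define k where "k = \<kappa>0 / P"
  define \<kappa> where "\<kappa> = min 1 k"
  have P: "P \<ge> 1" using dim by (simp add: P_def)
  have k: "k > 0" "k * P = \<kappa>0" using pos P by (auto simp: k_def)
  have v: "?v > 0" by (rule unit_ball_vol_pos) simp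
  have "(\<integral>\<^sup>+x. ennreal (indicator D x * F x) * indicator (ball y s) x \<partial>lborel) \<le>
      ennreal ((?v + C1) * s powr (?n - 2 + \<kappa>))" if s: "0 < s" "s \<le> 1" for y s
  proof -
    define a where "a = s powr (k - 2)"
    define c where "c = s powr (k - 2 + (?n - \<kappa>0))"
    have ac: "a \<ge> 0" "c \<ge> 0" by (auto simp: a_def c_def)
    define B where "B = ball y s \<inter> \<Omega>"
    have B: "B \<in> sets lebesgue" using \<Omega> by (auto simp: B_def)
    have pt: "F x \<le> a + c * \<bar>f x\<bar> powr P" if "x \<in> D - {p}" for x
    proof -
      define t where "t = \<bar>f x\<bar> * s powr (2 - k)"
      have t: "t \<ge> 0" by (simp add: t_def)
      have "a * s powr (2 - k) = 1" using s by (simp add: a_def powr_add[symmetric])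
      then have "\<bar>f x\<bar> = a * t" by (simp add: t_def mult_ac)
      moreover have "t \<le> 1 + t powr P"
      proof (cases "t \<le> 1")
        case True
        then show ?thesis by (simp add: add_increasing2)
      next
        case False
        then have "t powr 1 \<le> t powr P" using P by (intro powr_mono) auto
        then show ?thesis using False by simp
      qed
      then have "a * t \<le> a * (1 + t powr P)" using ac by (intro mult_left_mono)
      moreover have "a * t powr P = c * \<bar>f x\<bar> powr P"
      proof -
        have "(2 - k) * P = ?n - \<kappa>0" unfolding left_diff_distrib k(2) by (simp add: P_def)
        then have "t powr P = \<bar>f x\<bar> powr P * s powr (?n - \<kappa>0)"
          by (simp add: t_def powr_mult powr_powr)
        then show ?thesis by (simp add: a_def c_def powr_add)
      qed
      ultimately show ?thesis using F[OF that] by (simp add: distrib_left)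
    qed
    \<comment> \<open>Integrability ensures that the integral in the growth condition is genuine and
      not the default value 0.\<close>
    have Bi: "set_integrable lebesgue B (\<lambda>x. \<bar>f x\<bar> powr P)"
      using Lp by (intro set_integrable_subset[OF _ B]) (auto simp: Lp_on_def P_def B_def)
    then have Bi': "integrable lebesgue (\<lambda>x. indicator B x * \<bar>f x\<bar> powr P)" by (simp add: set_integrable_def)
    have m1: "(\<lambda>x. ennreal a * indicator (ball y s) x) \<in> borel_measurable lebesgue"
      by (intro borel_measurable_times_ennreal borel_measurable_indicator borel_measurable_const) auto
    have m2: "(\<lambda>x. ennreal (indicator B x * \<bar>f x\<bar> powr P)) \<in> borel_measurable lebesgue"
      using Bi' by (simp add: borel_measurable_integrable)
    have "AE x in lebesgue. x \<noteq> p"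
      by (rule AE_completion[OF AE_lborel_singleton])
    then have ae: "AE x in lebesgue. ennreal (indicator D x * F x) * indicator (ball y s) x \<le>
        ennreal a * indicator (ball y s) x + ennreal c * ennreal (indicator B x * \<bar>f x\<bar> powr P)"
    proof eventually_elim
      case (elim x)
      show ?case
      proof (cases "x \<in> D \<and> x \<in> ball y s")
        case True
        then have "ennreal (F x) \<le> ennreal (a + c * \<bar>f x\<bar> powr P)" using pt[of x] elim by (intro ennreal_leI) auto
        also have "\<dots> = ennreal a + ennreal c * ennreal (\<bar>f x\<bar> powr P)"
          using ac by (subst ennreal_plus) (auto simp: ennreal_mult)
        finally show ?thesis using True \<Omega>(2) by (auto simp: B_def)
      qed auto
    qed
    \<comment> \<open>The comparison takes place over \<open>lebesgue\<close>, as \<open>f\<close>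
      is only Lebesgue measurable; passing to the completion leaves nonnegative integrals unchanged,
      and the point \<open>p\<close> is a null set.\<close>
    have "(\<integral>\<^sup>+x. ennreal (indicator D x * F x) * indicator (ball y s) x \<partial>lborel) =
        (\<integral>\<^sup>+x. ennreal (indicator D x * F x) * indicator (ball y s) x \<partial>lebesgue)"
      by (rule nn_integral_completion[symmetric])
    also have "\<dots> \<le> (\<integral>\<^sup>+x. ennreal a * indicator (ball y s) x + ennreal c * ennreal (indicator B x * \<bar>f x\<bar> powr P) \<partial>lebesgue)"
      by (rule nn_integral_mono_AE[OF ae])
    also have "\<dots> = (\<integral>\<^sup>+x. ennreal a * indicator (ball y s) x \<partial>lebesgue) +
        ennreal c * (\<integral>\<^sup>+x. ennreal (indicator B x * \<bar>f x\<bar> powr P) \<partial>lebesgue)"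
      unfolding nn_integral_cmult[OF m2, symmetric]
      by (intro nn_integral_add m1 borel_measurable_times_ennreal m2 borel_measurable_const)
    also have "(\<integral>\<^sup>+x. ennreal a * indicator (ball y s) x \<partial>lebesgue) = ennreal (a * (?v * s ^ DIM('a)))"
      using s ac by (simp add: nn_integral_completion nn_integral_cmult_indicator emeasure_ball ennreal_mult'[symmetric])
    also have "(\<integral>\<^sup>+x. ennreal (indicator B x * \<bar>f x\<bar> powr P) \<partial>lebesgue) = ennreal (LINT x:B|lebesgue. \<bar>f x\<bar> powr P)"
      using nn_integral_eq_integral[OF Bi'] by (simp add: set_lebesgue_integral_def)
    also have "ennreal (a * (?v * s ^ DIM('a))) + ennreal c * ennreal (LINT x:B|lebesgue. \<bar>f x\<bar> powr P) \<le>
        ennreal (a * (?v * s ^ DIM('a))) + ennreal c * ennreal (C1 * s powr \<kappa>0)"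
      using grow[OF s(1), of y] by (intro add_left_mono mult_left_mono ennreal_leI) (auto simp: B_def P_def)
    also have "\<dots> = ennreal (a * (?v * s ^ DIM('a)) + c * (C1 * s powr \<kappa>0))"
      using ac v s pos by (subst ennreal_plus) (auto simp: ennreal_mult'[symmetric])
    also have "\<dots> \<le> ennreal ((?v + C1) * s powr (?n - 2 + \<kappa>))"
    proof (rule ennreal_leI)
      have "a * s ^ DIM('a) = s powr (?n - 2 + k)"
        using s by (simp add: a_def powr_realpow[symmetric] powr_add[symmetric] algebra_simps)
      moreover have "c * s powr \<kappa>0 = s powr (?n - 2 + k)"
        using s by (simp add: c_def powr_add[symmetric] algebra_simps)
      moreover have "a * (?v * s ^ DIM('a)) + c * (C1 * s powr \<kappa>0) = ?v * (a * s ^ DIM('a)) + C1 * (c * s powr \<kappa>0)"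
        by (simp only: mult_ac)
      ultimately have "a * (?v * s ^ DIM('a)) + c * (C1 * s powr \<kappa>0) = (?v + C1) * s powr (?n - 2 + k)"
        by (simp only: distrib_right)
      also have "\<dots> \<le> (?v + C1) * s powr (?n - 2 + \<kappa>)"
        using s v pos by (intro mult_left_mono powr_mono') (auto simp: \<kappa>_def)
      finally show "a * (?v * s ^ DIM('a)) + c * (C1 * s powr \<kappa>0) \<le> (?v + C1) * s powr (?n - 2 + \<kappa>)" .
    qed
    finally show ?thesis .
  qed
  then have "morrey_on D F (?v + C1) \<kappa>" using v pos k by (simp add: morrey_on_def \<kappa>_def)
  then show ?thesis by blast
qed

text \<open>The first factor is that of \<open>flux_le_H\<close>; the root appears because
  \<open>sup_bound\<close> estimates the square of H.\<close>

definition solution_const :: "real \<Rightarrow> real \<Rightarrow> real \<Rightarrow> real \<Rightarrow> real \<Rightarrow> real" where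
  "solution_const n C0 M \<kappa> d = (1 + 1 / (2 * ellipticity C0)) *
     sqrt (moser_const n (ellipticity C0 / (C0 + 1)) ((3 / 2 + C0) / ellipticity C0) (drift_const n C0) M \<kappa> d)"

lemma solution_const_pos: "C0 > 0 \<Longrightarrow> solution_const n C0 M \<kappa> d > 0"
proof -
  assume C0: "C0 > 0"
  then have "1 + 1 / (2 * ellipticity C0) > 0" by (simp add: ellipticity_def add_pos_nonneg)
  moreover have "moser_base n \<theta> \<Lambda> C M \<kappa> d > 0" for \<theta> \<Lambda> C
    unfolding moser_base_def by (intro mult_pos_pos) auto
  then have "moser_const n \<theta> \<Lambda> C M \<kappa> d > 0" for \<theta> \<Lambda> C
    unfolding moser_const_def using less_imp_neq[of 0 "moser_base n \<theta> \<Lambda> C M \<kappa> d"] by simp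
  ultimately show ?thesis unfolding solution_const_def by simp
qed

text \<open>The forms are translated into coordinates on the punctured ball, where H(Q) becomes a
  punctured subsolution. Its drift is the length of \<Gamma>, so the Morrey condition on the
  coefficients of \<Gamma> is the one required.\<close>

lemma (in density) solution_bound:
  fixes \<Gamma> \<omega> :: "'n::{finite,linorder} form"
  assumes dim: "CARD('n) > 2" and \<Omega>: "open \<Omega>" "ball x0 (R + a0) \<subseteq> \<Omega>" and R: "R > 0" "a0 > 0"
    and forms: "form_on 1 (\<Omega> - {p}) \<Gamma>" "form_on 1 (\<Omega> - {p}) \<omega>"
    and smooth: "smooth_on (\<Omega> - {p}) \<Gamma>" "smooth_on (\<Omega> - {p}) \<omega>"
    and Q: "Q = (\<lambda>x. (form_norm (\<omega> x))\<^sup>2)"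
    and closed: "\<And>x. x \<in> \<Omega> - {p} \<Longrightarrow> ext_deriv \<omega> x = \<Gamma> x \<and>\<^sub>e \<omega> x"
    and coclosed: "\<And>x. x \<in> \<Omega> - {p} \<Longrightarrow>
      codiff 1 (\<lambda>y. \<rho> (Q y) *\<^sub>R \<omega> y) x = hodge_star (\<Gamma> x \<and>\<^sub>e hodge_star (\<rho> (Q x) *\<^sub>R \<omega> x))"
    and Lp: "Lp_on (2 * real CARD('n) / (real CARD('n) - 2)) \<Omega> (\<lambda>x. H (Q x))"
    and morrey: "morrey_on (ball x0 (R + a0)) (\<lambda>x. \<Sum>i\<in>UNIV. (\<Gamma> x $ {i})\<^sup>2) M \<kappa>"
    and x: "x \<in> ball x0 R - {p}"
  shows "Q x * \<rho> (Q x) \<le> solution_const CARD('n) C0 M \<kappa> a0 * Lp_norm 2 (ball x0 (R + a0)) (\<lambda>x. H (Q x))"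
proof -
  let ?D = "ball x0 (R + a0)"
  define S where "S = \<Omega> - {p}"
  define U where "U = ?D - {p}"
  have U: "open U" "U \<subseteq> S" "U \<subseteq> ?D" using \<Omega> by (auto simp: U_def S_def open_Diff)
  have S: "open S" using \<Omega> by (auto simp: S_def open_Diff)
  define w where "w i x = \<omega> x $ {i}" for i x
  define dw where "dw i x = (\<chi> k. partial_deriv k \<omega> x $ {i})" for i x
  define G where "G x = (\<chi> i. \<Gamma> x $ {i})" for x
  define W where "W x = (\<chi> i. w i x)" for x
  \<comment> \<open>The coordinate version of \<open>Q\<close>. The two agree off \<open>p\<close>;
    at \<open>p\<close> itself \<omega> need not be a 1-form.\<close>
  define Q' where "Q' x = W x \<bullet> W x" for x
  define q where "q x = (\<Sum>j\<in>UNIV. (2 * w j x) *\<^sub>R dw j x)" for x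
  have one: "card I \<noteq> 1 \<Longrightarrow> \<Gamma> x $ I = 0" "card I \<noteq> 1 \<Longrightarrow> \<omega> x $ I = 0" if "x \<in> S" for x I
    using forms that by (auto simp: form_on_def S_def)
  have w: "C1_grad_on S (w i) (dw i)" for i
    unfolding w_def dw_def using smooth_on_component_C1(1)[OF smooth(2)] by (simp add: S_def)
  have Gc: "continuous_on S G"
    unfolding G_def using smooth_on_component_C1(3)[OF smooth(1)]
    by (auto simp: S_def intro!: continuous_intros continuous_on_vec_lambda)
  have QQ: "Q x = Q' x" if "x \<in> S" for x
    using one(2)[OF that] unfolding Q form_norm_sq
    by (subst form_inner_one_form) (auto simp: Q'_def W_def w_def inner_vec_def)
  have Q'G: "GDERIV Q' x :> q x" if "x \<in> S" for x
    unfolding Q'_def W_def q_def using w that by (intro GDERIV_sum_squares) (auto simp: C1_grad_on_def)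
  have QG: "GDERIV Q x :> q x" if "x \<in> S" for x
    using has_derivative_transform_within_open[OF Q'G[OF that, unfolded gderiv_def] S that, of Q] QQ
    unfolding gderiv_def by simp
  have wsub: "weak_subsolution U (\<lambda>x. H (Q' x)) (\<lambda>x. H' (Q' x) *\<^sub>R q x)
    (\<lambda>x. (\<rho> (Q' x) / 2) *\<^sub>R q x + (\<rho>' (Q' x) * (q x \<bullet> W x)) *\<^sub>R W x) (\<lambda>x. norm (G x))
    (ellipticity C0 / (C0 + 1)) ((3 / 2 + C0) / ellipticity C0) (drift_const CARD('n) C0)"
    unfolding Q'_def W_def q_def
  proof (rule weak_subsolution_H[OF U(1)])
    show "C1_grad_on U (w i) (dw i)" for i using C1_grad_on_subset[OF w U(2)] .
    show "continuous_on U G" using continuous_on_subset[OF Gc U(2)] .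
    fix x assume "x \<in> U"
    then have xS: "x \<in> S" using U(2) by auto
    then have xo: "x \<in> \<Omega> - {p}" by (simp add: S_def)
    show "dw j x $ i - dw i x $ j = G x $ i * w j x - G x $ j * w i x" for i j
      using curl_equation[OF closed[OF xo] one(1)[OF xS] one(2)[OF xS], of i j] by (simp add: dw_def G_def w_def)
    have "GDERIV (\<lambda>y. \<rho> (Q y)) x :> \<rho>' (Q x) *\<^sub>R q x"
      by (rule GDERIV_compose_within[OF QG[OF xS] \<rho>_deriv S xS]) (auto simp: Q)
    from divergence_equation[OF smooth_on_component_C1(2)[OF smooth(2) xo] QG[OF xS] this coclosed[OF xo] one(1)[OF xS]]
    have "(\<Sum>i\<in>UNIV. \<rho> (Q' x) * dw i x $ i + \<rho>' (Q' x) * w i x * q x $ i) = - \<rho> (Q' x) * (G x \<bullet> W x)"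
      by (simp add: QQ[OF xS] dw_def w_def G_def W_def inner_vec_def)
    then show "(\<Sum>i\<in>UNIV. \<rho> ((\<chi> i. w i x) \<bullet> (\<chi> i. w i x)) * dw i x $ i +
        \<rho>' ((\<chi> i. w i x) \<bullet> (\<chi> i. w i x)) * w i x * (\<Sum>j\<in>UNIV. (2 * w j x) *\<^sub>R dw j x) $ i) =
      - \<rho> ((\<chi> i. w i x) \<bullet> (\<chi> i. w i x)) * (G x \<bullet> (\<chi> i. w i x))"
      by (simp only: Q'_def W_def q_def)
  qed
  have Hn: "0 \<le> H (Q x)" "0 \<le> H (Q' x)" for x by (auto intro!: H_nonneg simp: Q Q'_def)
  define e where "e = 2 * real CARD('n) / (real CARD('n) - 2)"
  have e2: "e \<ge> 2" using dim by (simp add: e_def field_simps)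
  define hq where "hq x = indicator \<Omega> x *\<^sub>R \<bar>H (Q x)\<bar> powr e" for x
  have hqi: "integrable lebesgue hq" using Lp by (simp add: hq_def[abs_def] Lp_on_def set_integrable_def e_def)
  have hq0: "0 \<le> hq x" for x by (simp add: hq_def)
  define h2 where "h2 x = indicator ?D x *\<^sub>R \<bar>H (Q x)\<bar> powr 2" for x
  have h20: "0 \<le> h2 x" for x by (simp add: h2_def)
  \<comment> \<open>The ball has finite measure and the given exponent is at least 2, so t^2 at most
    1 + t^e gives square integrability. Without it the norm in the conclusion could be a default
    value.\<close>
  have h2i: "integrable lebesgue h2"
  proof (rule Bochner_Integration.integrable_bound)
    have "integrable lebesgue (indicator ?D :: _ \<Rightarrow> real)"
      using R by (intro integrable_real_indicator) (auto simp: emeasure_ball)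
    then show "integrable lebesgue (\<lambda>x. indicator ?D x + hq x)" using hqi by (intro Bochner_Integration.integrable_add)
    have m: "(\<lambda>x. indicator \<Omega> x *\<^sub>R H (Q x)) \<in> borel_measurable lebesgue"
      using Lp by (simp add: Lp_on_def set_borel_measurable_def)
    have "(\<lambda>x. indicator ?D x *\<^sub>R \<bar>indicator \<Omega> x *\<^sub>R H (Q x)\<bar> powr 2) \<in> borel_measurable lebesgue"
    proof (intro borel_measurable_scaleR borel_measurable_indicator)
      show "(\<lambda>x. \<bar>indicator \<Omega> x *\<^sub>R H (Q x)\<bar> powr 2) \<in> borel_measurable lebesgue"
        using m by (intro powr_real_measurable borel_measurable_abs) auto
    qed auto
    also have "(\<lambda>x. indicator ?D x *\<^sub>R \<bar>indicator \<Omega> x *\<^sub>R H (Q x)\<bar> powr 2) = h2"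
      using \<Omega>(2) by (intro ext) (auto simp: h2_def indicator_def)
    finally show "h2 \<in> borel_measurable lebesgue" .
    show "AE x in lebesgue. norm (h2 x) \<le> norm (indicator ?D x + hq x)"
    proof (rule AE_I2)
      fix x
      show "norm (h2 x) \<le> norm (indicator ?D x + hq x)"
      proof (cases "x \<in> ?D")
        case True
        then have "x \<in> \<Omega>" using \<Omega>(2) by auto
        have "H (Q x) powr 2 \<le> 1 + H (Q x) powr e"
        proof (cases "H (Q x) \<le> 1")
          case True
          then have "H (Q x) powr 2 \<le> 1" using Hn by (intro powr_le1) auto
          then show ?thesis by (simp add: add_increasing2)
        next
          case False
          then have "H (Q x) powr 2 \<le> H (Q x) powr e" using e2 by (intro powr_mono) auto
          then show ?thesis by linarith
        qed
        then show ?thesis using True \<open>x \<in> \<Omega>\<close> Hn(1)[of x] by (simp add: h2_def hq_def)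
      qed (simp add: h2_def)
    qed
  qed
  define J where "J = (LINT x:?D|lebesgue. \<bar>H (Q x)\<bar> powr 2)"
  have J: "J = (LINT x|lebesgue. h2 x)" by (simp add: J_def h2_def[abs_def] set_lebesgue_integral_def)
  have J0: "J \<ge> 0" unfolding J using h20 by (intro integral_nonneg_AE) auto
  interpret punctured_subsolution x0 p "R + a0" "\<lambda>x. H (Q' x)" "\<lambda>x. H' (Q' x) *\<^sub>R q x"
    "\<lambda>x. (\<rho> (Q' x) / 2) *\<^sub>R q x + (\<rho>' (Q' x) * (q x \<bullet> W x)) *\<^sub>R W x" "\<lambda>x. norm (G x)"
    "ellipticity C0 / (C0 + 1)" "(3 / 2 + C0) / ellipticity C0" "drift_const CARD('n) C0" M \<kappa>
  proof (intro punctured_subsolution.intro morrey_subsolution.intro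
      punctured_subsolution_axioms.intro morrey_subsolution_axioms.intro)
    show "weak_subsolution (?D - {p}) (\<lambda>x. H (Q' x)) (\<lambda>x. H' (Q' x) *\<^sub>R q x)
      (\<lambda>x. (\<rho> (Q' x) / 2) *\<^sub>R q x + (\<rho>' (Q' x) * (q x \<bullet> W x)) *\<^sub>R W x) (\<lambda>x. norm (G x))
      (ellipticity C0 / (C0 + 1)) ((3 / 2 + C0) / ellipticity C0) (drift_const CARD('n) C0)"
      using wsub by (simp add: U_def)
    show "M \<ge> 0" "0 < \<kappa>" "\<kappa> \<le> 1" using morrey by (auto simp: morrey_on_def)
    show "DIM((real, 'n) vec) > 2" using dim by simp
    show "(\<integral>\<^sup>+x. ennreal (indicator (?D - {p}) x * (norm (G x))\<^sup>2) * indicator (ball y s) x \<partial>lborel) \<le>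
        ennreal (M * s powr (real DIM((real, 'n) vec) - 2 + \<kappa>))" if s: "0 < s" "s \<le> 1" for y s
    proof -
      have "(norm (G x))\<^sup>2 = (\<Sum>i\<in>UNIV. (\<Gamma> x $ {i})\<^sup>2)" for x
        unfolding power2_norm_eq_inner by (simp add: inner_vec_def G_def power2_eq_square)
      then have "(\<integral>\<^sup>+x. ennreal (indicator (?D - {p}) x * (norm (G x))\<^sup>2) * indicator (ball y s) x \<partial>lborel) \<le>
          (\<integral>\<^sup>+x. ennreal (indicator ?D x * (\<Sum>i\<in>UNIV. (\<Gamma> x $ {i})\<^sup>2)) * indicator (ball y s) x \<partial>lborel)"
        by (intro nn_integral_mono mult_right_mono ennreal_leI) (auto simp: indicator_def sum_nonneg)
      also have "\<dots> \<le> ennreal (M * s powr (real DIM((real, 'n) vec) - 2 + \<kappa>))"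
        using morrey s by (auto simp: morrey_on_def)
      finally show ?thesis .
    qed
    have "(\<integral>\<^sup>+x. ennreal ((indicator (?D - {p}) x * H (Q' x)) powr (2 * real DIM((real, 'n) vec) / (real DIM((real, 'n) vec) - 2))) \<partial>lborel) \<le>
        (\<integral>\<^sup>+x. ennreal (hq x) \<partial>lborel)"
    proof (intro nn_integral_mono ennreal_leI)
      fix x
      show "(indicator (?D - {p}) x * H (Q' x)) powr (2 * real DIM((real, 'n) vec) / (real DIM((real, 'n) vec) - 2)) \<le> hq x"
      proof (cases "x \<in> U")
        case True
        then show ?thesis using U(2) \<Omega>(2) QQ[of x] Hn(2)[of x] by (auto simp: hq_def e_def U_def S_def)
      qed (use hq0 in \<open>simp add: U_def\<close>)
    qed
    also have "\<dots> = (\<integral>\<^sup>+x. ennreal (hq x) \<partial>lebesgue)" by (rule nn_integral_completion[symmetric])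
    also have "\<dots> = ennreal (LINT x|lebesgue. hq x)" using hqi hq0 by (intro nn_integral_eq_integral) auto
    also have "\<dots> < \<infinity>" by simp
    finally show "(\<integral>\<^sup>+x. ennreal ((indicator (?D - {p}) x * H (Q' x)) powr (2 * real DIM((real, 'n) vec) / (real DIM((real, 'n) vec) - 2))) \<partial>lborel) < \<infinity>" .
  qed
  have "(\<integral>\<^sup>+y. ennreal (indicator (?D - {p}) y * (H (Q' y))\<^sup>2) \<partial>lborel) \<le> (\<integral>\<^sup>+y. ennreal (h2 y) \<partial>lborel)"
  proof (intro nn_integral_mono ennreal_leI)
    fix y
    show "indicator (?D - {p}) y * (H (Q' y))\<^sup>2 \<le> h2 y"
    proof (cases "y \<in> U")
      case True
      then show ?thesis using U(2) QQ[of y] Hn(2)[of y] by (auto simp: h2_def U_def S_def)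
    qed (use h20 in \<open>simp add: U_def\<close>)
  qed
  also have "\<dots> = (\<integral>\<^sup>+y. ennreal (h2 y) \<partial>lebesgue)" by (rule nn_integral_completion[symmetric])
  also have "\<dots> = ennreal J" unfolding J using h2i h20 by (intro nn_integral_eq_integral) auto
  finally have "(H (Q' x))\<^sup>2 \<le> moser_const CARD('n) (ellipticity C0 / (C0 + 1)) ((3 / 2 + C0) / ellipticity C0)
      (drift_const CARD('n) C0) M \<kappa> a0 * J"
    using sup_bound[of R x J] R x J0 by simp
  then have "H (Q' x) \<le> sqrt (moser_const CARD('n) (ellipticity C0 / (C0 + 1)) ((3 / 2 + C0) / ellipticity C0)
      (drift_const CARD('n) C0) M \<kappa> a0) * sqrt J"
    unfolding real_sqrt_mult[symmetric] by (rule real_le_rsqrt)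
  moreover have "sqrt J = Lp_norm 2 ?D (\<lambda>x. H (Q x))"
    unfolding Lp_norm_def J_def[symmetric] using J0 by (simp add: powr_half_sqrt)
  moreover have "Q x = Q' x" using x \<Omega>(2) R by (intro QQ) (auto simp: S_def subset_eq)
  moreover have "Q' x * \<rho> (Q' x) \<le> (1 + 1 / (2 * ellipticity C0)) * H (Q' x)"
    by (intro flux_le_H) (simp add: Q'_def)
  moreover have "1 + 1 / (2 * ellipticity C0) > 0" using ellipticity_pos by (simp add: add_pos_pos)
  ultimately show ?thesis unfolding solution_const_def
    using mult_left_mono[of "H (Q' x)" _ "1 + 1 / (2 * ellipticity C0)"]
    by (simp only: mult.assoc) (meson less_imp_le order_trans)
qed

theorem corollary7:
  fixes C0 :: real
  assumes "CARD('n::{finite,linorder}) > 2" and "C0 > 0"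
  shows "\<exists>\<epsilon>>0. \<forall>(\<Gamma> :: 'n form) x0 R a0. R > 0 \<and> a0 > 0 \<longrightarrow>
    (\<exists>C>0. \<forall>\<Omega> p \<eta> \<omega> Q f \<rho> \<rho>' H H' C1 \<kappa>.
       open \<Omega> \<and> bounded \<Omega> \<and> connected \<Omega> \<and> interior_sphere_condition \<Omega> \<and> p \<in> \<Omega> \<and>
       closure (ball x0 (R + a0)) \<subseteq> \<Omega> \<and>
       continuous_on {0..} \<rho>' \<and>
       (\<forall>q\<ge>0. \<rho> q > 0 \<and> (\<rho> has_real_derivative \<rho>' q) (at q within {0..})) \<and>
       H 0 = 0 \<and>
       (\<forall>q\<ge>0. H' q = 1/2 * \<rho> q + q * \<rho>' q \<and>
          (H has_real_derivative H' q) (at q within {0..})) \<and>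
       (\<forall>q\<ge>0. (\<rho>' q > 0 \<longrightarrow> H' q \<le> C0 * \<rho> q) \<and> (\<rho>' q < 0 \<longrightarrow> H' q \<ge> inverse C0 * \<rho> q)) \<and>
       form_on 0 (\<Omega> - {p}) \<eta> \<and> form_on 1 (\<Omega> - {p}) \<Gamma> \<and> form_on 1 (\<Omega> - {p}) \<omega> \<and>
       smooth_on (\<Omega> - {p}) \<eta> \<and> smooth_on (\<Omega> - {p}) \<Gamma> \<and> smooth_on (\<Omega> - {p}) \<omega> \<and>
       Q = (\<lambda>x. (form_norm (\<omega> x))\<^sup>2) \<and>
       (\<forall>x\<in>\<Omega> - {p}.
          \<Gamma> x = ext_deriv \<eta> x \<and>
          ext_deriv \<omega> x = \<Gamma> x \<and>\<^sub>e \<omega> x \<and>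
          codiff 1 (\<lambda>y. \<rho> (Q y) *\<^sub>R \<omega> y) x = hodge_star (\<Gamma> x \<and>\<^sub>e hodge_star (\<rho> (Q x) *\<^sub>R \<omega> x))) \<and>
       Lp_on (2 * real CARD('n) / (real CARD('n) - 2)) \<Omega> (\<lambda>x. H (Q x)) \<and>
       f = (\<lambda>x. grad_norm \<Gamma> x + (form_norm (\<Gamma> x))\<^sup>2) \<and>
       Lp_on (real CARD('n) / 2) \<Omega> f \<and> Lp_norm (real CARD('n) / 2) \<Omega> f < \<epsilon> \<and>
       \<kappa> > 0 \<and> C1 > 0 \<and>
       (\<forall>y. \<forall>r>0. (LINT x:ball y r \<inter> \<Omega>|lebesgue. \<bar>f x\<bar> powr (real CARD('n) / 2)) \<le> C1 * r powr \<kappa>)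
       \<longrightarrow>
       bdd_above ((\<lambda>x. Q x * \<rho> (Q x)) ` (ball x0 R - {p})) \<and>
       (SUP x\<in>ball x0 R - {p}. Q x * \<rho> (Q x))
         \<le> C * Lp_norm 2 (ball x0 (R + a0)) (\<lambda>x. H (Q x)))"
proof (rule exI[of _ 1], intro conjI allI impI, goal_cases)
  case (2 \<Gamma> x0 R a0)
  then have R: "R > 0" "a0 > 0" by auto
  let ?D = "ball x0 (R + a0)" and ?F = "\<lambda>x. \<Sum>i\<in>UNIV. (\<Gamma> x $ {i})\<^sup>2"
  \<comment> \<open>\<open>C\<close> must not depend on the constants of the growth condition; this choice of Morrey
    constants refers to \<open>\<Gamma>\<close> and the ball only.\<close>
  define z where "z = (SOME z. morrey_on ?D ?F (fst z) (snd z))"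
  define C where "C = solution_const CARD('n) C0 (fst z) (snd z) a0"
  show ?case
  proof (rule exI[of _ C], rule conjI, goal_cases)
    case 1
    \<comment> \<open>Positivity must hold for every choice of \<open>z\<close>, because the
      hypotheses that guarantee Morrey constants are not yet available here.\<close>
    show ?case unfolding C_def using assms(2) by (rule solution_const_pos)
  next
    case 2
    show ?case
    proof (intro allI impI, goal_cases)
      case (1 \<Omega> p \<eta> \<omega> Q f \<rho> \<rho>' H H' C1 \<kappa>)
      then have \<Omega>: "open \<Omega>" "closure ?D \<subseteq> \<Omega>"
        and forms: "form_on 1 (\<Omega> - {p}) \<Gamma>" "form_on 1 (\<Omega> - {p}) \<omega>"
        and smooth: "smooth_on (\<Omega> - {p}) \<Gamma>" "smooth_on (\<Omega> - {p}) \<omega>"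
        and Q: "Q = (\<lambda>x. (form_norm (\<omega> x))\<^sup>2)"
        and eqs: "\<And>x. x \<in> \<Omega> - {p} \<Longrightarrow> ext_deriv \<omega> x = \<Gamma> x \<and>\<^sub>e \<omega> x"
          "\<And>x. x \<in> \<Omega> - {p} \<Longrightarrow>
            codiff 1 (\<lambda>y. \<rho> (Q y) *\<^sub>R \<omega> y) x = hodge_star (\<Gamma> x \<and>\<^sub>e hodge_star (\<rho> (Q x) *\<^sub>R \<omega> x))"
        and Lp: "Lp_on (2 * real CARD('n) / (real CARD('n) - 2)) \<Omega> (\<lambda>x. H (Q x))"
        and f: "f = (\<lambda>x. grad_norm \<Gamma> x + (form_norm (\<Gamma> x))\<^sup>2)" "Lp_on (real CARD('n) / 2) \<Omega> f"
        and pos: "\<kappa> > 0" "C1 > 0"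
        and grow: "\<And>y r. r > 0 \<Longrightarrow>
          (LINT x:ball y r \<inter> \<Omega>|lebesgue. \<bar>f x\<bar> powr (real CARD('n) / 2)) \<le> C1 * r powr \<kappa>"
        by blast+
      from 1 have \<rho>: "continuous_on {0..} \<rho>'" "H 0 = 0"
        "\<forall>q\<ge>0. \<rho> q > 0 \<and> (\<rho> has_real_derivative \<rho>' q) (at q within {0..})"
        "\<forall>q\<ge>0. H' q = 1/2 * \<rho> q + q * \<rho>' q \<and> (H has_real_derivative H' q) (at q within {0..})"
        "\<forall>q\<ge>0. (\<rho>' q > 0 \<longrightarrow> H' q \<le> C0 * \<rho> q) \<and> (\<rho>' q < 0 \<longrightarrow> H' q \<ge> inverse C0 * \<rho> q)"
        by blast+
      have "density C0 \<rho> \<rho>' H H'"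
        using assms(2) \<rho> unfolding density_def by blast
      then interpret density C0 \<rho> \<rho>' H H' .
      have D: "?D \<subseteq> \<Omega>" using \<Omega>(2) closure_subset by blast
      have "\<exists>M \<kappa>. morrey_on ?D ?F M \<kappa>"
      proof (rule morrey_on_growth[where f=f and \<Omega>=\<Omega> and p=p and ?C1.0=C1 and ?\<kappa>0.0=\<kappa>])
        show "?F x \<le> \<bar>f x\<bar>" if x: "x \<in> ?D - {p}" for x
        proof -
          have one: "card I \<noteq> 1 \<Longrightarrow> \<Gamma> x $ I = 0" for I
            using forms(1) x D by (auto simp: form_on_def)
          have "form_inner (\<Gamma> x) (\<Gamma> x) = (\<Sum>i\<in>UNIV. \<Gamma> x $ {i} * \<Gamma> x $ {i})"
            by (rule form_inner_one_form) (rule one)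
          then have "(form_norm (\<Gamma> x))\<^sup>2 = ?F x"
            unfolding form_norm_sq by (simp add: power2_eq_square)
          moreover have "grad_norm \<Gamma> x \<ge> 0" by (simp add: grad_norm_def sum_nonneg)
          ultimately show ?thesis by (simp add: f(1))
        qed
      qed (use assms \<Omega> D f(2) pos grow in auto)
      then have "\<exists>z. morrey_on ?D ?F (fst z) (snd z)" by simp
      then have z: "morrey_on ?D ?F (fst z) (snd z)" unfolding z_def by (rule someI_ex)
      have bound: "Q x * \<rho> (Q x) \<le> C * Lp_norm 2 ?D (\<lambda>x. H (Q x))" if "x \<in> ball x0 R - {p}" for x
        unfolding C_def
        by (rule solution_bound[OF assms(1) \<Omega>(1) D R forms smooth Q eqs Lp z that])
      \<comment> \<open>Needed because the supremum of an empty set of reals carries no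
        information.\<close>
      have "ball x0 R - {p} \<noteq> {}"
        using uncountable_ball[OF R(1), of x0] countable_subset[of "ball x0 R" "{p}"] by auto
      then show ?case
        by (intro conjI bdd_aboveI2[OF bound] cSUP_least[OF _ bound])
    qed
  qed
qed simp

end
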